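(* Let $H$ be a fixed graph with no isolated vertices. Then \[ \lim_{n\to\infty}\Pr{G(H,n,p)\text{ is Hamiltonian}}=\begin{cases}0 & p\le p_2^-(H),\\ 1 & p\ge p_2^+(H).\end{cases} \]
   Context: A copy of $H$ in $K_n$ is a subgraph of the complete graph on $[n]$ isomorphic to $H$. $G(H,n,p)$ is the random (multi)graph on $[n]$ obtained by including each copy of $H$ in $K_n$ independently with probability $p$ and taking the union. Let $m_1(H)$ be the number of copies of $H$ in $K_n$ containing the vertex $1$. Let $\delta(H)$ be the minimum degree of $H$, and for an integer $d\ge 0$ let $\delta_d(H)=\lceil d/\delta(H)\rceil-1$ and $p_d^{\pm}(H)=\frac{\ln n+\delta_d(H)\ln\ln n\pm x(n)}{m_1(H)}$, where $x(n)$ is any function with $1\ll x(n)\ll\ln\ln n$. *)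

theory Defs
  imports "HOL-Probability.Product_PMF" "HOL-Library.Landau_Symbols"
begin

type_synonym 'a graph = "'a set \<times> 'a set set"

abbreviation verts :: "'a graph \<Rightarrow> 'a set" where "verts \<equiv> fst"
abbreviation edges :: "'a graph \<Rightarrow> 'a set set" where "edges \<equiv> snd"

definition simple_graph :: "'a graph \<Rightarrow> bool" where
  "simple_graph G \<longleftrightarrow>
     finite (verts G) \<and> verts G \<noteq> {} \<and> (\<forall>e\<in>edges G. e \<subseteq> verts G \<and> card e = 2)"

definition vdegree :: "'a graph \<Rightarrow> 'a \<Rightarrow> nat" where
  "vdegree G v = card {e \<in> edges G. v \<in> e}"

definition isolated :: "'a graph \<Rightarrow> 'a \<Rightarrow> bool" where
  "isolated G v \<longleftrightarrow> v \<in> verts G \<and> (\<forall>e\<in>edges G. v \<notin> e)"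

definition min_degree :: "'a graph \<Rightarrow> nat" where
  "min_degree G = Min (vdegree G ` verts G)"

definition subgraph :: "'a graph \<Rightarrow> 'a graph \<Rightarrow> bool" where
  "subgraph G' G \<longleftrightarrow> simple_graph G' \<and> verts G' \<subseteq> verts G \<and> edges G' \<subseteq> edges G"

definition isomorphic :: "'a graph \<Rightarrow> 'b graph \<Rightarrow> bool" where
  "isomorphic G G' \<longleftrightarrow>
     (\<exists>f. bij_betw f (verts G) (verts G') \<and>
          (\<forall>u\<in>verts G. \<forall>v\<in>verts G. {u, v} \<in> edges G \<longleftrightarrow> {f u, f v} \<in> edges G'))"

definition hamiltonian :: "'a graph \<Rightarrow> bool" where
  "hamiltonian G \<longleftrightarrow>
     (\<exists>vs. length vs \<ge> 3 \<and> distinct vs \<and> set vs = verts G \<and>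
           (\<forall>i < length vs. {vs ! i, vs ! ((i + 1) mod length vs)} \<in> edges G))"

definition complete_graph :: "nat \<Rightarrow> nat graph" where
  "complete_graph n = ({1..n}, {e. e \<subseteq> {1..n} \<and> card e = 2})"

definition copies :: "'a graph \<Rightarrow> nat \<Rightarrow> nat graph set" where
  "copies H n = {C. subgraph C (complete_graph n) \<and> isomorphic H C}"

lemma finite_copies: "finite (copies H n)"
proof (rule finite_subset)
  show "copies H n \<subseteq> Pow {1..n} \<times> Pow (Pow {1..n})"
    by (auto simp: copies_def subgraph_def complete_graph_def)
qed simp

definition union_graph :: "nat \<Rightarrow> nat graph set \<Rightarrow> nat graph" where
  "union_graph n S = ({1..n}, \<Union>C\<in>S. edges C)"

text \<open>Multiplicities of edges covered by several copies are discarded, since a cycle of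
  length at least three uses no pair of vertices twice.\<close>

definition random_graph :: "'a graph \<Rightarrow> nat \<Rightarrow> real \<Rightarrow> nat graph pmf" where
  "random_graph H n p =
     map_pmf (\<lambda>\<omega>. union_graph n {C \<in> copies H n. \<omega> C})
       (Pi_pmf (copies H n) False (\<lambda>_. bernoulli_pmf p))"

definition m1 :: "'a graph \<Rightarrow> nat \<Rightarrow> nat" where
  "m1 H n = card {C \<in> copies H n. 1 \<in> verts C}"

definition delta :: "nat \<Rightarrow> 'a graph \<Rightarrow> int" where
  "delta d H = \<lceil>real d / real (min_degree H)\<rceil> - 1"

definition p_minus :: "nat \<Rightarrow> 'a graph \<Rightarrow> (nat \<Rightarrow> real) \<Rightarrow> nat \<Rightarrow> real" where
  "p_minus d H x n =
     (ln (real n) + real_of_int (delta d H) * ln (ln (real n)) - x n) / real (m1 H n)"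

definition p_plus :: "nat \<Rightarrow> 'a graph \<Rightarrow> (nat \<Rightarrow> real) \<Rightarrow> nat \<Rightarrow> real" where
  "p_plus d H x n =
     (ln (real n) + real_of_int (delta d H) * ln (ln (real n)) + x n) / real (m1 H n)"

end

theory Submission
  imports Defs "HOL-Real_Asymp.Real_Asymp"
begin

text \<open>
  Below the threshold a second moment argument produces a vertex of degree at most one: a vertex
  in no chosen copy if \<open>\<delta>(H) \<ge> 2\<close>, and a vertex that lies in exactly one chosen copy and is a
  leaf there if \<open>\<delta>(H) = 1\<close>.

  Above the threshold the copies are exposed in two rounds with probabilities \<open>p\<^sub>1\<close> and \<open>p\<^sub>2\<close>,
  where \<open>p\<^sub>1\<close> is still above the threshold for minimum degree two and \<open>p\<^sub>2 = x(n) / (2 m\<^sub>1)\<close>. With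
  high probability the first round is an expander: every set \<open>X\<close> of at most \<open>n/4\<close> vertices has at
  least \<open>2|X|\<close> neighbours. For large \<open>X\<close> this is a union bound; for small \<open>X\<close> it holds because
  few copies meet a small set in two or more vertices, and vertices in few copies are far apart.
  By Posa's rotations, a non-Hamiltonian expander has at least
  \<open>n\<^sup>2/32\<close> boosters, that is, pairs of vertices whose addition as an edge closes a Hamilton cycle or
  lengthens the longest path. If the union of both rounds is not Hamiltonian, then some family of at
  most \<open>n\<close> copies of the second round can be added to the first one so that no copy of the second
  round contains a booster any more. The expected number of copies in the second round
  is of order \<open>n x(n)\<close>, and a constant fraction of all copies contains a booster, so a union
  bound over these families suffices.
\<close>

section \<open>Random subsets\<close>

text \<open>Edges of the random graph are dependent, copies are not, so every event is phrased for
  the random set of chosen copies. The natural parameter is \<open>M = m1 H n * p\<close>, the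
  expected number of chosen copies at a vertex, about \<open>ln n\<close> at the threshold. A vertex
  lies in no chosen copy with probability about \<open>exp (- M)\<close> and in exactly one with
  probability about \<open>M * exp (- M)\<close>. One copy already gives degree two if the minimum
  degree of \<open>H\<close> is at least two; otherwise a vertex can be a leaf of its only copy, and
  the extra factor \<open>M\<close> is what the term \<open>ln (ln n)\<close> compensates. The
  difficulty in the second round is that the boosters change as copies are added. Fixing the family
  \<open>T'\<close> of added copies fixes the graph whose boosters are counted. As no member of
  \<open>T'\<close> contains a booster of that graph, choosing all of \<open>T'\<close> and choosing
  no copy with a booster concern disjoint sets of copies, hence are independent. A plain count of
  the families would be far too large; weighting each by its probability \<open>r ^ card T'\<close>
  of being chosen makes the sum manageable.\<close>

definition random_subset :: "'b set \<Rightarrow> real \<Rightarrow> 'b set pmf" where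
  "random_subset A p = map_pmf (\<lambda>\<omega>. {C \<in> A. \<omega> C}) (Pi_pmf A False (\<lambda>_. bernoulli_pmf p))"

abbreviation subset_prob :: "'b set \<Rightarrow> real \<Rightarrow> 'b set set \<Rightarrow> real" where
  "subset_prob A p \<equiv> measure_pmf.prob (random_subset A p)"

lemma set_pmf_random_subset: "set_pmf (random_subset A p) \<subseteq> Pow A"
  by (auto simp: random_subset_def)

lemma finite_set_pmf_random_subset: "finite A \<Longrightarrow> finite (set_pmf (random_subset A p))"
  by (rule finite_subset[OF set_pmf_random_subset]) simp

lemma integrable_random_subset [simp]:
  fixes f :: "_ \<Rightarrow> real"
  shows "finite A \<Longrightarrow> integrable (measure_pmf (random_subset A p)) f"
  by (rule integrable_measure_pmf_finite[OF finite_set_pmf_random_subset])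

text \<open>The integrand is a product over \<open>A\<close>: a member of \<open>F\<close>
  contributes 1 if chosen and 0 otherwise, one of \<open>B\<close> contributes \<open>t\<close> if
  chosen and 1 otherwise, all others contribute 1. Independence turns this into a product of
  two-point expectations.\<close>

lemma expectation_random_subset:
  assumes A: "finite A" "F \<subseteq> A" "B \<subseteq> A" "F \<inter> B = {}" and p: "0 \<le> p" "p \<le> 1" and t: "0 \<le> t"
  shows "measure_pmf.expectation (random_subset A p) (\<lambda>S. of_bool (F \<subseteq> S) * t ^ card (S \<inter> B))
         = p ^ card F * (1 - (1 - t) * p) ^ card B"
proof -
  define f :: "_ \<Rightarrow> bool \<Rightarrow> real" where
    "f = (\<lambda>x b. if x \<in> F then of_bool b else if x \<in> B then (if b then t else 1) else 1)"
  have fin: "finite F" "finite B" using A by (auto intro: finite_subset)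
  have split: "(\<Prod>x\<in>A. g x) = (\<Prod>x\<in>F. g x) * (\<Prod>x\<in>B. g x)"
    if "\<And>x. x \<in> A - F - B \<Longrightarrow> g x = 1" for g :: "_ \<Rightarrow> real"
  proof -
    have "(\<Prod>x\<in>A. g x) = (\<Prod>x\<in>F \<union> B. g x)"
      by (rule prod.mono_neutral_right) (use A that in auto)
    also have "\<dots> = (\<Prod>x\<in>F. g x) * (\<Prod>x\<in>B. g x)"
      by (rule prod.union_disjoint) (use A fin in auto)
    finally show ?thesis .
  qed
  have point: "of_bool (F \<subseteq> {C\<in>A. \<omega> C}) * t ^ card ({C\<in>A. \<omega> C} \<inter> B) = (\<Prod>x\<in>A. f x (\<omega> x))" for \<omega>
  proof -
    have "(\<Prod>x\<in>A. f x (\<omega> x)) = (\<Prod>x\<in>F. f x (\<omega> x)) * (\<Prod>x\<in>B. f x (\<omega> x))"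
      by (rule split) (auto simp: f_def)
    also have "(\<Prod>x\<in>F. f x (\<omega> x)) = (\<Prod>x\<in>F. of_bool (\<omega> x))"
      by (rule prod.cong) (auto simp: f_def)
    also have "\<dots> = of_bool (F \<subseteq> {C\<in>A. \<omega> C})"
    proof (cases "\<forall>x\<in>F. \<omega> x")
      case True
      then show ?thesis using A by auto
    next
      case False
      then obtain y where "y \<in> F" "\<not> \<omega> y" by blast
      then show ?thesis using fin by (subst prod_zero) auto
    qed
    also have "(\<Prod>x\<in>B. f x (\<omega> x)) = (\<Prod>x\<in>B. if \<omega> x then t else 1)"
      by (rule prod.cong) (use A in \<open>auto simp: f_def\<close>)
    also have "\<dots> = t ^ card {x\<in>B. \<omega> x}"
      using fin by (subst prod.inter_filter[symmetric]) auto
    also have "{x\<in>B. \<omega> x} = {C\<in>A. \<omega> C} \<inter> B" using A by auto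
    finally show ?thesis by simp
  qed
  have "measure_pmf.expectation (random_subset A p) (\<lambda>S. of_bool (F \<subseteq> S) * t ^ card (S \<inter> B))
    = measure_pmf.expectation (Pi_pmf A False (\<lambda>_. bernoulli_pmf p)) (\<lambda>\<omega>. \<Prod>x\<in>A. f x (\<omega> x))"
    unfolding random_subset_def by (simp add: point)
  also have "\<dots> = (\<Prod>x\<in>A. measure_pmf.expectation (bernoulli_pmf p) (f x))"
    by (rule expectation_prod_Pi_pmf) (use A t in \<open>auto simp: f_def integrable_measure_pmf_finite\<close>)
  also have "\<dots> = (\<Prod>x\<in>A. p * f x True + (1 - p) * f x False)"
    using p by (simp add: mult.commute)
  also have "\<dots> = (\<Prod>x\<in>F. p * f x True + (1 - p) * f x False) * (\<Prod>x\<in>B. p * f x True + (1 - p) * f x False)"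
    by (rule split) (auto simp: f_def)
  also have "(\<Prod>x\<in>F. p * f x True + (1 - p) * f x False) = (\<Prod>x\<in>F. p)"
    by (rule prod.cong) (auto simp: f_def)
  also have "(\<Prod>x\<in>B. p * f x True + (1 - p) * f x False) = (\<Prod>x\<in>B. 1 - (1 - t) * p)"
    by (rule prod.cong) (use A in \<open>auto simp: f_def algebra_simps\<close>)
  finally show ?thesis by simp
qed

text \<open>The case \<open>t = 0\<close>: as \<open>0 ^ 0 = 1\<close>, the power
  \<open>0 ^ card (S \<inter> B)\<close> is the indicator of an empty intersection.\<close>

lemma prob_random_subset:
  assumes "finite A" "F \<subseteq> A" "B \<subseteq> A" "F \<inter> B = {}" "0 \<le> p" "p \<le> 1"
  shows "subset_prob A p {S. F \<subseteq> S \<and> S \<inter> B = {}} = p ^ card F * (1 - p) ^ card B"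
proof -
  have "subset_prob A p {S. F \<subseteq> S \<and> S \<inter> B = {}}
     = measure_pmf.expectation (random_subset A p) (indicator {S. F \<subseteq> S \<and> S \<inter> B = {}})"
    by simp
  also have "\<dots> = measure_pmf.expectation (random_subset A p) (\<lambda>S. of_bool (F \<subseteq> S) * 0 ^ card (S \<inter> B))"
    by (rule integral_cong_AE)
       (use assms in \<open>auto intro!: AE_pmfI simp: indicator_def power_0_left card_eq_0_iff dest: finite_subset\<close>)
  also have "\<dots> = p ^ card F * (1 - p) ^ card B"
    using expectation_random_subset[OF assms, of 0] by simp
  finally show ?thesis .
qed

text \<open>A union bound over events "\<open>F i\<close> is chosen and few (\<open>t i < 1\<close>) or many (\<open>t i > 1\<close>) members of
  \<open>B i\<close> are", each estimated by an exponential moment; \<open>t i = 0\<close> means that none is.\<close>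
lemma prob_random_subset_union_bound:
  assumes A: "finite A" and p: "0 \<le> p" "p \<le> 1" and I: "finite I"
    and F: "\<And>i. i \<in> I \<Longrightarrow> F i \<subseteq> A \<and> B i \<subseteq> A \<and> F i \<inter> B i = {} \<and> 0 \<le> t i \<and> 0 \<le> c i"
    and Q: "\<And>S. S \<subseteq> A \<Longrightarrow> Q S \<Longrightarrow> \<exists>i\<in>I. F i \<subseteq> S \<and> 1 \<le> c i * t i ^ card (S \<inter> B i)"
  shows "subset_prob A p {S. Q S}
     \<le> (\<Sum>i\<in>I. c i * (p ^ card (F i) * (1 - (1 - t i) * p) ^ card (B i)))"
proof -
  have "subset_prob A p {S. Q S}
     = measure_pmf.expectation (random_subset A p) (indicator {S. Q S})"
    by simp
  also have "\<dots> \<le> measure_pmf.expectation (random_subset A p)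
      (\<lambda>S. \<Sum>i\<in>I. c i * (of_bool (F i \<subseteq> S) * t i ^ card (S \<inter> B i)))"
  proof (rule integral_mono_AE)
    show "AE S in measure_pmf (random_subset A p). indicator {S. Q S} S
        \<le> (\<Sum>i\<in>I. c i * (of_bool (F i \<subseteq> S) * t i ^ card (S \<inter> B i)))"
    proof (rule AE_pmfI)
      fix S assume "S \<in> set_pmf (random_subset A p)"
      then have S: "S \<subseteq> A" using set_pmf_random_subset by auto
      have nn: "0 \<le> c i * (of_bool (F i \<subseteq> S) * t i ^ card (S \<inter> B i))" if "i \<in> I" for i
        using F[OF that] by auto
      show "indicator {S. Q S} S \<le> (\<Sum>i\<in>I. c i * (of_bool (F i \<subseteq> S) * t i ^ card (S \<inter> B i)))"
      proof (cases "Q S")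
        case True
        then obtain i where i: "i \<in> I" "F i \<subseteq> S" "1 \<le> c i * t i ^ card (S \<inter> B i)"
          using Q[OF S] by blast
        have "1 \<le> c i * (of_bool (F i \<subseteq> S) * t i ^ card (S \<inter> B i))" using i by simp
        also have "\<dots> \<le> (\<Sum>i\<in>I. c i * (of_bool (F i \<subseteq> S) * t i ^ card (S \<inter> B i)))"
          by (rule member_le_sum) (use i nn I in auto)
        finally show ?thesis using True by simp
      next
        case False
        then show ?thesis using nn by (auto intro!: sum_nonneg)
      qed
    qed
  qed (use A in auto)
  also have "\<dots> = (\<Sum>i\<in>I. c i * measure_pmf.expectation (random_subset A p)
      (\<lambda>S. of_bool (F i \<subseteq> S) * t i ^ card (S \<inter> B i)))"
    using A by (subst Bochner_Integration.integral_sum) auto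
  also have "\<dots> = (\<Sum>i\<in>I. c i * (p ^ card (F i) * (1 - (1 - t i) * p) ^ card (B i)))"
    by (rule sum.cong) (use A F p in \<open>auto simp: expectation_random_subset\<close>)
  finally show ?thesis .
qed

section \<open>Two independent rounds, and monotonicity in the probability\<close>

text \<open>A member is missed by both rounds with probability \<open>(1 - p) * (1 - r)\<close>,
  which is one minus the combined parameter.\<close>

lemma random_subset_union:
  assumes A: "finite A" and p: "0 \<le> p" "p \<le> 1" "0 \<le> r" "r \<le> 1"
  shows "random_subset A (p + r - p * r)
       = bind_pmf (random_subset A p) (\<lambda>S. map_pmf (\<lambda>T. S \<union> T) (random_subset A r))"
proof -
  have pr: "0 \<le> p + r - p * r" "p + r - p * r \<le> 1"
  proof -
    have "p * r \<le> p" using p by (simp add: mult_left_le)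
    then show "0 \<le> p + r - p * r" using p by simp
    have "0 \<le> (1 - p) * (1 - r)" using p by simp
    then show "p + r - p * r \<le> 1" by (simp add: algebra_simps)
  qed
  have bern: "bernoulli_pmf (p + r - p * r)
      = bind_pmf (bernoulli_pmf p) (\<lambda>a. bind_pmf (bernoulli_pmf r) (\<lambda>b. return_pmf (a \<or> b)))"
  proof (rule pmf_eqI)
    fix x
    show "pmf (bernoulli_pmf (p + r - p * r)) x
      = pmf (bind_pmf (bernoulli_pmf p) (\<lambda>a. bind_pmf (bernoulli_pmf r) (\<lambda>b. return_pmf (a \<or> b)))) x"
      using p pr by (cases x) (simp_all add: pmf_bind algebra_simps)
  qed
  have "Pi_pmf A False (\<lambda>_. bernoulli_pmf (p + r - p * r))
     = bind_pmf (Pi_pmf A False (\<lambda>_. bernoulli_pmf p)) (\<lambda>f.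
         bind_pmf (Pi_pmf A False (\<lambda>_. bernoulli_pmf r)) (\<lambda>g.
           return_pmf (\<lambda>x. if x \<in> A then f x \<or> g x else False)))"
    unfolding bern using A
    by (subst Pi_pmf_bind[where d' = False], simp, subst Pi_pmf_bind[where d' = False], simp, simp)
  then show ?thesis
    unfolding random_subset_def map_pmf_def
    by (auto simp: bind_assoc_pmf bind_return_pmf intro!: bind_pmf_cong)
qed

lemma prob_bind_pmf:
  assumes "integrable (measure_pmf M) (\<lambda>x. measure_pmf.prob (N x) X)"
  shows "measure_pmf.prob (bind_pmf M N) X = measure_pmf.expectation M (\<lambda>x. measure_pmf.prob (N x) X)"
proof -
  have "ennreal (measure_pmf.prob (bind_pmf M N) X) = (\<integral>\<^sup>+x. ennreal (measure_pmf.prob (N x) X) \<partial>M)"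
    by (simp flip: measure_pmf.emeasure_eq_measure)
  also have "\<dots> = ennreal (measure_pmf.expectation M (\<lambda>x. measure_pmf.prob (N x) X))"
    by (rule nn_integral_eq_integral) (use assms in auto)
  finally show ?thesis
    by (subst (asm) ennreal_inj) auto
qed

lemma prob_random_subset_union:
  assumes "finite A" "0 \<le> p" "p \<le> 1" "0 \<le> r" "r \<le> 1"
  shows "subset_prob A (p + r - p * r) X
       = measure_pmf.expectation (random_subset A p)
           (\<lambda>S. subset_prob A r {T. S \<union> T \<in> X})"
  unfolding random_subset_union[OF assms]
  by (subst prob_bind_pmf) (auto simp: vimage_def intro: integrable_random_subset[OF assms(1)])

text \<open>Condition on the first round: a bad outcome is charged in full, and after a good one the
  second round contributes at most \<open>e\<close>.\<close>

lemma prob_random_subset_union_le: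
  assumes A: "finite A" and p: "0 \<le> p" "p \<le> 1" "0 \<le> r" "r \<le> 1"
    and e: "0 \<le> e" "\<And>S. S \<subseteq> A \<Longrightarrow> Q S \<Longrightarrow> subset_prob A r {T. S \<union> T \<in> X} \<le> e"
  shows "subset_prob A (p + r - p * r) X
       \<le> subset_prob A p {S. \<not> Q S} + e"
proof -
  have "subset_prob A (p + r - p * r) X
     \<le> measure_pmf.expectation (random_subset A p) (\<lambda>S. indicator {S. \<not> Q S} S + e)"
    unfolding prob_random_subset_union[OF A p]
  proof (rule integral_mono_AE)
    show "AE S in measure_pmf (random_subset A p).
        subset_prob A r {T. S \<union> T \<in> X} \<le> indicator {S. \<not> Q S} S + e"
    proof (rule AE_pmfI)
      fix S assume "S \<in> set_pmf (random_subset A p)"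
      then have "S \<subseteq> A" using set_pmf_random_subset by auto
      moreover have "subset_prob A r {T. S \<union> T \<in> X} \<le> 1" by simp
      ultimately show "subset_prob A r {T. S \<union> T \<in> X} \<le> indicator {S. \<not> Q S} S + e"
        using e by (cases "Q S") (auto intro: order_trans)
    qed
  qed (use A in auto)
  also have "\<dots> = subset_prob A p {S. \<not> Q S} + e"
    using A by (subst Bochner_Integration.integral_add) auto
  finally show ?thesis .
qed

text \<open>Coupling: the denser random subset is the sparser one together with an independent
  second round, whose parameter \<open>r\<close> solves \<open>p + r - p * r = p'\<close>.\<close>

lemma prob_random_subset_mono:
  assumes A: "finite A" and p: "0 \<le> p" "p \<le> p'" "p' \<le> 1"
    and Q: "\<And>S T. Q S \<Longrightarrow> S \<subseteq> T \<Longrightarrow> Q T"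
  shows "subset_prob A p {S. Q S} \<le> measure_pmf.prob (random_subset A p') {S. Q S}"
proof (cases "p = 1")
  case False
  then have p1: "p < 1" using p by simp
  define r where "r = (p' - p) / (1 - p)"
  have r: "0 \<le> r" "r \<le> 1" using p p1 by (auto simp: r_def divide_simps)
  have eq: "p + r - p * r = p'"
  proof -
    have "r * (1 - p) = p' - p" using p1 by (simp add: r_def)
    then show ?thesis by (simp add: algebra_simps)
  qed
  have "subset_prob A p {S. Q S}
     = measure_pmf.expectation (random_subset A p) (indicator {S. Q S})" by simp
  also have "\<dots> \<le> measure_pmf.expectation (random_subset A p)
       (\<lambda>S. subset_prob A r {T. S \<union> T \<in> {S. Q S}})"
  proof (rule integral_mono)
    fix S
    show "indicator {S. Q S} S \<le> subset_prob A r {T. S \<union> T \<in> {S. Q S}}"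
    proof (cases "Q S")
      case True
      then have "{T. S \<union> T \<in> {S. Q S}} = UNIV" using Q by auto
      then show ?thesis by simp
    qed simp
  qed (use A in auto)
  also have "\<dots> = measure_pmf.prob (random_subset A p') {S. Q S}"
    using prob_random_subset_union[OF A _ _ r, of p] p p1 eq by simp
  finally show ?thesis .
qed (use p in auto)

section \<open>Weighted counts of subsets of bounded size\<close>

text \<open>As \<open>y \<le> 1\<close>, every counted \<open>T\<close> satisfies
  \<open>y ^ k \<le> y ^ card T\<close>, and the sum of \<open>y ^ card T\<close> over all subsets
  is \<open>(1 + y) ^ card V\<close>. With \<open>y = k / card V\<close> this is the usual bound
  \<open>(e * card V / k) ^ k\<close>.\<close>

lemma card_bounded_subsets_le:
  fixes y :: real
  assumes V: "finite V" and y: "0 < y" "y \<le> 1"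
  shows "real (card {T. T \<subseteq> V \<and> card T \<le> k}) \<le> (1 / y) ^ k * exp (y * card V)"
proof -
  have "y ^ k * real (card {T. T \<subseteq> V \<and> card T \<le> k}) = (\<Sum>T\<in>{T. T \<subseteq> V \<and> card T \<le> k}. y ^ k)" by simp
  also have "\<dots> \<le> (\<Sum>T\<in>{T. T \<subseteq> V \<and> card T \<le> k}. y ^ card T)"
    using y by (intro sum_mono power_decreasing) auto
  also have "\<dots> \<le> (\<Sum>T\<in>Pow V. y ^ card T)"
    using y V by (intro sum_mono2) auto
  also have "\<dots> = (\<Prod>x\<in>V. y + 1)"
    by (subst prod_add[OF V]) simp
  also have "\<dots> = (1 + y) ^ card V" by (simp add: add.commute)
  also have "\<dots> \<le> exp y ^ card V"
    using y by (intro power_mono) auto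
  also have "\<dots> = exp (y * card V)" by (simp add: exp_of_nat2_mult)
  finally show ?thesis using y by (simp add: field_simps)
qed

text \<open>The same weighting: \<open>r ^ j \<le> t ^ k * (r / t) ^ j\<close> for
  \<open>j \<le> k\<close>. The free parameter \<open>t\<close> trades the factor
  \<open>t ^ k\<close> against the exponent \<open>r * card A / t\<close>.\<close>

lemma sum_bounded_subsets_le:
  fixes r t :: real
  assumes A: "finite A" and r: "0 \<le> r" and t: "1 \<le> t"
  shows "(\<Sum>T\<in>{T. T \<subseteq> A \<and> card T \<le> k}. r ^ card T) \<le> t ^ k * exp (r * card A / t)"
proof -
  have "(\<Sum>T\<in>{T. T \<subseteq> A \<and> card T \<le> k}. r ^ card T) \<le> (\<Sum>T\<in>{T. T \<subseteq> A \<and> card T \<le> k}. t ^ k * (r / t) ^ card T)"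
  proof (rule sum_mono)
    fix T assume T: "T \<in> {T. T \<subseteq> A \<and> card T \<le> k}"
    have "r ^ card T = t ^ card T * (r / t) ^ card T" using t by (simp add: power_mult_distrib[symmetric])
    also have "\<dots> \<le> t ^ k * (r / t) ^ card T"
      using T t r by (intro mult_right_mono power_increasing) auto
    finally show "r ^ card T \<le> t ^ k * (r / t) ^ card T" .
  qed
  also have "\<dots> \<le> (\<Sum>T\<in>Pow A. t ^ k * (r / t) ^ card T)"
    using r t A by (intro sum_mono2) auto
  also have "\<dots> = t ^ k * (\<Prod>x\<in>A. r / t + 1)"
    by (subst prod_add[OF A]) (simp add: sum_distrib_left)
  also have "(\<Prod>x\<in>A. r / t + 1) = (1 + r / t) ^ card A" by (simp add: add.commute)
  also have "\<dots> \<le> exp (r / t) ^ card A"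
    using r t by (intro power_mono) auto
  also have "\<dots> = exp (r * card A / t)" by (simp flip: exp_of_nat2_mult)
  finally show ?thesis using t by (simp add: mult_left_mono)
qed

section \<open>Rotations and boosters\<close>

definition nbh :: "'v set set \<Rightarrow> 'v set \<Rightarrow> 'v set" where
  "nbh E X = {y. y \<notin> X \<and> (\<exists>x\<in>X. {x, y} \<in> E)}"

definition expander :: "'v set \<Rightarrow> 'v set set \<Rightarrow> bool" where
  "expander V E \<longleftrightarrow> (\<forall>X. X \<subseteq> V \<and> X \<noteq> {} \<and> 4 * card X \<le> card V \<longrightarrow> 2 * card X \<le> card (nbh E X))"

definition gpath :: "'v set \<Rightarrow> 'v set set \<Rightarrow> 'v list \<Rightarrow> bool" where
  "gpath V E xs \<longleftrightarrow> xs \<noteq> [] \<and> distinct xs \<and> set xs \<subseteq> V \<and> successively (\<lambda>x y. {x, y} \<in> E) xs"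

definition path_order :: "'v set \<Rightarrow> 'v set set \<Rightarrow> nat" where
  "path_order V E = Max (length ` {xs. gpath V E xs})"

text \<open>A pair that is already an edge counts exactly when the graph is Hamiltonian. Hence no
  edge of a non-Hamiltonian graph is a booster, while the lower bound on the number of boosters
  needs no case distinction.\<close>

definition boosters :: "'v set \<Rightarrow> 'v set set \<Rightarrow> 'v set set" where
  "boosters V E = {e. e \<subseteq> V \<and> card e = 2 \<and>
     (hamiltonian (V, insert e E) \<or> path_order V E < path_order V (insert e E))}"

text \<open>Being consecutive on the path, in either order: this symmetric relation is invariant
  under reversal, so a rotation changes it only where the path is cut and glued.\<close>

fun adj :: "'v list \<Rightarrow> 'v \<Rightarrow> 'v \<Rightarrow> bool" where
  "adj (a # b # xs) x y \<longleftrightarrow> (x = a \<and> y = b) \<or> (x = b \<and> y = a) \<or> adj (b # xs) x y"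
| "adj _ x y \<longleftrightarrow> False"

text \<open>Posa's rotation with the first vertex kept fixed: the edge from the last vertex back to
  \<open>u\<close> replaces the path edge from \<open>u\<close> to \<open>z\<close>, and
  \<open>z\<close> becomes the new last vertex.\<close>

inductive rotation :: "'v set set \<Rightarrow> 'v list \<Rightarrow> 'v list \<Rightarrow> bool" for E P where
  rot_refl: "rotation E P P"
| rot_step: "rotation E P (ys @ u # z # zs) \<Longrightarrow> {last (z # zs), u} \<in> E \<Longrightarrow> rotation E P (ys @ u # rev (z # zs))"

definition ends :: "'v set set \<Rightarrow> 'v list \<Rightarrow> 'v set" where
  "ends E P = {last Q | Q. rotation E P Q}"

lemma adj_append:
  "xs \<noteq> [] \<Longrightarrow> ys \<noteq> [] \<Longrightarrow> adj (xs @ ys) x y \<longleftrightarrow>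
     adj xs x y \<or> adj ys x y \<or> (x = last xs \<and> y = hd ys) \<or> (x = hd ys \<and> y = last xs)"
proof (induction xs rule: induct_list012)
  case (2 a)
  then show ?case by (cases ys) auto
qed auto

lemma adj_rev: "adj (rev xs) x y \<longleftrightarrow> adj xs x y"
proof (induction xs)
  case (Cons a xs)
  show ?case
  proof (cases "xs = []")
    case False
    then have "adj (rev (a # xs)) x y \<longleftrightarrow> adj (rev xs) x y \<or> (x = hd xs \<and> y = a) \<or> (x = a \<and> y = hd xs)"
      by (simp add: adj_append last_rev)
    also have "\<dots> \<longleftrightarrow> adj ([a] @ xs) x y"
      using Cons False by (subst adj_append) auto
    finally show ?thesis by simp
  qed simp
qed simp

lemma adj_nth:
  "adj xs x y \<Longrightarrow> \<exists>i. Suc i < length xs \<and> (x = xs ! i \<and> y = xs ! Suc i \<or> x = xs ! Suc i \<and> y = xs ! i)"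
proof (induction xs rule: induct_list012)
  case (3 a b xs)
  show ?case
  proof (cases "adj (b # xs) x y")
    case True
    then obtain i where "Suc i < length (b # xs)"
      "x = (b # xs) ! i \<and> y = (b # xs) ! Suc i \<or> x = (b # xs) ! Suc i \<and> y = (b # xs) ! i"
      using 3 by blast
    then show ?thesis by (intro exI[of _ "Suc i"]) auto
  next
    case False
    then show ?thesis using 3 by (intro exI[of _ 0]) auto
  qed
qed auto

text \<open>A vertex of \<open>R\<close> has at most one successor and one predecessor on
  \<open>P\<close>, and \<open>last P\<close> has no successor, which makes the inequality
  strict.\<close>

lemma card_adj_less:
  assumes P: "distinct P" "P \<noteq> []" and R: "finite R" "last P \<in> R"
  shows "card {x. \<exists>y\<in>R. adj P x y} < 2 * card R"
proof -
  define I J where "I = {i. Suc i < length P \<and> P ! i \<in> R}" and "J = {i. Suc i < length P \<and> P ! Suc i \<in> R}"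
  have fin: "finite I" "finite J"
    by (rule finite_subset[of _ "{..<length P}"]; auto simp: I_def J_def)+
  have "{x. \<exists>y\<in>R. adj P x y} \<subseteq> (\<lambda>i. P ! Suc i) ` I \<union> (\<lambda>i. P ! i) ` J"
    by (auto dest!: adj_nth simp: I_def J_def)
  then have "card {x. \<exists>y\<in>R. adj P x y} \<le> card ((\<lambda>i. P ! Suc i) ` I \<union> (\<lambda>i. P ! i) ` J)"
    using fin by (intro card_mono) auto
  also have "\<dots> \<le> card I + card J"
    using fin card_image_le card_Un_le by (meson add_mono le_trans)
  also have "card I \<le> card (R - {last P})"
  proof (rule card_inj_on_le[where f = "\<lambda>i. P ! i"])
    show "inj_on ((!) P) I" using P by (auto simp: inj_on_def I_def nth_eq_iff_index_eq)
    show "(!) P ` I \<subseteq> R - {last P}"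
      using P by (auto simp: I_def last_conv_nth nth_eq_iff_index_eq)
  qed (use R in auto)
  also have "card J \<le> card R"
    by (rule card_inj_on_le[where f = "\<lambda>i. P ! Suc i"])
       (use P R in \<open>auto simp: inj_on_def J_def nth_eq_iff_index_eq\<close>)
  finally have "card {x. \<exists>y\<in>R. adj P x y} \<le> card (R - {last P}) + card R" by simp
  moreover have "card R > 0" using R card_gt_0_iff by blast
  ultimately show ?thesis using R by (simp add: card_Diff_singleton)
qed

lemma rotation_gpath:
  assumes "rotation E P Q" "gpath V E P"
  shows "gpath V E Q \<and> set Q = set P \<and> hd Q = hd P"
  using assms
proof induction
  case (rot_step ys u z zs)
  then have IH: "gpath V E (ys @ u # z # zs)" "set (ys @ u # z # zs) = set P" "hd (ys @ u # z # zs) = hd P"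
    by blast+
  have 1: "successively (\<lambda>x y. {x, y} \<in> E) (rev (z # zs))"
    using IH(1) unfolding successively_rev insert_commute[of _ "_::'v" "{}"]
    by (auto simp: gpath_def successively_append_iff successively_Cons)
  have 2: "{last (ys @ [u]), hd (rev (z # zs))} \<in> E"
    using rot_step(2) by (simp only: hd_rev last_snoc insert_commute)
  have 3: "successively (\<lambda>x y. {x, y} \<in> E) (ys @ [u])"
    using IH(1) by (auto simp: gpath_def successively_append_iff)
  have "successively (\<lambda>x y. {x, y} \<in> E) ((ys @ [u]) @ rev (z # zs))"
    using 1 2 3 unfolding successively_append_iff by blast
  then have "successively (\<lambda>x y. {x, y} \<in> E) (ys @ u # rev (z # zs))" by simp
  moreover have "hd (ys @ u # rev (z # zs)) = hd (ys @ u # z # zs)" by (cases ys) auto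
  ultimately show ?case
    using IH by (auto simp: gpath_def)
qed simp

text \<open>An edge of the initial path survives a rotation unless one of its ends becomes an end
  of some rotated path.\<close>
lemma adj_rotation:
  assumes "rotation E P Q" "x \<notin> ends E P" "\<And>y. y \<in> ends E P \<Longrightarrow> \<not> adj P x y" "adj Q x y"
  shows "adj P x y"
  using assms
proof (induction arbitrary: y)
  case (rot_step ys u z zs)
  have Q: "adj (ys @ u # z # zs) x y \<longleftrightarrow> adj (ys @ [u]) x y \<or> adj (z # zs) x y \<or> x = u \<and> y = z \<or> x = z \<and> y = u" for y
    using adj_append[of "ys @ [u]" "z # zs" x y] by simp
  have Q': "adj (ys @ u # rev (z # zs)) x y \<longleftrightarrow> adj (ys @ [u]) x y \<or> adj (z # zs) x y
      \<or> x = u \<and> y = last (z # zs) \<or> x = last (z # zs) \<and> y = u"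
    using adj_append[of "ys @ [u]" "rev (z # zs)" x y] adj_rev[of "z # zs" x y] by (simp add: hd_rev)
  have 1: "last (z # zs) \<in> ends E P"
    using rot_step(1) unfolding ends_def by (auto intro!: exI[of _ "ys @ u # z # zs"])
  have 2: "z \<in> ends E P"
    using rotation.rot_step[OF rot_step(1,2)] unfolding ends_def by (auto intro!: exI[of _ "ys @ u # rev (z # zs)"])
  have "x \<noteq> last (z # zs)" using 1 rot_step by metis
  \<comment> \<open>Only the pivot \<open>u\<close> and the old last vertex get a new path
    neighbour. If \<open>x\<close> were the pivot, the new end \<open>z\<close> would be next to
    \<open>x\<close> on \<open>P\<close> already, by induction.\<close>
  moreover have "x \<noteq> u"
  proof
    assume "x = u"
    then have "adj P x z" using rot_step.IH[of z] rot_step.prems Q by blast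
    then show False using 2 rot_step.prems by blast
  qed
  ultimately have "adj (ys @ u # z # zs) x y" using rot_step.prems Q Q' by blast
  then show ?case using rot_step by blast
qed

text \<open>The vertex \<open>x\<close> is joined to the last vertex of some rotated path
  \<open>Q\<close>. Rotating \<open>Q\<close> at \<open>x\<close> makes the successor
  \<open>z\<close> of \<open>x\<close> an end. If no end were next to \<open>x\<close> on
  \<open>P\<close>, then by \<open>adj_rotation\<close> the path edge from \<open>x\<close> to
  \<open>z\<close> would already belong to \<open>P\<close>, a contradiction.\<close>

lemma nbh_ends_adj:
  assumes P: "gpath V E P" and sub: "nbh E (ends E P) \<subseteq> set P" and x: "x \<in> nbh E (ends E P)"
  shows "\<exists>y\<in>ends E P. adj P x y"
proof (rule ccontr)
  assume no: "\<not> ?thesis"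
  obtain Q where Q: "rotation E P Q" "{last Q, x} \<in> E" and xe: "x \<notin> ends E P"
    using x by (auto simp: nbh_def ends_def)
  have "x \<in> set Q" using rotation_gpath[OF Q(1) P] sub x by auto
  then obtain ys zs where Qs: "Q = ys @ x # zs" by (meson split_list)
  have "x \<noteq> last Q" using Q xe by (auto simp: ends_def)
  then obtain z zs' where zs: "zs = z # zs'" using Qs by (cases zs) auto
  have "rotation E P (ys @ x # rev (z # zs'))"
    by (rule rotation.rot_step) (use Q Qs zs in auto)
  then have "z \<in> ends E P" unfolding ends_def by (auto intro!: exI[of _ "ys @ x # rev (z # zs')"])
  moreover have "adj Q x z" using Qs zs adj_append[of "ys @ [x]" "z # zs'"] by simp
  ultimately show False using adj_rotation[OF Q(1) xe] no by blast
qed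

section \<open>Longest paths in a finite graph, Posa's lemma and boosters\<close>

locale finite_graph =
  fixes V :: "'v set" and E :: "'v set set"
  assumes finV: "finite V" and neV: "V \<noteq> {}" and edgesV: "\<And>e. e \<in> E \<Longrightarrow> e \<subseteq> V"
begin

lemma finite_paths: "finite {xs. gpath V E xs}"
proof (rule finite_subset)
  show "{xs. gpath V E xs} \<subseteq> {xs. set xs \<subseteq> V \<and> length xs \<le> card V}"
    using finV by (auto simp: gpath_def distinct_card[symmetric] intro!: card_mono)
  show "finite {xs. set xs \<subseteq> V \<and> length xs \<le> card V}"
    by (rule finite_lists_length_le[OF finV])
qed

lemma gpath_length_le: "gpath V E xs \<Longrightarrow> length xs \<le> path_order V E"
  unfolding path_order_def using finite_paths by (intro Max_ge) auto

lemma longest_path: obtains P where "gpath V E P" "length P = path_order V E"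
proof -
  obtain v where "v \<in> V" using neV by blast
  then have "gpath V E [v]" by (simp add: gpath_def)
  then have "path_order V E \<in> length ` {xs. gpath V E xs}"
    unfolding path_order_def using finite_paths by (intro Max_in) auto
  then show ?thesis using that by auto
qed

lemma path_order_le: "path_order V E \<le> card V"
proof -
  obtain P where "gpath V E P" "length P = path_order V E" by (rule longest_path)
  then show ?thesis using card_mono[OF finV] by (metis distinct_card gpath_def)
qed

lemma finite_ends: "gpath V E P \<Longrightarrow> finite (ends E P) \<and> ends E P \<subseteq> set P \<and> last P \<in> ends E P"
proof -
  assume P: "gpath V E P"
  have "ends E P \<subseteq> set P"
    using rotation_gpath[OF _ P] by (fastforce simp: ends_def gpath_def)
  then show ?thesis using finite_subset by (auto simp: ends_def intro: rotation.rot_refl)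
qed

text \<open>Posa's lemma: all neighbours of the set of ends lie on \<open>P\<close>, next to an end, so there are
  fewer than twice as many of them as of ends.\<close>
lemma ends_large:
  assumes P: "gpath V E P" "length P = path_order V E" and X: "expander V E"
  shows "card V < 4 * card (ends E P)"
proof (rule ccontr)
  assume "\<not> ?thesis"
  moreover have "ends E P \<subseteq> V" "ends E P \<noteq> {}"
    using finite_ends[OF P(1)] P(1) by (auto simp: gpath_def)
  ultimately have 1: "2 * card (ends E P) \<le> card (nbh E (ends E P))"
    using X by (auto simp: expander_def)
  have sub: "nbh E (ends E P) \<subseteq> set P"
  proof
    fix y assume y: "y \<in> nbh E (ends E P)"
    then obtain Q where Q: "rotation E P Q" "{last Q, y} \<in> E" by (auto simp: nbh_def ends_def)
    have Qp: "gpath V E Q" "set Q = set P" using rotation_gpath[OF Q(1) P(1)] by auto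
    have len: "length Q = length P"
      using Qp P by (metis distinct_card gpath_def)
    show "y \<in> set P"
    proof (rule ccontr)
      assume "y \<notin> set P"
      then have "gpath V E (Q @ [y])"
        using Q Qp edgesV[OF Q(2)] by (auto simp: gpath_def successively_append_iff)
      then show False using gpath_length_le len P by fastforce
    qed
  qed
  have "nbh E (ends E P) \<subseteq> {x. \<exists>y\<in>ends E P. adj P x y}"
    using nbh_ends_adj[OF P(1) sub] by blast
  moreover have "finite {x. \<exists>y\<in>ends E P. adj P x y}"
    by (rule finite_subset[of _ "set P"]) (auto dest!: adj_nth)
  ultimately have "card (nbh E (ends E P)) \<le> card {x. \<exists>y\<in>ends E P. adj P x y}"
    by (intro card_mono)
  also have "\<dots> < 2 * card (ends E P)"
    by (rule card_adj_less) (use P finite_ends in \<open>auto simp: gpath_def\<close>)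
  finally show False using 1 by simp
qed

text \<open>Connectedness. A nonempty set \<open>B\<close> without outside neighbours has more than
  \<open>card V / 4\<close> vertices, so it contains a set of size \<open>card V div 4\<close>,
  whose neighbours also stay inside \<open>B\<close>; thus \<open>B\<close> has at least
  \<open>3 * (card V div 4)\<close> vertices. For at least ten vertices, \<open>A\<close> and its
  complement cannot both be that large.\<close>

lemma expander_nbh_nonempty:
  assumes X: "expander V E" and n: "10 \<le> card V" and A: "A \<subseteq> V" "A \<noteq> {}" "A \<noteq> V"
  shows "nbh E A \<noteq> {}"
proof
  assume emp: "nbh E A = {}"
  have big: "3 * (card V div 4) \<le> card B \<and> card V < 4 * card B"
    if B: "B \<subseteq> V" "B \<noteq> {}" "nbh E B = {}" for B
  proof -
    have finB: "finite B" using B finV finite_subset by blast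
    have 1: "card V < 4 * card B"
    proof (rule ccontr)
      assume "\<not> ?thesis"
      then have "4 * card B \<le> card V" by simp
      then have "2 * card B \<le> card (nbh E B)" using X B unfolding expander_def by blast
      then show False using B finB by auto
    qed
    then have "card V div 4 \<le> card B" by linarith
    then obtain S where S: "S \<subseteq> B" "card S = card V div 4" "finite S"
      using finB by (meson obtain_subset_with_card_n)
    have "S \<noteq> {}" using S n by auto
    moreover have "S \<subseteq> V" using S B by blast
    moreover have "4 * card S \<le> card V" using S by simp
    ultimately have 2: "2 * card S \<le> card (nbh E S)" using X unfolding expander_def by blast
    have "nbh E S \<subseteq> B - S" using B S by (auto simp: nbh_def)
    then have "card (nbh E S) \<le> card (B - S)" using finB by (intro card_mono) auto
    also have "\<dots> = card B - card S" using S finB by (intro card_Diff_subset) auto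
    finally show ?thesis using 1 2 S by linarith
  qed
  have "nbh E (V - A) = {}"
  proof -
    have "False" if "x \<in> V - A" "y \<notin> V - A" "{x, y} \<in> E" for x y
    proof -
      have "y \<in> A" using edgesV[OF that(3)] that by auto
      then have "x \<in> nbh E A" using that by (auto simp: nbh_def insert_commute)
      then show False using emp by blast
    qed
    then show ?thesis by (auto simp: nbh_def)
  qed
  then have "3 * (card V div 4) \<le> card (V - A) \<and> card V < 4 * card (V - A)"
    using A by (intro big) auto
  moreover have "3 * (card V div 4) \<le> card A \<and> card V < 4 * card A"
    using A emp by (intro big) auto
  moreover have "card (V - A) = card V - card A" "card A \<le> card V"
    using A finV by (auto simp: card_Diff_subset finite_subset card_mono)
  ultimately show False using n by linarith
qed

text \<open>The new edge closes the path to a cycle. If the cycle misses a vertex, connectedness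
  gives an edge leaving it at some \<open>x\<close>, and opening the cycle next to \<open>x\<close>
  yields a longer path.\<close>

lemma longest_path_booster:
  assumes P: "gpath V E P" "length P = path_order V E" and X: "expander V E" and n: "10 \<le> card V"
    and ne: "hd P \<noteq> last P"
  shows "{hd P, last P} \<in> boosters V E"
proof -
  define e where "e = {hd P, last P}"
  have eV: "e \<subseteq> V" "card e = 2" using P ne by (auto simp: e_def gpath_def)
  interpret G': finite_graph V "insert e E"
    using finV neV edgesV eV by unfold_locales auto
  have succ: "successively (\<lambda>x y. {x, y} \<in> insert e E) P"
    using P by (auto simp: gpath_def elim!: successively_mono)
  have "hamiltonian (V, insert e E) \<or> path_order V E < path_order V (insert e E)"
  proof (cases "set P = V")
    case True
    have len: "length P = card V" using P True by (metis distinct_card gpath_def)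
    have "{P ! i, P ! ((i + 1) mod length P)} \<in> insert e E" if i: "i < length P" for i
    proof (cases "Suc i < length P")
      case True
      then show ?thesis using successively_nth[OF succ True] by simp
    next
      case False
      then have "Suc i = length P" using i by simp
      moreover have "P \<noteq> []" using i by auto
      ultimately have "P ! i = last P" "P ! ((i + 1) mod length P) = hd P"
        by (auto simp: last_conv_nth hd_conv_nth simp flip: \<open>Suc i = length P\<close>)
      then show ?thesis by (simp add: e_def insert_commute)
    qed
    then show ?thesis using len n P True unfolding hamiltonian_def
      by (intro disjI1 exI[of _ P]) (auto simp: gpath_def)
  next
    case False
    have "nbh E (set P) \<noteq> {}"
      using expander_nbh_nonempty[OF X n, of "set P"] P False by (auto simp: gpath_def)
    then obtain x y where xy: "x \<in> set P" "y \<notin> set P" "{x, y} \<in> E" by (auto simp: nbh_def)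
    obtain as bs where Ps: "P = as @ x # bs" using xy by (meson split_list)
    have "gpath V (insert e E) (y # x # bs @ as)"
    proof -
      have "{last (x # bs), hd as} = e" if "as \<noteq> []"
      proof -
        have "hd P = hd as" "last P = last (x # bs)" using that by (auto simp: Ps)
        then show ?thesis unfolding e_def doubleton_eq_iff by metis
      qed
      then have link: "as \<noteq> [] \<longrightarrow> {last (x # bs), hd as} \<in> insert e E" by blast
      have "successively (\<lambda>x y. {x, y} \<in> insert e E) as \<and> successively (\<lambda>x y. {x, y} \<in> insert e E) (x # bs)"
        using succ unfolding Ps successively_append_iff by blast
      with link have "successively (\<lambda>x y. {x, y} \<in> insert e E) ((x # bs) @ as)"
        unfolding successively_append_iff by blast
      moreover have "{y, x} \<in> E" using xy by (simp add: insert_commute)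
      ultimately show ?thesis
        using P xy edgesV[OF xy(3)] by (auto simp: gpath_def Ps)
    qed
    then have "length (y # x # bs @ as) \<le> path_order V (insert e E)" by (rule G'.gpath_length_le)
    then show ?thesis using P Ps by simp
  qed
  then show ?thesis using eV by (simp add: boosters_def e_def)
qed

text \<open>Each of the more than \<open>card V / 4\<close> ends \<open>b\<close> of
  \<open>P\<close> is the first vertex of a longest path, namely of a reversed rotation of
  \<open>P\<close>. Rotating that path with \<open>b\<close> fixed gives again more than
  \<open>card V / 4\<close> ends \<open>c\<close>. Each unordered pair of \<open>b\<close> and
  \<open>c\<close> arises at most twice, hence \<open>32 = 4 * 4 * 2\<close>.\<close>

lemma card_boosters:
  assumes X: "expander V E" and n: "10 \<le> card V"
  shows "(card V)\<^sup>2 \<le> 32 * card (boosters V E)"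
proof -
  obtain P where P: "gpath V E P" "length P = path_order V E" by (rule longest_path)
  have same: "gpath V E Q \<and> length Q = path_order V E \<and> hd Q = hd P'"
    if "rotation E P' Q" "gpath V E P'" "length P' = path_order V E" for P' Q
    using rotation_gpath[OF that(1,2)] that by (metis distinct_card gpath_def)
  have "\<exists>P'. gpath V E P' \<and> length P' = path_order V E \<and> hd P' = b" if b: "b \<in> ends E P" for b
  proof -
    obtain Q where Q: "rotation E P Q" "b = last Q" using b by (auto simp: ends_def)
    then have "gpath V E Q" "length Q = path_order V E" using same P by auto
    then have "gpath V E (rev Q)" by (auto simp: gpath_def insert_commute)
    then show ?thesis using Q \<open>length Q = _\<close> by (intro exI[of _ "rev Q"]) (auto simp: hd_rev)
  qed
  then obtain PP where PP: "\<And>b. b \<in> ends E P \<Longrightarrow>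
      gpath V E (PP b) \<and> length (PP b) = path_order V E \<and> hd (PP b) = b" by metis
  define \<Sigma> where "\<Sigma> = Sigma (ends E P) (\<lambda>b. ends E (PP b))"
  have finB: "finite (boosters V E)" using finV by (auto simp: boosters_def)
  have eP: "finite (ends E P)" "card V < 4 * card (ends E P)"
    using finite_ends ends_large[OF P X] P by auto
  have ePP: "finite (ends E (PP b))" "card V < 4 * card (ends E (PP b))" if "b \<in> ends E P" for b
    using finite_ends ends_large[OF _ _ X] PP[OF that] by auto
  have "card V * card V \<le> (4 * card (ends E P)) * card V" using eP by simp
  also have "\<dots> = (\<Sum>b\<in>ends E P. 4 * card V)" by simp
  also have "\<dots> \<le> (\<Sum>b\<in>ends E P. 4 * (4 * card (ends E (PP b))))"
    by (intro sum_mono) (use ePP in force)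
  also have "\<dots> = 16 * card \<Sigma>"
    unfolding \<Sigma>_def using eP ePP by (subst card_SigmaI) (auto simp: sum_distrib_left)
  finally have big: "card V * card V \<le> 16 * card \<Sigma>" .
  \<comment> \<open>Needed so that a longest path has distinct first and last vertices.\<close>
  have "path_order V E \<ge> 2"
  proof -
    have "card (ends E P) \<le> card (set P)" using finite_ends[OF P(1)] by (intro card_mono) auto
    also have "\<dots> \<le> length P" by (rule card_length)
    finally show ?thesis using eP n P by linarith
  qed
  have "\<Sigma> \<subseteq> (\<Union>e\<in>boosters V E. {(b, c). {b, c} = e})"
  proof safe
    fix b c assume "(b, c) \<in> \<Sigma>"
    then have b: "b \<in> ends E P" and "c \<in> ends E (PP b)" by (auto simp: \<Sigma>_def)
    then obtain Q where Q: "rotation E (PP b) Q" "c = last Q" by (auto simp: ends_def)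
    have Q': "gpath V E Q" "length Q = path_order V E" "hd Q = b"
      using same[OF Q(1)] PP[OF b] by auto
    have "hd Q \<noteq> last Q"
      using Q'(1,2) \<open>path_order V E \<ge> 2\<close>
      by (cases Q) (auto simp: gpath_def split: if_splits)
    then have "{b, c} \<in> boosters V E"
      using longest_path_booster[OF Q'(1,2) X n] Q Q' by simp
    then show "(b, c) \<in> (\<Union>e\<in>boosters V E. {(b, c). {b, c} = e})" by auto
  qed
  moreover have two: "finite {(b, c). {b, c} = e} \<and> card {(b, c). {b, c} = e} \<le> 2" if e: "e \<in> boosters V E" for e
  proof -
    obtain u w where "e = {u, w}" using e unfolding boosters_def card_2_iff by blast
    then have "{(b, c). {b, c} = e} \<subseteq> {(u, w), (w, u)}" by (auto simp: doubleton_eq_iff)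
    moreover from this have "finite {(b, c). {b, c} = e}" by (rule finite_subset) simp
    moreover have "card {(b, c). {b, c} = e} \<le> card {(u, w), (w, u)}"
      by (rule card_mono[OF _ calculation(1)]) simp
    moreover have "card {(u, w), (w, u)} \<le> 2"
      using card_length[of "[(u, w), (w, u)]"] by (simp only: list.set list.size)
    ultimately show ?thesis by simp
  qed
  ultimately have "card \<Sigma> \<le> card (\<Union>e\<in>boosters V E. {(b, c). {b, c} = e})"
    using finB by (intro card_mono) auto
  also have "\<dots> \<le> (\<Sum>e\<in>boosters V E. card {(b, c). {b, c} = e})"
    by (rule card_UN_le[OF finB])
  also have "\<dots> \<le> (\<Sum>e\<in>boosters V E. 2)" by (intro sum_mono) (use two in blast)
  finally have "card \<Sigma> \<le> 2 * card (boosters V E)" by simp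
  then show ?thesis using big by (simp add: power2_eq_square)
qed

end

section \<open>Counting copies\<close>

abbreviation hamiltonian_prob :: "'a graph \<Rightarrow> nat \<Rightarrow> real \<Rightarrow> real" where
  "hamiltonian_prob H n p \<equiv> measure_pmf.prob (random_graph H n p) {G. hamiltonian G}"

abbreviation copies_at :: "'v graph set \<Rightarrow> 'v \<Rightarrow> 'v graph set" where
  "copies_at S u \<equiv> {C \<in> S. u \<in> verts C}"

section \<open>Transport of graphs along injections\<close>

definition map_graph :: "('v \<Rightarrow> 'w) \<Rightarrow> 'v graph \<Rightarrow> 'w graph" where
  "map_graph f G = (f ` verts G, (`) f ` edges G)"

lemma inj_map_graph: "inj f \<Longrightarrow> inj (map_graph f)"
proof (rule injI)
  fix G G' assume f: "inj f" and eq: "map_graph f G = map_graph f G'"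
  have "inj ((`) f)" using f by (simp add: inj_def inj_image_eq_iff)
  then show "G = G'" using eq f by (simp add: map_graph_def prod_eq_iff inj_image_eq_iff)
qed

lemma vdegree_map_graph:
  assumes inj: "inj_on f (verts G)" and sub: "\<And>e. e \<in> edges G \<Longrightarrow> e \<subseteq> verts G" and u: "u \<in> verts G"
  shows "vdegree (map_graph f G) (f u) = vdegree G u"
proof -
  have "{e \<in> edges (map_graph f G). f u \<in> e} = (`) f ` {e \<in> edges G. u \<in> e}"
    using inj_on_image_mem_iff[OF inj u sub] by (auto simp: map_graph_def)
  moreover have "inj_on ((`) f) {e \<in> edges G. u \<in> e}"
    by (rule inj_on_subset[OF inj_on_image_Pow[OF inj]]) (use sub in auto)
  ultimately show ?thesis by (simp add: vdegree_def card_image)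
qed

lemma isomorphic_map_graph:
  assumes "simple_graph G" "inj_on f (verts G)"
  shows "isomorphic G (map_graph f G)"
proof -
  have "{u, w} \<in> edges G \<longleftrightarrow> {f u, f w} \<in> edges (map_graph f G)" if "u \<in> verts G" "w \<in> verts G" for u w
  proof -
    have "{u, w} \<in> edges G" if "e \<in> edges G" "f ` {u, w} = f ` e" for e
    proof -
      have "{u, w} = e"
        using that \<open>u \<in> verts G\<close> \<open>w \<in> verts G\<close> assms
        by (intro inj_on_image_eq_iff[THEN iffD1, OF assms(2) _ _ that(2)]) (auto simp: simple_graph_def)
      then show ?thesis using that by simp
    qed
    then show ?thesis by (auto simp: map_graph_def image_iff intro!: bexI[of _ "{u, w}"])
  qed
  then show ?thesis unfolding isomorphic_def
    by (intro exI[of _ f]) (use assms in \<open>auto simp: map_graph_def bij_betw_def\<close>)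
qed

lemma isomorphic_imp_map_graph:
  assumes iso: "isomorphic G G'" and G: "simple_graph G" "simple_graph G'"
  obtains f where "inj_on f (verts G)" "G' = map_graph f G"
proof -
  obtain f where fe: "bij_betw f (verts G) (verts G') \<and>
      (\<forall>u\<in>verts G. \<forall>w\<in>verts G. {u, w} \<in> edges G \<longleftrightarrow> {f u, f w} \<in> edges G')"
    using iso[unfolded isomorphic_def] by (rule exE)
  note f = conjunct1[OF fe] and e = conjunct2[OF fe]
  have "edges G' = (`) f ` edges G"
  proof (intro equalityI subsetI)
    fix d assume d: "d \<in> edges G'"
    then have "d \<subseteq> verts G'" "card d = 2" using G(2) by (simp_all add: simple_graph_def)
    moreover from this obtain x y where xy: "d = {x, y}" unfolding card_2_iff by blast
    ultimately have "x \<in> verts G'" "y \<in> verts G'" by simp_all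
    then obtain u w where "u \<in> verts G" "w \<in> verts G" "x = f u" "y = f w"
      using f unfolding bij_betw_def by blast
    moreover have "{f u, f w} \<in> edges G'" using d xy calculation by simp
    ultimately have "{u, w} \<in> edges G" "d = f ` {u, w}" using bspec[OF bspec[OF e]] xy by simp_all
    then show "d \<in> (`) f ` edges G" by blast
  next
    fix d assume "d \<in> (`) f ` edges G"
    then obtain c where c: "c \<in> edges G" "d = f ` c" by blast
    then have sub: "c \<subseteq> verts G" "card c = 2" using G(1) by (simp_all add: simple_graph_def)
    then obtain u w where uw0: "c = {u, w}" unfolding card_2_iff by blast
    then have uw: "c = {u, w}" "u \<in> verts G" "w \<in> verts G" using sub by simp_all
    then show "d \<in> edges G'" using bspec[OF bspec[OF e uw(2)] uw(3)] c by simp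
  qed
  then have "G' = map_graph f G" using f by (simp add: map_graph_def bij_betw_def prod_eq_iff)
  then show ?thesis using that f by (auto simp: bij_betw_def)
qed

text \<open>The first transposition moves \<open>u\<close> to \<open>u'\<close>. The second moves
  the image of \<open>w\<close> to \<open>w'\<close>; neither of these is \<open>u'\<close>, so it
  leaves \<open>u'\<close> in place.\<close>

lemma ex_permutation_pair:
  assumes "u \<noteq> w" "u' \<noteq> w'" "{u, w, u', w'} \<subseteq> V"
  shows "\<exists>\<pi>. bij \<pi> \<and> \<pi> ` V = V \<and> \<pi> u = u' \<and> \<pi> w = w'"
proof -
  define w1 where "w1 = Transposition.transpose u u' w"
  have w1: "w1 \<noteq> u'" "w1 \<in> V" using assms by (auto simp: w1_def Transposition.transpose_def)
  have im: "Transposition.transpose a b ` V = V" if "a \<in> V" "b \<in> V" for a b :: 'a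
    using that by (simp add: transpose_image_eq)
  let ?\<pi> = "Transposition.transpose w1 w' \<circ> Transposition.transpose u u'"
  have "bij ?\<pi>" by (intro bij_comp) auto
  moreover have "?\<pi> ` V = V" using im w1 assms unfolding image_comp[symmetric] by simp
  moreover have "?\<pi> u = u'" "?\<pi> w = w'" using w1 assms by (auto simp: w1_def[symmetric])
  ultimately show ?thesis by blast
qed

text \<open>The first bound on \<open>n\<close> makes copies exist; the bound 10 is what the
  connectedness of expanders asks for.\<close>

locale copies_host =
  fixes H :: "'a graph" and n :: nat
  assumes H: "simple_graph H" "\<not> (\<exists>v. isolated H v)" and n: "card (verts H) \<le> n" "10 \<le> n"
begin

abbreviation V :: "nat set" where "V \<equiv> {1..n}"
abbreviation A :: "nat graph set" where "A \<equiv> copies H n"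
abbreviation v :: nat where "v \<equiv> card (verts H)"
abbreviation q :: nat where "q \<equiv> card (edges H)"
abbreviation N :: nat where "N \<equiv> card A"

text \<open>By symmetry the reference vertices \<open>1\<close> and \<open>2\<close> may be replaced by any others.\<close>
definition m2 :: nat where "m2 = card {C \<in> A. 1 \<in> verts C \<and> 2 \<in> verts C}"
definition me :: nat where "me = card {C \<in> A. {1, 2} \<in> edges C}"
definition m1_leaf :: nat where "m1_leaf = card {C \<in> A. 1 \<in> verts C \<and> vdegree C 1 = 1}"

lemma finite_A [simp]: "finite A"
  by (rule finite_copies)

lemma finite_H: "finite (verts H)" "finite (edges H)"
proof -
  show "finite (verts H)" using H by (simp add: simple_graph_def)
  moreover have "edges H \<subseteq> Pow (verts H)" using H by (auto simp: simple_graph_def)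
  ultimately show "finite (edges H)" by (meson finite_Pow_iff finite_subset)
qed

lemma copyD:
  assumes "C \<in> A"
  shows "simple_graph C" "verts C \<subseteq> V" "finite (verts C)" "finite (edges C)"
    "\<And>e. e \<in> edges C \<Longrightarrow> e \<subseteq> verts C \<and> card e = 2"
proof -
  show C: "simple_graph C" "verts C \<subseteq> V"
    using assms by (auto simp: copies_def subgraph_def complete_graph_def)
  show "finite (verts C)" "\<And>e. e \<in> edges C \<Longrightarrow> e \<subseteq> verts C \<and> card e = 2"
    using C by (auto simp: simple_graph_def)
  then show "finite (edges C)" by (meson PowI finite_Pow_iff finite_subset subsetI)
qed

lemma copy_map:
  assumes "C \<in> A"
  obtains f where "inj_on f (verts H)" "C = map_graph f H"
  using assms isomorphic_imp_map_graph[OF _ H(1) copyD(1)[OF assms]] by (auto simp: copies_def)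

lemma edges_H: "e \<in> edges H \<Longrightarrow> e \<subseteq> verts H \<and> card e = 2"
  using H by (auto simp: simple_graph_def)

lemma copy_card:
  assumes "C \<in> A"
  shows "card (verts C) = v" "card (edges C) = q"
    "card {w \<in> verts C. vdegree C w = 1} = card {w \<in> verts H. vdegree H w = 1}"
proof -
  obtain f where f: "inj_on f (verts H)" "C = map_graph f H" using copy_map[OF assms] .
  show "card (verts C) = v" using f by (simp add: map_graph_def card_image)
  have "inj_on ((`) f) (edges H)"
    by (rule inj_on_subset[OF inj_on_image_Pow[OF f(1)]]) (use edges_H in auto)
  then show "card (edges C) = q" using f by (simp add: map_graph_def card_image)
  have deg: "vdegree C (f u) = vdegree H u" if "u \<in> verts H" for u
    unfolding f(2) by (rule vdegree_map_graph) (use f edges_H that in auto)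
  have "{w \<in> verts C. vdegree C w = 1} = f ` {w \<in> verts H. vdegree H w = 1}"
    using deg f(2) by (auto simp: map_graph_def)
  then show "card {w \<in> verts C. vdegree C w = 1} = card {w \<in> verts H. vdegree H w = 1}"
    using f(1) by (simp add: card_image inj_on_subset)
qed

lemma vdegree_H_pos: "u \<in> verts H \<Longrightarrow> 1 \<le> vdegree H u"
  using H(2) finite_H by (auto simp: isolated_def vdegree_def Suc_le_eq card_gt_0_iff)

lemma min_degree_le: "u \<in> verts H \<Longrightarrow> min_degree H \<le> vdegree H u"
  using finite_H by (simp add: min_degree_def)

lemma min_degree_attained: "\<exists>u\<in>verts H. vdegree H u = min_degree H"
proof -
  have "min_degree H \<in> vdegree H ` verts H"
    unfolding min_degree_def using finite_H H by (intro Min_in) (auto simp: simple_graph_def)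
  then show ?thesis by auto
qed

lemma copy_vdegree:
  assumes "C \<in> A" "w \<in> verts C"
  shows "min_degree H \<le> vdegree C w" "1 \<le> vdegree C w"
proof -
  obtain f where f: "inj_on f (verts H)" "C = map_graph f H" using copy_map[OF assms(1)] .
  then obtain u where u: "u \<in> verts H" "w = f u" using assms by (auto simp: map_graph_def)
  have "vdegree C w = vdegree H u"
    unfolding f(2) u(2) by (rule vdegree_map_graph) (use f edges_H u in auto)
  then show "min_degree H \<le> vdegree C w" "1 \<le> vdegree C w"
    using u min_degree_le vdegree_H_pos by auto
qed

lemma copy_edge_at:
  assumes "C \<in> A" "w \<in> verts C"
  shows "\<exists>y\<in>verts C. y \<noteq> w \<and> {w, y} \<in> edges C"
proof -
  have "{e \<in> edges C. w \<in> e} \<noteq> {}"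
    using copy_vdegree(2)[OF assms] unfolding vdegree_def by (metis card.empty not_one_le_zero)
  then obtain e where e: "e \<in> edges C" "w \<in> e" by blast
  then have "e \<subseteq> verts C" "card e = 2" using copyD(5)[OF assms(1)] by auto
  then obtain a b where ab: "e = {a, b}" "a \<noteq> b" "{b, a} = e" unfolding card_2_iff by blast
  then have "w = a \<or> w = b" using e by blast
  then show ?thesis
  proof
    assume "w = a"
    then show ?thesis using e ab \<open>e \<subseteq> verts C\<close> by (intro bexI[of _ b]) simp_all
  next
    assume "w = b"
    then show ?thesis using e ab \<open>e \<subseteq> verts C\<close> by (intro bexI[of _ a]) simp_all
  qed
qed

lemma ex_copy: "A \<noteq> {}"
proof -
  obtain f where f: "f ` verts H \<subseteq> V" "inj_on f (verts H)"
    using card_le_inj[OF finite_H(1), of V] n by auto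
  have im: "card (f ` e) = 2" if "e \<in> edges H" for e
    using edges_H[OF that] f by (metis card_image inj_on_subset)
  have "subgraph (map_graph f H) (complete_graph n)"
    using f edges_H im finite_H H by (fastforce simp: subgraph_def complete_graph_def map_graph_def simple_graph_def)
  then have "map_graph f H \<in> A"
    using isomorphic_map_graph[OF H(1) f(2)] by (simp add: copies_def)
  then show ?thesis by blast
qed

lemma v_ge_2: "2 \<le> v" and q_pos: "1 \<le> q"
proof -
  obtain u where u: "u \<in> verts H" using H by (auto simp: simple_graph_def)
  have "{e \<in> edges H. u \<in> e} \<noteq> {}"
    using vdegree_H_pos[OF u] unfolding vdegree_def by (metis card.empty not_one_le_zero)
  then obtain e where e: "e \<in> edges H" by blast
  then show "1 \<le> q" using finite_H card_gt_0_iff by (fastforce simp: Suc_le_eq)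
  show "2 \<le> v" using edges_H[OF e] card_mono[OF finite_H(1), of e] by simp
qed

lemma map_copy:
  assumes \<pi>: "bij \<pi>" "\<pi> ` V = V" and C: "C \<in> A"
  shows "map_graph \<pi> C \<in> A"
proof -
  have inj: "inj_on \<pi> X" for X using \<pi> by (meson bij_is_inj inj_on_subset subset_UNIV)
  have sg: "simple_graph (map_graph \<pi> C)"
    using copyD[OF C] inj by (auto simp: simple_graph_def map_graph_def card_image intro!: image_mono)
  moreover have "verts (map_graph \<pi> C) \<subseteq> V"
    using copyD(2)[OF C] \<pi>(2) by (auto simp: map_graph_def)
  moreover have "edges (map_graph \<pi> C) \<subseteq> edges (complete_graph n)"
  proof
    fix e assume e: "e \<in> edges (map_graph \<pi> C)"
    then have "e \<subseteq> verts (map_graph \<pi> C)" "card e = 2" using sg by (auto simp: simple_graph_def)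
    then show "e \<in> edges (complete_graph n)"
      using \<open>verts (map_graph \<pi> C) \<subseteq> V\<close> by (auto simp: complete_graph_def)
  qed
  moreover obtain f where f: "inj_on f (verts H)" "C = map_graph f H" using copy_map[OF C] .
  then have "map_graph \<pi> C = map_graph (\<pi> \<circ> f) H" by (auto simp: map_graph_def image_comp[symmetric] image_image)
  then have "isomorphic H (map_graph \<pi> C)"
    using isomorphic_map_graph[OF H(1), of "\<pi> \<circ> f"] f inj by (simp add: comp_inj_on)
  ultimately show ?thesis by (auto simp: copies_def subgraph_def complete_graph_def)
qed

section \<open>Vertex symmetry and double counting\<close>

text \<open>A permutation of the vertices taking \<open>u\<close>, \<open>w\<close> to
  \<open>u'\<close>, \<open>w'\<close> maps copies injectively to copies, and likewise in the other
  direction. Properties of one vertex are covered by letting \<open>P\<close> ignore its second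
  argument.\<close>

lemma count_symmetric:
  assumes P: "\<And>\<pi> u w C. bij \<pi> \<Longrightarrow> C \<in> A \<Longrightarrow> P u w C \<Longrightarrow> P (\<pi> u) (\<pi> w) (map_graph \<pi> C)"
    and uw: "u \<in> V" "w \<in> V" "u \<noteq> w" "u' \<in> V" "w' \<in> V" "u' \<noteq> w'"
  shows "card {C \<in> A. P u w C} = card {C \<in> A. P u' w' C}"
proof -
  have le: "card {C \<in> A. P u w C} \<le> card {C \<in> A. P u' w' C}"
    if uw: "u \<in> V" "w \<in> V" "u \<noteq> w" "u' \<in> V" "w' \<in> V" "u' \<noteq> w'" for u w u' w'
  proof -
    obtain \<pi> where \<pi>: "bij \<pi>" "\<pi> ` V = V" "\<pi> u = u'" "\<pi> w = w'"
      using ex_permutation_pair[of u w u' w' V] uw by auto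
    show ?thesis
    proof (rule card_inj_on_le[where f = "map_graph \<pi>"])
      show "inj_on (map_graph \<pi>) {C \<in> A. P u w C}"
        using inj_map_graph[OF bij_is_inj[OF \<pi>(1)]] by (rule inj_on_subset) simp
      show "map_graph \<pi> ` {C \<in> A. P u w C} \<subseteq> {C \<in> A. P u' w' C}"
        using map_copy[OF \<pi>(1,2)] P[OF \<pi>(1), of _ u w] \<pi> by auto
    qed simp
  qed
  show ?thesis using le[OF uw] le[OF uw(4-6) uw(1-3)] by simp
qed

lemma ex_other_vertex: "u \<in> V \<Longrightarrow> \<exists>w\<in>V. u \<noteq> w"
  using n by (cases "u = 1") (auto intro: bexI[of _ 1] bexI[of _ 2])

lemma card_copies_at: "u \<in> V \<Longrightarrow> card (copies_at A u) = m1 H n"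
proof -
  assume u: "u \<in> V"
  obtain w where w: "w \<in> V" "u \<noteq> w" using ex_other_vertex[OF u] by blast
  show ?thesis
    unfolding m1_def using u w n
    by (intro count_symmetric[where P = "\<lambda>u _ C. u \<in> verts C" and w = w and w' = 2])
       (auto simp: map_graph_def)
qed

lemma card_copies_leaf: "u \<in> V \<Longrightarrow> card {C \<in> A. u \<in> verts C \<and> vdegree C u = 1} = m1_leaf"
proof -
  assume u: "u \<in> V"
  obtain w where w: "w \<in> V" "u \<noteq> w" using ex_other_vertex[OF u] by blast
  have step: "\<pi> u \<in> verts (map_graph \<pi> C) \<and> vdegree (map_graph \<pi> C) (\<pi> u) = 1"
    if "bij \<pi>" "C \<in> A" "u \<in> verts C \<and> vdegree C u = 1" for \<pi> u C
  proof -
    have "vdegree (map_graph \<pi> C) (\<pi> u) = vdegree C u"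
      by (rule vdegree_map_graph)
         (use copyD[OF that(2)] that in \<open>auto intro: inj_on_subset[OF bij_is_inj]\<close>)
    then show ?thesis using that by (simp add: map_graph_def)
  qed
  show ?thesis
    unfolding m1_leaf_def using u w n
    by (intro count_symmetric[where P = "\<lambda>u _ C. u \<in> verts C \<and> vdegree C u = 1" and w = w and w' = 2] step)
       auto
qed

lemma card_copies_pair: "u \<in> V \<Longrightarrow> w \<in> V \<Longrightarrow> u \<noteq> w \<Longrightarrow> card {C \<in> A. u \<in> verts C \<and> w \<in> verts C} = m2"
  unfolding m2_def using n
  by (intro count_symmetric[where P = "\<lambda>u w C. u \<in> verts C \<and> w \<in> verts C"])
     (auto simp: map_graph_def)

lemma card_copies_edge: "u \<in> V \<Longrightarrow> w \<in> V \<Longrightarrow> u \<noteq> w \<Longrightarrow> card {C \<in> A. {u, w} \<in> edges C} = me"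
proof -
  assume "u \<in> V" "w \<in> V" "u \<noteq> w"
  moreover have "{\<pi> u, \<pi> w} \<in> edges (map_graph \<pi> C)" if "{u, w} \<in> edges C" for \<pi> u w and C :: "nat graph"
  proof -
    have "\<pi> ` {u, w} \<in> edges (map_graph \<pi> C)"
      unfolding map_graph_def snd_conv using that by (rule imageI)
    then show ?thesis by simp
  qed
  ultimately show ?thesis
    unfolding me_def using n
    by (intro count_symmetric[where P = "\<lambda>u w C. {u, w} \<in> edges C"]) auto
qed

lemma m1_eq: "n * m1 H n = v * N"
proof -
  have "(\<Sum>u\<in>V. card (copies_at A u)) = (\<Sum>C\<in>A. v)"
  proof (rule sum_multicount_gen)
    show "\<forall>C\<in>A. card {u \<in> V. u \<in> verts C} = v"
    proof
      fix C assume C: "C \<in> A"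
      have "{u \<in> V. u \<in> verts C} = verts C" using copyD(2)[OF C] by auto
      then show "card {u \<in> V. u \<in> verts C} = v" using copy_card(1)[OF C] by simp
    qed
  qed auto
  then show ?thesis by (simp add: card_copies_at mult.commute)
qed

lemma m1_leaf_eq: "n * m1_leaf = card {w \<in> verts H. vdegree H w = 1} * N"
proof -
  have "(\<Sum>u\<in>V. card {C \<in> A. u \<in> verts C \<and> vdegree C u = 1}) = (\<Sum>C\<in>A. card {w \<in> verts H. vdegree H w = 1})"
  proof (rule sum_multicount_gen)
    show "\<forall>C\<in>A. card {u \<in> V. u \<in> verts C \<and> vdegree C u = 1} = card {w \<in> verts H. vdegree H w = 1}"
    proof
      fix C assume C: "C \<in> A"
      have "{u \<in> V. u \<in> verts C \<and> vdegree C u = 1} = {w \<in> verts C. vdegree C w = 1}"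
        using copyD(2)[OF C] by auto
      then show "card {u \<in> V. u \<in> verts C \<and> vdegree C u = 1} = card {w \<in> verts H. vdegree H w = 1}"
        using copy_card(3)[OF C] by simp
    qed
  qed auto
  then show ?thesis by (simp add: card_copies_leaf mult.commute del: One_nat_def)
qed

lemma m2_eq: "(n - 1) * m2 = (v - 1) * m1 H n"
proof -
  have 1: "1 \<in> V" using n by simp
  have "(\<Sum>u\<in>V - {1}. card {C \<in> copies_at A 1. u \<in> verts C}) = (\<Sum>C\<in>copies_at A 1. v - 1)"
  proof (rule sum_multicount_gen)
    show "\<forall>C\<in>copies_at A 1. card {u \<in> V - {1}. u \<in> verts C} = v - 1"
    proof
      fix C assume C: "C \<in> copies_at A 1"
      have "{u \<in> V - {1}. u \<in> verts C} = verts C - {1}" using copyD(2)[of C] C by auto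
      then show "card {u \<in> V - {1}. u \<in> verts C} = v - 1"
        using copy_card(1)[of C] C copyD(3)[of C] by (simp add: card_Diff_singleton)
    qed
  qed auto
  moreover have "card {C \<in> copies_at A 1. u \<in> verts C} = m2" if "u \<in> V - {1}" for u
  proof -
    have "{C \<in> copies_at A 1. u \<in> verts C} = {C \<in> A. 1 \<in> verts C \<and> u \<in> verts C}" by auto
    then show ?thesis using card_copies_pair[OF 1, of u] that by auto
  qed
  ultimately show ?thesis using card_copies_at[OF 1] 1 by (simp add: mult.commute del: One_nat_def)
qed

lemma me_eq: "n * (n - 1) * me = 2 * q * N"
proof -
  let ?P = "{e. e \<subseteq> V \<and> card e = 2}"
  have "(\<Sum>e\<in>?P. card {C \<in> A. e \<in> edges C}) = (\<Sum>C\<in>A. q)"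
  proof (rule sum_multicount_gen)
    show "\<forall>C\<in>A. card {e \<in> ?P. e \<in> edges C} = q"
    proof
      fix C assume C: "C \<in> A"
      have "{e \<in> ?P. e \<in> edges C} = edges C" using copyD(2,5)[OF C] by blast
      then show "card {e \<in> ?P. e \<in> edges C} = q" using copy_card(2)[OF C] by simp
    qed
  qed auto
  moreover have "card {C \<in> A. e \<in> edges C} = me" if "e \<in> ?P" for e
    using that card_copies_edge by (auto simp: card_2_iff)
  moreover have "card ?P = n choose 2" using n_subsets[of V 2] by simp
  ultimately have eq: "(n choose 2) * me = N * q" by simp
  have "2 * (n choose 2) = n * (n - 1)"
    unfolding choose_two by (rule dvd_mult_div_cancel) (cases n; auto)
  then have "n * (n - 1) * me = 2 * ((n choose 2) * me)" by (simp only: mult.assoc[symmetric])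
  then show ?thesis unfolding eq by simp
qed

lemma m1_pos: "1 \<le> m1 H n"
proof -
  have "N > 0" using ex_copy by (simp add: card_gt_0_iff)
  then have "n * m1 H n > 0" using v_ge_2 unfolding m1_eq by simp
  then show ?thesis by simp
qed

lemma m2_pos: "1 \<le> m2"
proof -
  have "(v - 1) * m1 H n > 0" using v_ge_2 m1_pos by simp
  then have "(n - 1) * m2 > 0" unfolding m2_eq .
  then show ?thesis by simp
qed

text \<open>By \<open>m2_eq\<close> the proportion of the copies at one vertex that contain another
  given one is \<open>(v - 1) / (n - 1)\<close>, which is at most \<open>v / n\<close> because
  \<open>v \<le> n\<close>.\<close>

lemma m2_le: "real n * real m2 \<le> real v * real (m1 H n)"
proof -
  have eq: "(real n - 1) * real m2 = (real v - 1) * real (m1 H n)"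
  proof -
    have "real (n - 1) * real m2 = real (v - 1) * real (m1 H n)"
      unfolding of_nat_mult[symmetric] m2_eq ..
    moreover have "real (n - 1) = real n - 1" "real (v - 1) = real v - 1"
      using n v_ge_2 by (simp_all add: of_nat_diff)
    ultimately show ?thesis by simp
  qed
  have "(real n - 1) * (real n * real m2) = real n * ((real v - 1) * real (m1 H n))"
    by (simp add: eq[symmetric])
  also have "\<dots> \<le> (real n - 1) * (real v * real (m1 H n))"
  proof -
    have "real n * (real v - 1) \<le> (real n - 1) * real v" using n by (simp add: algebra_simps)
    then have "real n * (real v - 1) * real (m1 H n) \<le> (real n - 1) * real v * real (m1 H n)"
      by (rule mult_right_mono) simp
    then show ?thesis by (simp add: mult.assoc)
  qed
  finally show ?thesis using n by (simp add: mult_le_cancel_left)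
qed

text \<open>Ensures that \<open>p = M / m1 H n\<close> is at most \<open>v * M / n\<close>, so that
  \<open>p\<close> is small whenever \<open>M\<close> is logarithmic.\<close>

lemma n_le: "real n \<le> real v * real (m1 H n)"
proof -
  have "real n * 1 \<le> real n * real m2" using m2_pos by (intro mult_left_mono) auto
  then show ?thesis using m2_le by simp
qed

lemma me_ge: "2 * real q * real (m1 H n) \<le> real v * real n * real me"
proof -
  have "n * (v * (n - 1) * me) = n * (2 * q * m1 H n)"
  proof -
    have "n * (v * (n - 1) * me) = v * (n * (n - 1) * me)" by (simp add: mult_ac)
    also have "\<dots> = 2 * q * (v * N)" unfolding me_eq by (simp add: mult_ac)
    also have "\<dots> = n * (2 * q * m1 H n)" unfolding m1_eq[symmetric] by (simp add: mult_ac)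
    finally show ?thesis .
  qed
  then have "2 * q * m1 H n = v * (n - 1) * me" using n by simp
  also have "\<dots> \<le> v * n * me" by simp
  finally have "real (2 * q * m1 H n) \<le> real (v * n * me)" by (simp only: of_nat_le_iff)
  then show ?thesis by simp
qed

text \<open>Every copy has at least one leaf among its \<open>v\<close> vertices, so by symmetry at
  least one in \<open>v\<close> of the copies at a vertex has a leaf there.\<close>

lemma m1_leaf_ge:
  assumes "min_degree H = 1"
  shows "real (m1 H n) \<le> real v * real m1_leaf"
proof -
  obtain u where "u \<in> verts H" "vdegree H u = 1" using min_degree_attained assms by auto
  then have "card {w \<in> verts H. vdegree H w = 1} > 0" using finite_H by (auto simp: card_gt_0_iff)
  then have "N \<le> card {w \<in> verts H. vdegree H w = 1} * N" by simp
  then have "v * N \<le> v * (n * m1_leaf)" unfolding m1_leaf_eq by simp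
  then have "n * m1 H n \<le> n * (v * m1_leaf)" unfolding m1_eq by (simp add: mult_ac)
  then have "m1 H n \<le> v * m1_leaf" using n by simp
  then have "real (m1 H n) \<le> real (v * m1_leaf)" by (simp only: of_nat_le_iff)
  then show ?thesis by simp
qed

end

section \<open>Expansion from local conditions\<close>

text \<open>The list entry \<open>(C, y)\<close> is a step to the vertex \<open>y\<close> inside the copy \<open>C\<close>.\<close>
fun walk :: "'v graph set \<Rightarrow> 'v \<Rightarrow> ('v graph \<times> 'v) list \<Rightarrow> 'v \<Rightarrow> bool" where
  "walk S a [] b \<longleftrightarrow> a = b"
| "walk S a ((C, y) # ws) b \<longleftrightarrow> C \<in> S \<and> a \<in> verts C \<and> y \<in> verts C \<and> y \<noteq> a \<and> walk S y ws b"

lemma walk_append: "walk S a ws b \<Longrightarrow> walk S b ws' c \<Longrightarrow> walk S a (ws @ ws') c"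
  by (induction S a ws b rule: walk.induct) auto

lemma walk_split: "walk S a (ws @ ws') c \<Longrightarrow> \<exists>b. walk S a ws b \<and> walk S b ws' c"
  by (induction ws arbitrary: a) auto

definition near :: "'v graph set \<Rightarrow> nat \<Rightarrow> 'v \<Rightarrow> 'v \<Rightarrow> bool" where
  "near S k a b \<longleftrightarrow> (\<exists>ws. walk S a ws b \<and> length ws \<le> k)"

lemma near_refl: "near S k a a"
  unfolding near_def by (rule exI[of _ "[]"]) simp

lemma near_trans: "near S k a b \<Longrightarrow> near S l b c \<Longrightarrow> near S (k + l) a c"
  unfolding near_def by (metis walk_append length_append add_mono)

lemma near_mono: "near S k a b \<Longrightarrow> k \<le> l \<Longrightarrow> near S l a b"
  unfolding near_def by (meson le_trans)

text \<open>Cutting out the part of a shortest walk between two occurrences of the same copy.\<close>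
lemma near_distinct_walk:
  assumes "near S k a b"
  shows "\<exists>ws. walk S a ws b \<and> length ws \<le> k \<and> distinct (map fst ws)"
proof -
  obtain ws where ws: "walk S a ws b" and shortest: "\<And>ws'. walk S a ws' b \<Longrightarrow> length ws \<le> length ws'"
    using assms exists_least_iff[of "\<lambda>m. \<exists>ws. walk S a ws b \<and> length ws = m"]
    unfolding near_def by (metis not_le)
  have "length ws \<le> k" using assms shortest unfolding near_def by (meson le_trans)
  moreover have "distinct (map fst ws)"
  proof (rule ccontr)
    assume "\<not> distinct (map fst ws)"
    then obtain xs' ys' zs' C where "map fst ws = xs' @ [C] @ ys' @ [C] @ zs'"
      using not_distinct_decomp by blast
    then obtain xs y ys z zs where eq: "ws = xs @ (C, y) # ys @ (C, z) # zs"
      by (auto simp: map_eq_append_conv map_eq_Cons_conv append_eq_map_conv Cons_eq_map_conv)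
    from ws obtain b1 where 1: "walk S a xs b1" "walk S b1 ((C, y) # ys @ (C, z) # zs) b"
      unfolding eq using walk_split by metis
    then obtain b2 where 2: "walk S b2 ((C, z) # zs) b" and C: "C \<in> S" "b1 \<in> verts C"
      using walk_split[of S y ys "(C, z) # zs" b] by auto
    show False
    proof (cases "z = b1")
      case True
      then have "walk S a (xs @ zs) b" using 1 2 walk_append by fastforce
      then show False using shortest[of "xs @ zs"] eq by simp
    next
      case False
      then have "walk S b1 ((C, z) # zs) b" using 2 C by simp
      then have "walk S a (xs @ (C, z) # zs) b" using 1 walk_append by metis
      then show False using shortest[of "xs @ (C, z) # zs"] eq by simp
    qed
  qed
  ultimately show ?thesis using ws by blast
qed

text \<open>\<open>X1\<close> consists of vertices of low degree, of which only two neighbours \<open>T u\<close> each are counted; a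
  vertex of \<open>X2\<close> sees at most three vertices of \<open>X1\<close> and these neighbours.\<close>
lemma card_nbh_ge_combine:
  assumes fin: "finite X1" "finite X2" "finite (nbh E (X1 \<union> X2))" "finite (nbh E X2)"
    and X2: "6 * card X2 \<le> card (nbh E X2)"
    and T: "\<And>u. u \<in> X1 \<Longrightarrow> T u \<subseteq> nbh E {u} \<and> card (T u) = 2"
    and disj: "\<And>u u'. u \<in> X1 \<Longrightarrow> u' \<in> X1 \<Longrightarrow> u \<noteq> u' \<Longrightarrow> T u \<inter> T u' = {}"
    and indep: "\<And>u. u \<in> X1 \<Longrightarrow> T u \<inter> X1 = {}"
    and sep: "\<And>w u u' y y'. w \<in> X2 \<Longrightarrow> u \<in> X1 \<Longrightarrow> u' \<in> X1 \<Longrightarrow> y \<in> insert u (T u) \<Longrightarrow> y' \<in> insert u' (T u')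
       \<Longrightarrow> {w, y} \<in> E \<Longrightarrow> {w, y'} \<in> E \<Longrightarrow> u = u'"
  shows "2 * (card X1 + card X2) \<le> card (nbh E (X1 \<union> X2))"
proof -
  define TT where "TT = (\<Union>u\<in>X1. T u)"
  have finT: "finite (T u)" if "u \<in> X1" for u
    using T[OF that] by (metis card.infinite zero_neq_numeral)
  have TT: "finite TT" "card TT = 2 * card X1"
    unfolding TT_def using fin finT T disj by (simp_all add: card_UN_disjoint)
  define L where "L = nbh E X2 \<inter> (X1 \<union> TT)"
  have L3: "card (nbh E {w} \<inter> (X1 \<union> TT)) \<le> 3" if w: "w \<in> X2" for w
  proof (cases "nbh E {w} \<inter> (X1 \<union> TT) = {}")
    case False
    then obtain y u where y: "y \<in> nbh E {w}" "u \<in> X1" "y \<in> insert u (T u)" by (auto simp: TT_def)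
    have "nbh E {w} \<inter> (X1 \<union> TT) \<subseteq> insert u (T u)"
    proof
      fix y' assume "y' \<in> nbh E {w} \<inter> (X1 \<union> TT)"
      then obtain u' where y': "y' \<in> nbh E {w}" "u' \<in> X1" "y' \<in> insert u' (T u')" by (auto simp: TT_def)
      have "u = u'" by (rule sep[OF w y(2) y'(2) y(3) y'(3)]) (use y y' in \<open>auto simp: nbh_def\<close>)
      then show "y' \<in> insert u (T u)" using y' by simp
    qed
    then have "card (nbh E {w} \<inter> (X1 \<union> TT)) \<le> card (insert u (T u))"
      using finT[OF y(2)] by (intro card_mono) auto
    also have "\<dots> \<le> Suc (card (T u))" by (rule card_insert_le_m1) simp_all
    also have "\<dots> = 3" using T[OF y(2)] by simp
    finally show ?thesis .
  qed simp
  have "L \<subseteq> (\<Union>w\<in>X2. nbh E {w} \<inter> (X1 \<union> TT))" by (auto simp: L_def nbh_def)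
  then have "card L \<le> card (\<Union>w\<in>X2. nbh E {w} \<inter> (X1 \<union> TT))"
    using fin TT by (intro card_mono) auto
  also have "\<dots> \<le> (\<Sum>w\<in>X2. card (nbh E {w} \<inter> (X1 \<union> TT)))" by (rule card_UN_le) fact
  also have "\<dots> \<le> (\<Sum>w\<in>X2. 3)" by (intro sum_mono L3)
  finally have L: "card L \<le> 3 * card X2" by simp
  \<comment> \<open>The constant 6 is used up here: \<open>TT - X2\<close> keeps
    \<open>2 * card X1 - card X2\<close> vertices, and discarding \<open>L\<close> leaves at least
    \<open>(6 - 3) * card X2\<close> neighbours of \<open>X2\<close>, which sums to twice
    \<open>card X1 + card X2\<close>.\<close>
  have "card (TT - X2) + card (nbh E X2 - L) = card ((TT - X2) \<union> (nbh E X2 - L))"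
    using TT fin by (intro card_Un_disjoint[symmetric]) (auto simp: L_def)
  also have "\<dots> \<le> card (nbh E (X1 \<union> X2))"
  proof (rule card_mono)
    show "(TT - X2) \<union> (nbh E X2 - L) \<subseteq> nbh E (X1 \<union> X2)"
    proof
      fix y assume "y \<in> (TT - X2) \<union> (nbh E X2 - L)"
      then show "y \<in> nbh E (X1 \<union> X2)"
      proof
        assume y: "y \<in> TT - X2"
        then obtain u where u: "u \<in> X1" "y \<in> T u" by (auto simp: TT_def)
        then have "{u, y} \<in> E" using T[OF u(1)] by (auto simp: nbh_def)
        moreover have "y \<notin> X1" using indep u by blast
        ultimately show ?thesis using u y by (auto simp: nbh_def)
      next
        assume "y \<in> nbh E X2 - L"
        then show ?thesis by (auto simp: nbh_def L_def)
      qed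
    qed
  qed (use fin in auto)
  finally have "card (TT - X2) + card (nbh E X2 - L) \<le> card (nbh E (X1 \<union> X2))" .
  moreover have "card TT \<le> card (TT - X2) + card X2"
    using diff_card_le_card_Diff[of X2 TT] fin by (simp add: le_diff_conv)
  moreover have "card (nbh E X2) \<le> card (nbh E X2 - L) + card L"
    using diff_card_le_card_Diff[of L "nbh E X2"] TT fin by (simp add: le_diff_conv L_def)
  ultimately show ?thesis unfolding distrib_left using TT L X2 by linarith
qed

section \<open>Four conditions on the chosen copies that imply expansion\<close>

context copies_host
begin

abbreviation E :: "nat graph set \<Rightarrow> nat set set" where "E S \<equiv> (\<Union>C\<in>S. edges C)"

text \<open>The bound comes from \<open>card_nbh_not_small\<close>: a factor 2 from
  \<open>sparse\<close>, a factor 7 for a set together with fewer than six times as many neighbours,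
  and \<open>v\<close> vertices in each copy.\<close>

definition small :: "nat graph set \<Rightarrow> nat set" where
  "small S = {u \<in> V. card (copies_at S u) < 14 * v}"

text \<open>The parameter \<open>M\<close> will be the expected number of chosen copies at a vertex.
  The union bound over sets of size \<open>u\<close> has terms of order
  \<open>(u * M ^ 2 / n) ^ u\<close>; up to the cutoff \<open>n / M ^ 3\<close> their base is at
  most \<open>1 / M\<close>.\<close>

definition sparse :: "real \<Rightarrow> nat graph set \<Rightarrow> bool" where
  "sparse M S \<longleftrightarrow> (\<forall>U. U \<subseteq> V \<and> U \<noteq> {} \<and> real (card U) * M ^ 3 \<le> real n \<longrightarrow>
     card {C \<in> S. 2 \<le> card (verts C \<inter> U)} < 2 * card U)"

text \<open>Four steps are what \<open>expanderI\<close> needs: from a low vertex to a neighbour of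
  it, on to a vertex outside \<open>small S\<close>, to a neighbour of another low vertex, and to
  that vertex.\<close>

definition separated :: "nat graph set \<Rightarrow> bool" where
  "separated S \<longleftrightarrow> (\<forall>a\<in>small S. \<forall>b\<in>small S. near S 4 a b \<longrightarrow> a = b)"

definition degree_ge_2 :: "nat graph set \<Rightarrow> bool" where
  "degree_ge_2 S \<longleftrightarrow> (\<forall>u\<in>V. 2 \<le> card (nbh (E S) {u}))"

text \<open>The range starts where that of \<open>sparse\<close> stops to be useful: sparsity is
  applied to sets of up to \<open>7 * card X\<close> vertices.\<close>

definition spread :: "real \<Rightarrow> nat graph set \<Rightarrow> bool" where
  "spread M S \<longleftrightarrow> (\<forall>X. X \<subseteq> V \<and> X \<noteq> {} \<and> real n < 7 * real (card X) * M ^ 3 \<and> 4 * card X \<le> n \<longrightarrow>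
     2 * card X \<le> card (nbh (E S) X))"

lemma E_subset: "S \<subseteq> A \<Longrightarrow> e \<in> E S \<Longrightarrow> e \<subseteq> V \<and> card e = 2"
  using copyD(2,5) by blast

lemma nbh_subset: "S \<subseteq> A \<Longrightarrow> nbh (E S) X \<subseteq> V"
proof
  fix y assume S: "S \<subseteq> A" and "y \<in> nbh (E S) X"
  then obtain x where "{x, y} \<in> E S" unfolding nbh_def by blast
  then show "y \<in> V" using E_subset[OF S] by blast
qed

lemma edge_near:
  assumes S: "S \<subseteq> A" and e: "{a, b} \<in> E S"
  shows "near S 1 a b"
proof -
  obtain C where C: "C \<in> S" "{a, b} \<in> edges C" using e by blast
  then have "{a, b} \<subseteq> verts C" "card {a, b} = 2" using copyD(5) S by blast+
  then have "walk S a [(C, b)] b" using C by (auto split: if_splits)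
  then show ?thesis unfolding near_def by (intro exI[of _ "[(C, b)]"]) simp
qed

text \<open>Otherwise \<open>U\<close>, the set \<open>X\<close> with its neighbours, has at most
  \<open>7 * card X\<close> vertices. A chosen copy at a vertex of \<open>X\<close> has an edge
  there, so it meets \<open>U\<close> at least twice. There are at least
  \<open>14 * v * card X\<close> incidences of \<open>X\<close> with such copies, at most
  \<open>v\<close> per copy, hence at least \<open>2 * card U\<close> copies, against
  sparsity.\<close>

lemma card_nbh_not_small:
  assumes S: "S \<subseteq> A" and sp: "sparse M S" and X: "X \<subseteq> V - small S" "7 * real (card X) * M ^ 3 \<le> real n"
    and M: "0 \<le> M"
  shows "6 * card X \<le> card (nbh (E S) X)"
proof (rule ccontr)
  assume no: "\<not> ?thesis"
  define U where "U = X \<union> nbh (E S) X"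
  have finX: "finite X" using X(1) by (rule finite_subset) simp
  have finN: "finite (nbh (E S) X)" using nbh_subset[OF S] by (rule finite_subset) simp
  have finS: "finite S" using S by (rule finite_subset) simp
  have "card U = card X + card (nbh (E S) X)"
    unfolding U_def using finX finN by (intro card_Un_disjoint) (auto simp: nbh_def)
  then have U: "card U \<le> 7 * card X" using no by simp
  have "real (card U) * M ^ 3 \<le> real (7 * card X) * M ^ 3"
    using U M by (intro mult_right_mono) auto
  also have "\<dots> \<le> real n" using X(2) by simp
  finally have "real (card U) * M ^ 3 \<le> real n" .
  moreover have "X \<noteq> {}" using no by auto
  moreover have "U \<subseteq> V" using X(1) nbh_subset[OF S] unfolding U_def by blast
  ultimately have few: "card {C \<in> S. 2 \<le> card (verts C \<inter> U)} < 2 * card U"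
    using sp unfolding sparse_def U_def by blast
  have touch: "2 \<le> card (verts C \<inter> U)" if C: "C \<in> S" and w: "w \<in> X" "w \<in> verts C" for C w
  proof -
    obtain y where y: "y \<in> verts C" "y \<noteq> w" "{w, y} \<in> edges C"
      using copy_edge_at[of C w] C w S by blast
    have "y \<in> U" using y C w by (auto simp: U_def nbh_def)
    then have "{w, y} \<subseteq> verts C \<inter> U" using w y by (auto simp: U_def)
    moreover have "finite (verts C \<inter> U)" using copyD(3)[of C] C S by auto
    ultimately have "card {w, y} \<le> card (verts C \<inter> U)" by (intro card_mono)
    then show ?thesis using y by simp
  qed
  have "14 * v * card X = (\<Sum>w\<in>X. 14 * v)" by simp
  also have "\<dots> \<le> (\<Sum>w\<in>X. card (copies_at S w))"
    by (rule sum_mono) (use X(1) in \<open>auto simp: small_def\<close>)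
  also have "\<dots> = (\<Sum>C\<in>S. card {w \<in> X. w \<in> verts C})"
    by (rule sum_multicount_gen) (use finX finS in auto)
  also have "\<dots> = (\<Sum>C\<in>{C \<in> S. 2 \<le> card (verts C \<inter> U)}. card {w \<in> X. w \<in> verts C})"
    by (rule sum.mono_neutral_right) (use finS touch in \<open>auto simp: card_eq_0_iff\<close>)
  also have "\<dots> \<le> (\<Sum>C\<in>{C \<in> S. 2 \<le> card (verts C \<inter> U)}. v)"
  proof (rule sum_mono)
    fix C assume "C \<in> {C \<in> S. 2 \<le> card (verts C \<inter> U)}"
    then have "C \<in> A" using S by blast
    then have "card {w \<in> X. w \<in> verts C} \<le> card (verts C)" using copyD(3) by (intro card_mono) auto
    then show "card {w \<in> X. w \<in> verts C} \<le> v" using copy_card(1)[OF \<open>C \<in> A\<close>] by simp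
  qed
  also have "\<dots> = v * card {C \<in> S. 2 \<le> card (verts C \<inter> U)}" by simp
  also have "\<dots> < v * (2 * card U)" using few v_ge_2 by simp
  also have "\<dots> \<le> v * (2 * (7 * card X))" using U by simp
  finally show False by simp
qed

text \<open>Large sets are covered by \<open>spread\<close>. A smaller one is split into its part in
  \<open>small S\<close> and the rest for \<open>card_nbh_ge_combine\<close>; every overlap excluded
  there would join two different vertices of \<open>small S\<close> by at most four steps.\<close>

lemma expanderI:
  assumes S: "S \<subseteq> A" and M: "0 \<le> M"
    and good: "sparse M S" "separated S" "degree_ge_2 S" "spread M S"
  shows "expander V (E S)"
  unfolding expander_def
proof (intro allI impI)
  fix X assume X: "X \<subseteq> V \<and> X \<noteq> {} \<and> 4 * card X \<le> card V"
  have finX: "finite X" using X finite_subset by blast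
  show "2 * card X \<le> card (nbh (E S) X)"
  proof (cases "real n < 7 * real (card X) * M ^ 3")
    case True
    then show ?thesis using good(4) X unfolding spread_def by simp
  next
    case False
    define X1 X2 where "X1 = X \<inter> small S" and "X2 = X - small S"
    have Xs: "X = X1 \<union> X2" "X1 \<inter> X2 = {}" "finite X1" "finite X2" "X1 \<subseteq> V" "X1 \<subseteq> small S" "X2 \<subseteq> V - small S"
      using X finX by (auto simp: X1_def X2_def)
    have cX: "card X = card X1 + card X2" unfolding Xs(1) by (rule card_Un_disjoint) (use Xs in auto)
    have "7 * real (card X2) * M ^ 3 \<le> 7 * real (card X) * M ^ 3"
      using M cX by (intro mult_right_mono) auto
    then have "7 * real (card X2) * M ^ 3 \<le> real n" using False by simp
    then have c2: "6 * card X2 \<le> card (nbh (E S) X2)"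
      by (rule card_nbh_not_small[OF S good(1) Xs(7) _ M])
    have "\<exists>T. T \<subseteq> nbh (E S) {u} \<and> card T = 2" if "u \<in> X1" for u
    proof -
      have "2 \<le> card (nbh (E S) {u})" using good(3) that Xs unfolding degree_ge_2_def by blast
      then show ?thesis by (meson obtain_subset_with_card_n)
    qed
    then obtain T where T: "\<And>u. u \<in> X1 \<Longrightarrow> T u \<subseteq> nbh (E S) {u} \<and> card (T u) = 2" by metis
    have sep: "a = b" if "a \<in> X1" "b \<in> X1" "near S k a b" "k \<le> 4" for a b k
    proof -
      have "near S 4 a b" using near_mono[OF that(3,4)] .
      moreover have "a \<in> small S" "b \<in> small S" using that Xs(6) by auto
      ultimately show ?thesis using good(2) unfolding separated_def by blast
    qed
    have nT: "near S 1 u y" "near S 1 y u" if "u \<in> X1" "y \<in> insert u (T u)" for u y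
    proof -
      have "near S 1 u y \<and> near S 1 y u"
      proof (cases "y = u")
        case False
        then have e: "{u, y} \<in> E S" using that T by (auto simp: nbh_def)
        moreover have "{y, u} \<in> E S" using e by (subst insert_commute)
        ultimately show ?thesis using edge_near[OF S] by blast
      qed (simp add: near_refl)
      then show "near S 1 u y" "near S 1 y u" by blast+
    qed
    have "2 * (card X1 + card X2) \<le> card (nbh (E S) (X1 \<union> X2))"
    proof (rule card_nbh_ge_combine[where T = T])
      show "finite (nbh (E S) (X1 \<union> X2))" "finite (nbh (E S) X2)"
        using nbh_subset[OF S] by (auto intro: finite_subset)
      show "T u \<subseteq> nbh (E S) {u} \<and> card (T u) = 2" if "u \<in> X1" for u using T[OF that] .
      show "T u \<inter> T u' = {}" if "u \<in> X1" "u' \<in> X1" "u \<noteq> u'" for u u'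
      proof (rule ccontr)
        assume "T u \<inter> T u' \<noteq> {}"
        then obtain y where "y \<in> insert u (T u)" "y \<in> insert u' (T u')" by blast
        then have "near S (1 + 1) u u'"
          by (rule near_trans[OF nT(1)[OF that(1)] nT(2)[OF that(2)]])
        then have "u = u'" by (rule sep[OF that(1,2)]) simp
        then show False using that by simp
      qed
      show "T u \<inter> X1 = {}" if "u \<in> X1" for u
      proof (rule ccontr)
        assume "T u \<inter> X1 \<noteq> {}"
        then obtain y where y: "y \<in> T u" "y \<in> X1" by blast
        then have "u = y" using sep[OF that y(2) nT(1)] that by simp
        then show False using y T[OF that] by (auto simp: nbh_def)
      qed
      show "u = u'" if "w \<in> X2" "u \<in> X1" "u' \<in> X1" "y \<in> insert u (T u)" "y' \<in> insert u' (T u')"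
        "{w, y} \<in> E S" "{w, y'} \<in> E S" for w u u' y y'
      proof -
        have "{y, w} \<in> E S" using that(6) by (subst insert_commute)
        then have "near S (1 + 1) u w" by (rule near_trans[OF nT(1)[OF that(2,4)] edge_near[OF S]])
        moreover have "near S (1 + 1) w u'" by (rule near_trans[OF edge_near[OF S that(7)] nT(2)[OF that(3,5)]])
        ultimately have "near S ((1 + 1) + (1 + 1)) u u'" by (rule near_trans)
        then show ?thesis by (rule sep[OF that(2,3)]) simp
      qed
    qed (use Xs c2 in auto)
    then show ?thesis using cX Xs(1) by simp
  qed
qed

end

section \<open>The first round is an expander\<close>

lemma one_minus_power_le_exp:
  fixes p :: real
  assumes "p \<le> 1"
  shows "(1 - p) ^ m \<le> exp (- p * real m)"
proof -
  have "(1 - p) ^ m \<le> exp (- p) ^ m"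
    using assms exp_ge_add_one_self[of "- p"] by (intro power_mono) auto
  then show ?thesis by (simp add: exp_of_nat2_mult[symmetric])
qed

lemma sum_powers_le:
  fixes r :: real
  assumes r: "0 \<le> r" "r \<le> 1/2" and K: "finite K" "0 \<notin> K"
  shows "(\<Sum>u\<in>K. r ^ u) \<le> 2 * r"
proof -
  have 1: "(\<Sum>u=1..m. r ^ u) \<le> 2 * r * (1 - (1/2) ^ m)" for m
  proof (induction m)
    case (Suc m)
    have "r ^ m \<le> (1/2) ^ m" using r by (intro power_mono) auto
    then have "r ^ Suc m \<le> r * (1/2) ^ m" using r by (simp add: mult_left_mono)
    then show ?case using Suc by (simp add: algebra_simps)
  qed simp
  obtain m where "K \<subseteq> {1..m}"
  proof -
    have "K \<subseteq> {1..Max K}" using K by (auto simp: Suc_le_eq intro: gr0I)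
    then show ?thesis using that by blast
  qed
  then have "(\<Sum>u\<in>K. r ^ u) \<le> (\<Sum>u=1..m. r ^ u)" using r by (intro sum_mono2) auto
  also have "\<dots> \<le> 2 * r * (1 - (1/2) ^ m)" by (rule 1)
  also have "\<dots> \<le> 2 * r" using r by (simp add: mult_left_le)
  finally show ?thesis .
qed

text \<open>Grouping a union bound by the size \<open>k i\<close>: if the terms of size
  \<open>u\<close> sum to at most \<open>r ^ u\<close>, the total is dominated by a geometric
  series.\<close>

lemma sum_by_size_le:
  fixes f :: "_ \<Rightarrow> real"
  assumes I: "finite I" "\<And>i. i \<in> I \<Longrightarrow> 1 \<le> k i" and r: "0 \<le> r" "r \<le> 1/2"
    and f: "\<And>i. i \<in> I \<Longrightarrow> f i \<le> g (k i)"
    and card: "\<And>u. u \<in> k ` I \<Longrightarrow> 0 \<le> g u \<and> real (card {i \<in> I. k i = u}) * g u \<le> r ^ u"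
  shows "(\<Sum>i\<in>I. f i) \<le> 2 * r"
proof -
  have "(\<Sum>i\<in>I. f i) = (\<Sum>u\<in>k ` I. \<Sum>i\<in>{i \<in> I. k i = u}. f i)"
    by (rule sum.group[symmetric]) (use I in auto)
  also have "\<dots> \<le> (\<Sum>u\<in>k ` I. r ^ u)"
  proof (rule sum_mono)
    fix u assume u: "u \<in> k ` I"
    have "(\<Sum>i\<in>{i \<in> I. k i = u}. f i) \<le> (\<Sum>i\<in>{i \<in> I. k i = u}. g u)"
      by (rule sum_mono) (use f in auto)
    also have "\<dots> \<le> r ^ u" using card[OF u] by simp
    finally show "(\<Sum>i\<in>{i \<in> I. k i = u}. f i) \<le> r ^ u" .
  qed
  also have "\<dots> \<le> 2 * r"
    by (rule sum_powers_le) (use I r in force)+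
  finally show ?thesis .
qed

lemma prob_random_subset_union_bound':
  assumes "finite A" "0 \<le> p" "p \<le> 1" "finite I"
    and B: "\<And>i. i \<in> I \<Longrightarrow> B i \<subseteq> A \<and> 0 \<le> t i \<and> 0 \<le> c i"
    and "\<And>S. S \<subseteq> A \<Longrightarrow> Q S \<Longrightarrow> \<exists>i\<in>I. 1 \<le> c i * t i ^ card (S \<inter> B i)"
  shows "subset_prob A p {S. Q S} \<le> (\<Sum>i\<in>I. c i * (1 - (1 - t i) * p) ^ card (B i))"
  using prob_random_subset_union_bound[of A p I "\<lambda>_. {}" B t c Q] assms by auto

lemma prob_random_subset_mono_event:
  assumes "\<And>S. S \<subseteq> A \<Longrightarrow> P S \<Longrightarrow> Q S"
  shows "subset_prob A p {S. P S} \<le> subset_prob A p {S. Q S}"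
proof (rule measure_pmf.finite_measure_mono_AE)
  show "AE S in measure_pmf (random_subset A p). S \<in> {S. P S} \<longrightarrow> S \<in> {S. Q S}"
  proof (rule AE_pmfI)
    fix S assume "S \<in> set_pmf (random_subset A p)"
    then have "S \<subseteq> A" using set_pmf_random_subset by blast
    then show "S \<in> {S. P S} \<longrightarrow> S \<in> {S. Q S}" using assms by blast
  qed
qed simp

lemma prob_random_subset_disj:
  assumes "\<And>S. S \<subseteq> A \<Longrightarrow> P S \<Longrightarrow> Q S \<or> R S"
  shows "subset_prob A p {S. P S}
    \<le> subset_prob A p {S. Q S} + subset_prob A p {S. R S}"
proof -
  have "subset_prob A p {S. P S} \<le> subset_prob A p {S. Q S \<or> R S}"
    by (rule prob_random_subset_mono_event) (use assms in blast)
  also have "{S. Q S \<or> R S} = {S. Q S} \<union> {S. R S}" by auto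
  also have "subset_prob A p ({S. Q S} \<union> {S. R S})
    \<le> subset_prob A p {S. Q S} + subset_prob A p {S. R S}"
    by (rule measure_Un_le) auto
  finally show ?thesis .
qed

section \<open>Union bounds for small and for large vertex sets\<close>

context copies_host
begin

text \<open>Double counting of the incidences between pairs in \<open>P\<close> and copies: each
  pair is an edge of \<open>me\<close> copies, each copy has \<open>q\<close> edges.\<close>

lemma card_copies_meeting:
  assumes P: "P \<subseteq> {e. e \<subseteq> V \<and> card e = 2}"
  shows "card P * me \<le> q * card {C \<in> A. edges C \<inter> P \<noteq> {}}"
proof -
  have finP: "finite P" using P by (rule finite_subset) simp
  have "card {C \<in> A. e \<in> edges C} = me" if "e \<in> P" for e
    using that P card_copies_edge by (auto simp: card_2_iff)
  then have "card P * me = (\<Sum>e\<in>P. card {C \<in> A. e \<in> edges C})" by simp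
  also have "\<dots> = (\<Sum>C\<in>A. card {e \<in> P. e \<in> edges C})"
    by (rule sum_multicount_gen) (use finP in auto)
  also have "\<dots> = (\<Sum>C\<in>{C \<in> A. edges C \<inter> P \<noteq> {}}. card {e \<in> P. e \<in> edges C})"
    by (rule sum.mono_neutral_right) (auto simp: card_eq_0_iff)
  also have "\<dots> \<le> (\<Sum>C\<in>{C \<in> A. edges C \<inter> P \<noteq> {}}. q)"
  proof (rule sum_mono)
    fix C assume "C \<in> {C \<in> A. edges C \<inter> P \<noteq> {}}"
    then have C: "C \<in> A" by blast
    have "card {e \<in> P. e \<in> edges C} \<le> card (edges C)" using copyD(4)[OF C] by (intro card_mono) auto
    then show "card {e \<in> P. e \<in> edges C} \<le> q" using copy_card(2)[OF C] by simp
  qed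
  finally show ?thesis by (simp add: mult.commute)
qed

text \<open>The right-hand side is the expected number of chosen copies with an edge in
  \<open>P\<close>. The overcounting factor \<open>q\<close> cancels against the one in
  \<open>me_ge\<close>.\<close>

lemma copies_meeting_rate:
  assumes P: "P \<subseteq> {e. e \<subseteq> V \<and> card e = 2}" and p: "0 \<le> p"
  shows "2 * (real (m1 H n) * p) * real (card P) / (real v * real n)
     \<le> p * real (card {C \<in> A. edges C \<inter> P \<noteq> {}})"
proof -
  let ?B = "real (card {C \<in> A. edges C \<inter> P \<noteq> {}})"
  have 1: "real (card P) * real me \<le> real q * ?B"
    using card_copies_meeting[OF P] unfolding of_nat_mult[symmetric] of_nat_le_iff .
  have "real q * (2 * real (m1 H n) * real (card P)) \<le> (real v * real n * real me) * real (card P)"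
    using mult_right_mono[OF me_ge, of "real (card P)"] by (simp add: mult_ac)
  also have "\<dots> = real v * real n * (real (card P) * real me)" by (simp add: mult_ac)
  also have "\<dots> \<le> real v * real n * (real q * ?B)" by (rule mult_left_mono[OF 1]) simp
  also have "\<dots> = real q * (real v * real n * ?B)" by (simp add: mult_ac)
  finally have "2 * real (m1 H n) * real (card P) \<le> real v * real n * ?B"
    by (rule mult_left_le_imp_le) (use q_pos in simp)
  then have "p * (2 * real (m1 H n) * real (card P)) \<le> p * (real v * real n * ?B)"
    by (rule mult_left_mono[OF _ p])
  then show ?thesis using n v_ge_2 by (simp add: divide_le_eq mult_ac)
qed

lemma pair_rate:
  assumes "0 \<le> p"
  shows "p * real m2 \<le> real v * (real (m1 H n) * p) / real n"
  using mult_left_mono[OF m2_le assms] n by (simp add: le_divide_eq mult_ac)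

lemma card_copies_two_in:
  assumes U: "U \<subseteq> V"
  shows "card {C \<in> A. 2 \<le> card (verts C \<inter> U)} \<le> card U * card U * m2"
proof -
  let ?P = "{(a, b). a \<in> U \<and> b \<in> U \<and> a \<noteq> b}"
  have finU: "finite U" using U by (rule finite_subset) simp
  have sub: "?P \<subseteq> U \<times> U" by auto
  have finP: "finite ?P" using sub by (rule finite_subset) (use finU in simp)
  have "{C \<in> A. 2 \<le> card (verts C \<inter> U)} \<subseteq> (\<Union>(a, b)\<in>?P. {C \<in> A. a \<in> verts C \<and> b \<in> verts C})"
  proof
    fix C assume C: "C \<in> {C \<in> A. 2 \<le> card (verts C \<inter> U)}"
    then have "2 \<le> card (verts C \<inter> U)" by simp
    then obtain T where T: "T \<subseteq> verts C \<inter> U" "card T = 2" by (rule obtain_subset_with_card_n)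
    then obtain a b where "T = {a, b}" "a \<noteq> b" unfolding card_2_iff by blast
    then have "(a, b) \<in> ?P" "a \<in> verts C \<and> b \<in> verts C" using T by simp_all
    then show "C \<in> (\<Union>(a, b)\<in>?P. {C \<in> A. a \<in> verts C \<and> b \<in> verts C})" using C by blast
  qed
  then have "card {C \<in> A. 2 \<le> card (verts C \<inter> U)} \<le> card (\<Union>(a, b)\<in>?P. {C \<in> A. a \<in> verts C \<and> b \<in> verts C})"
    using finP by (intro card_mono) auto
  also have "\<dots> \<le> (\<Sum>(a, b)\<in>?P. card {C \<in> A. a \<in> verts C \<and> b \<in> verts C})"
    using card_UN_le[OF finP, of "\<lambda>(a, b). {C \<in> A. a \<in> verts C \<and> b \<in> verts C}"]
    by (simp add: case_prod_unfold)
  also have "\<dots> = (\<Sum>(a, b)\<in>?P. m2)"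
    using U by (intro sum.cong) (auto intro!: card_copies_pair)
  also have "\<dots> = card ?P * m2" by (simp add: case_prod_unfold)
  also have "card ?P \<le> card U * card U"
    using card_mono[OF _ sub] finU by (simp add: card_cartesian_product)
  finally show ?thesis by simp
qed

text \<open>An upper tail estimate by an exponential moment: for a set of size \<open>u\<close> the
  probability is at most \<open>(u * M / n) ^ (2 * u) * exp (u * v)\<close>. There are at most
  \<open>(e * n / u) ^ u\<close> such sets, so size \<open>u\<close> contributes the
  \<open>u\<close>-th power of \<open>exp (v + 1) * u * M ^ 2 / n\<close>, whose base is at most
  \<open>exp (v + 1) / M\<close> by the cutoff.\<close>

lemma prob_not_sparse:
  assumes p: "0 \<le> p" "p \<le> 1" and M: "M = real (m1 H n) * p" "1 \<le> M"
    and r: "exp (real v + 1) / M \<le> 1 / 2"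
  shows "subset_prob A p {S. \<not> sparse M S} \<le> 2 * (exp (real v + 1) / M)"
proof -
  define I where "I = {U. U \<subseteq> V \<and> U \<noteq> {} \<and> real (card U) * M ^ 3 \<le> real n}"
  define B where "B = (\<lambda>U. {C \<in> A. 2 \<le> card (verts C \<inter> U)})"
  \<comment> \<open>Chosen so that \<open>t U\<close> times \<open>card U ^ 2 * v * M / n\<close>,
    which bounds the expected number of chosen copies meeting \<open>U\<close> twice, is
    \<open>card U * v\<close>.\<close>
  define t where "t = (\<lambda>U :: nat set. real n / (real (card U) * M))"
  define c where "c = (\<lambda>U. (1 / t U) ^ (2 * card U))"
  have fI: "finite I" by (rule finite_subset[of _ "Pow V"]) (auto simp: I_def)
  have U1: "1 \<le> card U" if "U \<in> I" for U
    using that by (auto simp: I_def Suc_le_eq card_gt_0_iff intro: finite_subset[OF _ finite_atLeastAtMost])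
  have t1: "1 \<le> t U" if U: "U \<in> I" for U
  proof -
    have "M \<le> M ^ 3" using M(2) by (intro self_le_power) auto
    then have "real (card U) * M \<le> real (card U) * M ^ 3" by (intro mult_left_mono) auto
    also have "\<dots> \<le> real n" using U by (simp add: I_def)
    finally show ?thesis using U1[OF U] M(2) by (simp add: t_def le_divide_eq)
  qed
  have "subset_prob A p {S. \<not> sparse M S}
     \<le> (\<Sum>U\<in>I. c U * (1 - (1 - t U) * p) ^ card (B U))"
  proof (rule prob_random_subset_union_bound')
    show "B U \<subseteq> A \<and> 0 \<le> t U \<and> 0 \<le> c U" if "U \<in> I" for U
      using t1[OF that] by (auto simp: B_def c_def)
    show "\<exists>U\<in>I. 1 \<le> c U * t U ^ card (S \<inter> B U)" if S: "S \<subseteq> A" "\<not> sparse M S" for S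
    proof -
      obtain U where U: "U \<in> I" "2 * card U \<le> card {C \<in> S. 2 \<le> card (verts C \<inter> U)}"
        using S(2) unfolding sparse_def I_def mem_Collect_eq not_all not_imp not_less by blast
      have "{C \<in> S. 2 \<le> card (verts C \<inter> U)} = S \<inter> B U" using S by (auto simp: B_def)
      then have "t U ^ (2 * card U) \<le> t U ^ card (S \<inter> B U)"
        using U t1 by (intro power_increasing) auto
      then have "c U * t U ^ (2 * card U) \<le> c U * t U ^ card (S \<inter> B U)"
        using t1[OF U(1)] by (intro mult_left_mono) (auto simp: c_def)
      moreover have "c U * t U ^ (2 * card U) = 1"
        using t1[OF U(1)] unfolding c_def power_mult_distrib[symmetric] by simp
      ultimately show ?thesis using U by auto
    qed
  qed (use p fI in auto)
  also have "\<dots> \<le> 2 * (exp (real v + 1) / M)"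
  proof (rule sum_by_size_le[where k = card and g = "\<lambda>u. (real u * M / real n) ^ (2 * u) * exp (real u * real v)"])
    fix U assume U: "U \<in> I"
    have "(1 - (1 - t U) * p) ^ card (B U) = (1 - (- (t U - 1) * p)) ^ card (B U)" by simp
    also have "\<dots> \<le> exp (- (- (t U - 1) * p) * real (card (B U)))"
      by (rule one_minus_power_le_exp) (use t1[OF U] p mult_nonneg_nonneg[of "t U - 1" p] in linarith)
    also have "\<dots> \<le> exp (real (card U) * real v)"
    proof -
      have "card (B U) \<le> card U * card U * m2"
        unfolding B_def by (rule card_copies_two_in) (use U in \<open>simp add: I_def\<close>)
      then have "real (card (B U)) \<le> real (card U * card U * m2)" by (simp only: of_nat_le_iff)
      then have "p * real (card (B U)) \<le> p * real (card U * card U * m2)"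
        by (rule mult_left_mono[OF _ p(1)])
      also have "\<dots> = real (card U) * real (card U) * (p * real m2)" by simp
      also have "\<dots> \<le> real (card U) * real (card U) * (real v * M / real n)"
        using pair_rate[OF p(1)] M(1) by (intro mult_left_mono) auto
      finally have 1: "p * real (card (B U)) \<le> real (card U) * real (card U) * (real v * M / real n)" .
      have "(t U - 1) * (p * real (card (B U))) \<le> t U * (p * real (card (B U)))"
        using p by (intro mult_right_mono) auto
      also have "\<dots> \<le> t U * (real (card U) * real (card U) * (real v * M / real n))"
        using t1[OF U] by (intro mult_left_mono 1) auto
      also have "\<dots> = real (card U) * real v"
        using U1[OF U] M(2) n by (simp add: t_def)
      finally show ?thesis by (simp add: algebra_simps)
    qed
    finally have "(1 - (1 - t U) * p) ^ card (B U) \<le> exp (real (card U) * real v)" .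
    moreover have "c U = (real (card U) * M / real n) ^ (2 * card U)" by (simp add: c_def t_def)
    ultimately show "c U * (1 - (1 - t U) * p) ^ card (B U)
        \<le> (real (card U) * M / real n) ^ (2 * card U) * exp (real (card U) * real v)"
      using M(2) by (auto intro!: mult_left_mono)
  next
    fix u assume "u \<in> card ` I"
    then obtain U where U: "U \<in> I" "u = card U" by blast
    then have u1: "1 \<le> u" and u3: "real u * M ^ 3 \<le> real n" using U1 by (auto simp: I_def)
    have un: "u \<le> n" using U card_mono[of V U] by (auto simp: I_def)
    have "real (card {U \<in> I. card U = u}) \<le> real (card {U. U \<subseteq> V \<and> card U \<le> u})"
      unfolding of_nat_le_iff by (rule card_mono) (auto simp: I_def)
    also have "\<dots> \<le> (1 / (real u / real n)) ^ u * exp (real u / real n * real (card V))"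
      by (rule card_bounded_subsets_le) (use u1 un n in auto)
    also have "\<dots> = (real n / real u * exp 1) ^ u"
      using n exp_of_nat_mult[of u "1::real"] by (simp add: power_mult_distrib power_divide)
    finally have "real (card {U \<in> I. card U = u}) * ((real u * M / real n) ^ (2 * u) * exp (real u * real v))
      \<le> (real n / real u * exp 1) ^ u * ((real u * M / real n) ^ (2 * u) * exp (real u * real v))"
      using M(2) by (intro mult_right_mono) auto
    also have "\<dots> = (real n / real u * exp 1 * ((real u * M / real n)\<^sup>2 * exp (real v))) ^ u"
      by (simp only: power_mult_distrib power_mult exp_of_nat_mult)
    also have "real n / real u * exp 1 * ((real u * M / real n)\<^sup>2 * exp (real v))
       = (real u * M ^ 2 / real n) * exp (real v + 1)"
      using u1 n by (simp add: power2_eq_square exp_add)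
    also have "((real u * M ^ 2 / real n) * exp (real v + 1)) ^ u \<le> (1 / M * exp (real v + 1)) ^ u"
    proof (intro power_mono mult_right_mono)
      have "M * (real u * M ^ 2) \<le> real n" using u3 by (simp add: power3_eq_cube power2_eq_square mult_ac)
      then show "real u * M ^ 2 / real n \<le> 1 / M" using M(2) n by (simp add: field_simps)
    qed (use M(2) in auto)
    finally show "0 \<le> (real u * M / real n) ^ (2 * u) * exp (real u * real v) \<and>
      real (card {U \<in> I. card U = u}) * ((real u * M / real n) ^ (2 * u) * exp (real u * real v))
      \<le> (exp (real v + 1) / M) ^ u" by simp
  qed (use fI U1 r M(2) in auto)
  finally show ?thesis .
qed

text \<open>If \<open>X\<close> fails and \<open>T\<close> is its neighbourhood, no chosen copy has
  an edge between \<open>X\<close> and the remaining vertices. With \<open>s = card X\<close> there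
  are at least \<open>s * n / 4\<close> such pairs, which gives the exponent
  \<open>s * M / (2 * v)\<close>. The pairs \<open>(X, T)\<close> number at most
  \<open>((n / s) ^ 3 * exp 2) ^ s\<close>, and \<open>n / s < 7 * M ^ 3\<close> explains
  \<open>343 * M ^ 9\<close>.\<close>

lemma prob_not_spread:
  assumes p: "0 \<le> p" "p \<le> 1" and M: "M = real (m1 H n) * p" "1 \<le> M"
    and r: "343 * exp 2 * M ^ 9 * exp (- M / (2 * real v)) \<le> 1 / 2"
  shows "subset_prob A p {S. \<not> spread M S} \<le> 2 * (343 * exp 2 * M ^ 9 * exp (- M / (2 * real v)))"
proof -
  define I where "I = {(X, T). X \<subseteq> V \<and> X \<noteq> {} \<and> real n < 7 * real (card X) * M ^ 3 \<and> 4 * card X \<le> n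
     \<and> T \<subseteq> V \<and> card T \<le> 2 * card X}"
  define P where "P = (\<lambda>(X, T). (\<lambda>(x, y). {x, y}) ` (X \<times> (V - X - T)))"
  define B where "B = (\<lambda>i. {C \<in> A. edges C \<inter> P i \<noteq> {}})"
  have fI: "finite I" by (rule finite_subset[of _ "Pow V \<times> Pow V"]) (auto simp: I_def)
  have I1: "1 \<le> card (fst i)" if "i \<in> I" for i
  proof -
    have i: "fst i \<subseteq> V" "fst i \<noteq> {}" using that by (auto simp: I_def)
    have "finite (fst i)" using i(1) by (rule finite_subset[OF _ finite_atLeastAtMost])
    then show ?thesis using i by (simp add: Suc_le_eq card_gt_0_iff)
  qed
  have "subset_prob A p {S. \<not> spread M S}
     \<le> (\<Sum>i\<in>I. 1 * (1 - (1 - 0) * p) ^ card (B i))"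
  proof (rule prob_random_subset_union_bound')
    show "B i \<subseteq> A \<and> 0 \<le> (0::real) \<and> 0 \<le> (1::real)" if "i \<in> I" for i
      by (auto simp: B_def)
    show "\<exists>i\<in>I. 1 \<le> 1 * (0::real) ^ card (S \<inter> B i)" if S: "S \<subseteq> A" "\<not> spread M S" for S
    proof -
      obtain X where X: "X \<subseteq> V" "X \<noteq> {}" "real n < 7 * real (card X) * M ^ 3" "4 * card X \<le> n"
        "card (nbh (E S) X) < 2 * card X"
        using S(2) unfolding spread_def not_all not_imp not_le by blast
      have i: "(X, nbh (E S) X) \<in> I" using X nbh_subset[OF S(1)] by (auto simp: I_def)
      have "S \<inter> B (X, nbh (E S) X) = {}"
      proof (rule ccontr)
        assume "S \<inter> B (X, nbh (E S) X) \<noteq> {}"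
        then obtain C x y where "C \<in> S" "{x, y} \<in> edges C" "x \<in> X" "y \<notin> X" "y \<notin> nbh (E S) X"
          by (auto simp: B_def P_def)
        then show False unfolding nbh_def by blast
      qed
      then show ?thesis using i by (intro bexI[OF _ i]) simp
    qed
  qed (use p fI in auto)
  also have "\<dots> \<le> 2 * (343 * exp 2 * M ^ 9 * exp (- M / (2 * real v)))"
  proof (rule sum_by_size_le[where k = "\<lambda>i. card (fst i)" and g = "\<lambda>s. exp (- (real s * M / (2 * real v)))"])
    fix i assume i: "i \<in> I"
    then obtain X T where XT: "i = (X, T)" "X \<subseteq> V" "4 * card X \<le> n" "T \<subseteq> V" "card T \<le> 2 * card X"
      by (auto simp: I_def)
    have fin: "finite X" "finite T" using XT by (auto intro: finite_subset)
    have cP: "card (P i) = card X * card (V - X - T)"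
    proof -
      have "inj_on (\<lambda>(x, y). {x, y}) (X \<times> (V - X - T))"
        by (auto simp: inj_on_def doubleton_eq_iff)
      then show ?thesis by (simp add: P_def XT(1) card_image card_cartesian_product)
    qed
    have PV: "P i \<subseteq> {e. e \<subseteq> V \<and> card e = 2}" using XT by (auto simp: P_def card_insert_if)
    \<comment> \<open>\<open>X\<close> and \<open>T\<close> together have at most
      \<open>3 * card X\<close> vertices, that is at most three quarters of
      \<open>V\<close>.\<close>
    have "n \<le> 4 * card (V - X - T)"
    proof -
      have "card V - card (X \<union> T) \<le> card (V - (X \<union> T))" using fin by (intro diff_card_le_card_Diff) simp
      moreover have "card (X \<union> T) \<le> card X + card T" by (rule card_Un_le)
      moreover have "V - (X \<union> T) = V - X - T" by blast
      ultimately show ?thesis using XT by simp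
    qed
    then have W: "real n \<le> 4 * real (card (V - X - T))" by linarith
    have "real (card X) * M / (2 * real v) = 2 * M * (real (card X) * (real n / 4)) / (real v * real n)"
      using n v_ge_2 by (simp add: field_simps)
    also have "\<dots> \<le> 2 * M * (real (card X) * real (card (V - X - T))) / (real v * real n)"
      using W M(2) by (intro divide_right_mono mult_left_mono) auto
    also have "\<dots> = 2 * (real (m1 H n) * p) * real (card (P i)) / (real v * real n)"
      unfolding cP M(1) by simp
    also have "\<dots> \<le> p * real (card (B i))"
      unfolding B_def by (rule copies_meeting_rate[OF PV p(1)])
    finally have 1: "real (card X) * M / (2 * real v) \<le> p * real (card (B i))" .
    have "(1 - p) ^ card (B i) \<le> exp (- p * real (card (B i)))"
      by (rule one_minus_power_le_exp[OF p(2)])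
    also have "\<dots> \<le> exp (- (real (card X) * M / (2 * real v)))" using 1 by simp
    finally show "1 * (1 - (1 - 0) * p) ^ card (B i) \<le> exp (- (real (card (fst i)) * M / (2 * real v)))"
      using XT by simp
  next
    fix s assume "s \<in> (\<lambda>i. card (fst i)) ` I"
    then obtain i where i: "i \<in> I" "s = card (fst i)" by blast
    then have s: "1 \<le> s" "real n < 7 * real s * M ^ 3" "4 * s \<le> n" using I1 by (auto simp: I_def)
    have y: "0 < real s / real n" "real s / real n \<le> 1" using s n by auto
    let ?A1 = "{X. X \<subseteq> V \<and> card X \<le> s}" and ?A2 = "{T. T \<subseteq> V \<and> card T \<le> 2 * s}"
    have ns: "1 / (real s / real n) = real n / real s" "real s / real n * real (card V) = real s" using n by auto
    have "{i \<in> I. card (fst i) = s} \<subseteq> ?A1 \<times> ?A2" by (auto simp: I_def)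
    then have "card {i \<in> I. card (fst i) = s} \<le> card (?A1 \<times> ?A2)" by (intro card_mono) auto
    then have "real (card {i \<in> I. card (fst i) = s}) \<le> real (card ?A1) * real (card ?A2)"
      unfolding card_cartesian_product of_nat_mult[symmetric] of_nat_le_iff .
    also have "\<dots> \<le> ((real n / real s) ^ s * exp (real s)) * ((real n / real s) ^ (2 * s) * exp (real s))"
      using card_bounded_subsets_le[OF _ y, of V s] card_bounded_subsets_le[OF _ y, of V "2 * s"]
      unfolding ns by (intro mult_mono) auto
    also have "\<dots> = ((real n / real s) ^ 3 * exp 2) ^ s"
    proof -
      have "exp (real s) * exp (real s) = exp 2 ^ s" by (simp flip: exp_of_nat_mult exp_add)
      moreover have "(real n / real s) ^ s * (real n / real s) ^ (2 * s) = ((real n / real s) ^ 3) ^ s"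
        by (simp flip: power_mult power_add add: algebra_simps)
      ultimately show ?thesis unfolding power_mult_distrib by (metis (no_types, lifting) mult.assoc mult.left_commute)
    qed
    also have "\<dots> \<le> ((7 * M ^ 3) ^ 3 * exp 2) ^ s"
    proof (intro power_mono mult_right_mono)
      show "real n / real s \<le> 7 * M ^ 3" using s by (simp add: divide_le_eq mult_ac)
    qed (use s in auto)
    also have "(7 * M ^ 3) ^ 3 = 343 * M ^ 9" by (simp add: power_mult_distrib flip: power_mult)
    finally have "real (card {i \<in> I. card (fst i) = s}) * exp (- (real s * M / (2 * real v)))
       \<le> (343 * M ^ 9 * exp 2) ^ s * exp (- (real s * M / (2 * real v)))"
      by (intro mult_right_mono) auto
    also have es: "exp (- (real s * M / (2 * real v))) = exp (- M / (2 * real v)) ^ s"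
      by (simp flip: exp_of_nat_mult)
    also have "(343 * M ^ 9 * exp 2) ^ s * exp (- M / (2 * real v)) ^ s
       = (343 * exp 2 * M ^ 9 * exp (- M / (2 * real v))) ^ s"
      unfolding power_mult_distrib[symmetric] by (simp add: mult_ac)
    finally show "0 \<le> exp (- (real s * M / (2 * real v))) \<and>
      real (card {i \<in> I. card (fst i) = s}) * exp (- (real s * M / (2 * real v)))
      \<le> (343 * exp 2 * M ^ 9 * exp (- M / (2 * real v))) ^ s" unfolding es by simp
  qed (use fI I1 r M(2) in auto)
  finally show ?thesis .
qed

end

section \<open>Short walks between vertices in few copies\<close>

lemma walk_last: "walk S a ws b \<Longrightarrow> ws \<noteq> [] \<Longrightarrow> b = snd (last ws) \<and> b \<in> verts (fst (last ws)) \<and> fst ` set ws \<subseteq> S"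
proof (induction S a ws b rule: walk.induct)
  case (2 S a C y ws b)
  then show ?case by (cases "ws = []") auto
qed simp

lemma walk_mono: "walk S a ws b \<Longrightarrow> S \<subseteq> T \<Longrightarrow> walk T a ws b"
  by (induction S a ws b rule: walk.induct) auto

text \<open>The error terms from \<open>sparse\<close>, \<open>spread\<close> and \<open>separated\<close>, and the part of the one from
  \<open>degree_ge_2\<close> that vanishes for every \<open>M\<close> tending to infinity.\<close>
definition failure_bound :: "nat \<Rightarrow> real \<Rightarrow> real" where
  "failure_bound k M = 2 * (exp (real k + 1) / M) + 2 * (343 * exp 2 * M ^ 9 * exp (- M / (2 * real k)))
    + 4 * (real k * M) ^ 4 * 4 ^ (28 * k) * exp 4 * exp (- M / 2) + 3 * ((real k * M)\<^sup>2 * exp (- M))"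

context copies_host
begin

definition walks :: "nat \<Rightarrow> nat \<Rightarrow> (nat graph \<times> nat) list set" where
  "walks j a = {ws. length ws = j \<and> (\<exists>b. walk A a ws b)}"

text \<open>Each step picks one of the \<open>m1 H n\<close> copies at the current vertex and then
  one of its \<open>v\<close> vertices.\<close>

lemma card_walks: "a \<in> V \<Longrightarrow> finite (walks j a) \<and> card (walks j a) \<le> (v * m1 H n) ^ j"
proof (induction j arbitrary: a)
  case 0
  have "walks 0 a = {[]}" by (auto simp: walks_def)
  then show ?case by simp
next
  case (Suc j)
  define K where "K = Sigma (copies_at A a) verts"
  have K: "finite K" "card K = m1 H n * v"
  proof -
    show "finite K" unfolding K_def by (intro finite_SigmaI) (simp_all add: copyD(3))
    have "card K = (\<Sum>C\<in>copies_at A a. card (verts C))"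
      unfolding K_def by (rule card_SigmaI) (simp_all add: copyD(3))
    also have "\<dots> = (\<Sum>C\<in>copies_at A a. v)" by (rule sum.cong) (simp_all add: copy_card(1))
    finally show "card K = m1 H n * v" by (simp add: card_copies_at[OF Suc.prems])
  qed
  have KV: "y \<in> V" if "(C, y) \<in> K" for C y
  proof -
    have "C \<in> A" "y \<in> verts C" using that by (simp_all add: K_def)
    then show ?thesis using copyD(2) by blast
  qed
  have sub: "walks (Suc j) a \<subseteq> (\<lambda>(k, ws). k # ws) ` Sigma K (\<lambda>k. walks j (snd k))"
  proof
    fix ws assume "ws \<in> walks (Suc j) a"
    then obtain b where len: "length ws = Suc j" and w: "walk A a ws b" by (auto simp: walks_def)
    then obtain C y ws' where ws: "ws = (C, y) # ws'" by (metis length_Suc_conv surj_pair)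
    have "(C, y) \<in> K" using w by (simp add: ws K_def)
    moreover have "ws' \<in> walks j y" using w len unfolding ws walks_def by auto
    ultimately have "((C, y), ws') \<in> Sigma K (\<lambda>k. walks j (snd k))" by simp
    then show "ws \<in> (\<lambda>(k, ws). k # ws) ` Sigma K (\<lambda>k. walks j (snd k))"
      unfolding ws by (rule rev_image_eqI) simp
  qed
  have fin: "finite (Sigma K (\<lambda>k. walks j (snd k)))"
    using K(1) Suc.IH KV by (intro finite_SigmaI) auto
  have "card (walks (Suc j) a) \<le> card (Sigma K (\<lambda>k. walks j (snd k)))"
    using sub fin surj_card_le by blast
  also have "\<dots> = (\<Sum>k\<in>K. card (walks j (snd k)))"
    by (rule card_SigmaI) (use K(1) Suc.IH KV in auto)
  also have "\<dots> \<le> (\<Sum>k\<in>K. (v * m1 H n) ^ j)"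
    by (rule sum_mono) (use Suc.IH KV in auto)
  also have "\<dots> = (v * m1 H n) ^ Suc j" by (simp add: K(2) mult.commute)
  finally show ?case using finite_subset[OF sub finite_imageI[OF fin]] by simp
qed

lemma card_copies_either:
  assumes "a \<in> V" "b \<in> V" "a \<noteq> b"
  shows "card {C \<in> A. a \<in> verts C \<or> b \<in> verts C} + m2 = 2 * m1 H n"
proof -
  have "{C \<in> A. a \<in> verts C \<or> b \<in> verts C} = copies_at A a \<union> copies_at A b" by auto
  moreover have "copies_at A a \<inter> copies_at A b = {C \<in> A. a \<in> verts C \<and> b \<in> verts C}" by auto
  ultimately show ?thesis
    using card_Un_Int[of "copies_at A a" "copies_at A b"]
    by (simp add: card_copies_at[OF assms(1)] card_copies_at[OF assms(2)] card_copies_pair[OF assms])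
qed

text \<open>The union bound runs over a start vertex and a walk of at most four steps through
  distinct copies, so that the walk is present with probability \<open>p ^ length\<close>; each
  length contributes at most \<open>n * (v * M) ^ 4\<close>. At most \<open>28 * v\<close> copies
  are chosen at the two ends, which by the moment with \<open>t = 1/4\<close> costs
  \<open>exp (- 3/2 * M)\<close> up to constants. As \<open>n \<le> exp M\<close>, this leaves
  \<open>exp (- M / 2)\<close>; some \<open>t\<close> below 1/2 is essential.\<close>

lemma prob_not_separated:
  assumes p: "0 \<le> p" "p \<le> 1" and M: "M = real (m1 H n) * p" "1 \<le> M" "real v * M \<le> real n" "real n \<le> exp M"
  shows "subset_prob A p {S. \<not> separated S}
    \<le> 4 * (real v * M) ^ 4 * 4 ^ (28 * v) * exp 4 * exp (- M / 2)"
proof -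
  define I where "I = {(a, ws). a \<in> V \<and> (\<exists>b. walk A a ws b \<and> b \<noteq> a) \<and> ws \<noteq> [] \<and> length ws \<le> 4 \<and> distinct (map fst ws)}"
  define F where "F = (\<lambda>i :: nat \<times> (nat graph \<times> nat) list. fst ` set (snd i))"
  define B where "B = (\<lambda>i :: nat \<times> (nat graph \<times> nat) list.
     {C \<in> A. fst i \<in> verts C \<or> snd (last (snd i)) \<in> verts C} - F i)"
  define K where "K = (4::real) ^ (28 * v) * exp (4 - 3 / 2 * M)"
  have len: "length (snd i) \<in> {1..4}" if "i \<in> I" for i
    using that by (auto simp: I_def Suc_le_eq)
  have Isub: "{i \<in> I. length (snd i) = j} \<subseteq> Sigma V (walks j)" for j
    by (auto simp: I_def walks_def)
  have finW: "finite (Sigma V (walks j))" for j using card_walks by (intro finite_SigmaI) auto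
  have fI: "finite I"
  proof (rule finite_subset)
    show "I \<subseteq> (\<Union>j\<in>{1..4}. {i \<in> I. length (snd i) = j})" using len by auto
    show "finite (\<Union>j\<in>{1..4}. {i \<in> I. length (snd i) = j})"
      using finite_subset[OF Isub finW] by blast
  qed
  have iD: "fst i \<in> V" "snd (last (snd i)) \<in> V" "fst i \<noteq> snd (last (snd i))" "F i \<subseteq> A" "card (F i) = length (snd i)"
    if iI: "i \<in> I" for i
  proof -
    obtain a ws b where i: "i = (a, ws)" "a \<in> V" "walk A a ws b" "b \<noteq> a" "ws \<noteq> []" "distinct (map fst ws)"
      using iI by (auto simp: I_def)
    have w: "b = snd (last ws)" "b \<in> verts (fst (last ws))" "fst ` set ws \<subseteq> A"
      using walk_last[OF i(3,5)] by auto
    then have "fst (last ws) \<in> A" using i(5) by auto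
    then have "b \<in> V" using copyD(2) w by blast
    then show "fst i \<in> V" "snd (last (snd i)) \<in> V" "fst i \<noteq> snd (last (snd i))" "F i \<subseteq> A"
      using i w by (simp_all add: F_def)
    show "card (F i) = length (snd i)"
      using distinct_card[OF i(6)] by (simp add: i(1) F_def)
  qed
  have "subset_prob A p {S. \<not> separated S}
     \<le> (\<Sum>i\<in>I. 4 ^ (28 * v) * (p ^ card (F i) * (1 - (1 - 1/4) * p) ^ card (B i)))"
  proof (rule prob_random_subset_union_bound)
    show "F i \<subseteq> A \<and> B i \<subseteq> A \<and> F i \<inter> B i = {} \<and> 0 \<le> (1/4::real) \<and> 0 \<le> (4 ^ (28 * v)::real)" if "i \<in> I" for i
      using iD(4)[OF that] by (auto simp: B_def)
    show "\<exists>i\<in>I. F i \<subseteq> S \<and> 1 \<le> 4 ^ (28 * v) * (1/4::real) ^ card (S \<inter> B i)" if S: "S \<subseteq> A" "\<not> separated S" for S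
    proof -
      obtain a b where ab: "a \<in> small S" "b \<in> small S" "near S 4 a b" "a \<noteq> b"
        using S(2) unfolding separated_def by blast
      obtain ws where ws: "walk S a ws b" "length ws \<le> 4" "distinct (map fst ws)"
        using near_distinct_walk[OF ab(3)] by blast
      have ne: "ws \<noteq> []" using ws(1) ab(4) by auto
      have "walk A a ws b" by (rule walk_mono[OF ws(1) S(1)])
      then have i: "(a, ws) \<in> I" using ab ws ne by (auto simp: I_def small_def)
      have wl: "b = snd (last ws)" "fst ` set ws \<subseteq> S" using walk_last[OF ws(1) ne] by auto
      have finS: "finite S" using S(1) by (rule finite_subset) simp
      have "S \<inter> B (a, ws) \<subseteq> copies_at S a \<union> copies_at S b"
        by (auto simp: B_def wl(1))
      then have "card (S \<inter> B (a, ws)) \<le> card (copies_at S a \<union> copies_at S b)"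
        using finS by (intro card_mono) auto
      also have "\<dots> \<le> card (copies_at S a) + card (copies_at S b)" by (rule card_Un_le)
      also have "\<dots> \<le> 28 * v" using ab by (simp add: small_def)
      finally have "(1/4::real) ^ (28 * v) \<le> (1/4) ^ card (S \<inter> B (a, ws))"
        by (intro power_decreasing) auto
      then have "4 ^ (28 * v) * (1/4::real) ^ (28 * v) \<le> 4 ^ (28 * v) * (1/4) ^ card (S \<inter> B (a, ws))"
        by (intro mult_left_mono) auto
      then have "1 \<le> 4 ^ (28 * v) * (1/4::real) ^ card (S \<inter> B (a, ws))"
        by (simp add: power_one_over)
      moreover have "F (a, ws) \<subseteq> S" using wl by (simp add: F_def)
      ultimately show ?thesis using i by blast
    qed
  qed (use p fI in auto)
  also have "\<dots> \<le> (\<Sum>i\<in>I. K * p ^ length (snd i))"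
  proof (rule sum_mono)
    fix i assume i: "i \<in> I"
    define X where "X = {C \<in> A. fst i \<in> verts C \<or> snd (last (snd i)) \<in> verts C}"
    have X: "card X + m2 = 2 * m1 H n" unfolding X_def by (rule card_copies_either[OF iD(1-3)[OF i]])
    have "finite (F i)" using iD(4)[OF i] by (rule finite_subset) simp
    then have "card X - card (F i) \<le> card (B i)"
      unfolding B_def X_def by (rule diff_card_le_card_Diff)
    then have "2 * m1 H n \<le> card (B i) + m2 + 4" using X iD(5)[OF i] len[OF i] unfolding atLeastAtMost_iff by linarith
    then have "real (2 * m1 H n) \<le> real (card (B i) + m2 + 4)" by (simp only: of_nat_le_iff)
    then have "p * (2 * real (m1 H n)) \<le> p * (real (card (B i)) + real m2 + 4)"
      using p(1) by (intro mult_left_mono) auto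
    then have "2 * M \<le> p * real (card (B i)) + p * real m2 + 4 * p" unfolding M(1) by (simp add: algebra_simps)
    moreover have "p * real m2 \<le> 1"
    proof -
      have "p * real m2 \<le> real v * M / real n" using pair_rate[OF p(1)] M(1) by simp
      also have "\<dots> \<le> 1" using M(3) n by (simp add: divide_le_eq)
      finally show ?thesis .
    qed
    \<comment> \<open>The loss is \<open>p * m2 \<le> 1\<close> for the copies containing both ends,
      and at most 4 for those on the walk. Below, \<open>3/4 * 5\<close> is rounded up to 4.\<close>
    ultimately have rate: "2 * M - 5 \<le> p * real (card (B i))" using p by linarith
    have "(1 - (1 - 1/4) * p) ^ card (B i) = (1 - 3/4 * p) ^ card (B i)" by simp
    also have "\<dots> \<le> exp (- (3/4 * p) * real (card (B i)))" by (rule one_minus_power_le_exp) (use p in simp)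
    also have "\<dots> \<le> exp (4 - 3/2 * M)" using rate by simp
    finally have "4 ^ (28 * v) * (p ^ card (F i) * (1 - (1 - 1/4) * p) ^ card (B i))
        \<le> 4 ^ (28 * v) * (p ^ card (F i) * exp (4 - 3/2 * M))"
      using p by (intro mult_left_mono) auto
    then show "4 ^ (28 * v) * (p ^ card (F i) * (1 - (1 - 1/4) * p) ^ card (B i)) \<le> K * p ^ length (snd i)"
      by (simp add: K_def iD(5)[OF i] mult_ac)
  qed
  also have "\<dots> = (\<Sum>j\<in>{1..4}. \<Sum>i\<in>{i \<in> I. length (snd i) = j}. K * p ^ length (snd i))"
    by (rule sum.group[symmetric]) (use fI len in auto)
  also have "\<dots> \<le> (\<Sum>j\<in>{1..4::nat}. real n * K * (real v * M) ^ 4)"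
  proof (rule sum_mono)
    fix j :: nat assume j: "j \<in> {1..4}"
    have "(\<Sum>i\<in>{i \<in> I. length (snd i) = j}. K * p ^ length (snd i)) = real (card {i \<in> I. length (snd i) = j}) * (K * p ^ j)"
      by simp
    also have "\<dots> \<le> (real n * (real v * real (m1 H n)) ^ j) * (K * p ^ j)"
    proof (rule mult_right_mono)
      have "card {i \<in> I. length (snd i) = j} \<le> card (Sigma V (walks j))" by (rule card_mono[OF finW Isub])
      also have "\<dots> = (\<Sum>a\<in>V. card (walks j a))" by (rule card_SigmaI) (use card_walks in auto)
      also have "\<dots> \<le> (\<Sum>a\<in>V. (v * m1 H n) ^ j)" by (rule sum_mono) (use card_walks in auto)
      also have "\<dots> = n * (v * m1 H n) ^ j" by simp
      finally have "real (card {i \<in> I. length (snd i) = j}) \<le> real (n * (v * m1 H n) ^ j)" by (simp only: of_nat_le_iff)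
      then show "real (card {i \<in> I. length (snd i) = j}) \<le> real n * (real v * real (m1 H n)) ^ j" by simp
    qed (use p in \<open>simp add: K_def\<close>)
    also have "\<dots> = real n * K * (real v * M) ^ j"
      unfolding M(1) by (simp add: power_mult_distrib mult_ac)
    also have "\<dots> \<le> real n * K * (real v * M) ^ 4"
    proof (rule mult_left_mono[OF power_increasing])
      have "1 * 1 \<le> real v * M" using v_ge_2 M(2) by (intro mult_mono) auto
      then show "1 \<le> real v * M" by simp
    qed (use j in \<open>auto simp: K_def\<close>)
    finally show "(\<Sum>i\<in>{i \<in> I. length (snd i) = j}. K * p ^ length (snd i)) \<le> real n * K * (real v * M) ^ 4" .
  qed
  also have "\<dots> = 4 * (real v * M) ^ 4 * (real n * K)" by simp
  also have "\<dots> \<le> 4 * (real v * M) ^ 4 * (4 ^ (28 * v) * exp 4 * exp (- M / 2))"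
  proof (rule mult_left_mono)
    have "exp (4 - 3 / 2 * M) = exp 4 * exp (- M / 2) * exp (- M)" by (simp flip: exp_add)
    then have "real n * K = 4 ^ (28 * v) * exp 4 * exp (- M / 2) * (real n * exp (- M))" by (simp add: K_def)
    also have "\<dots> \<le> 4 ^ (28 * v) * exp 4 * exp (- M / 2) * 1"
      using M(4) by (intro mult_left_mono) (auto simp: exp_minus field_simps)
    finally show "real n * K \<le> 4 ^ (28 * v) * exp 4 * exp (- M / 2)" by simp
  qed (use M(2) in simp)
  finally show ?thesis by (simp add: mult.assoc)
qed

section \<open>Vertices with fewer than two neighbours\<close>

lemma vdegree_le_nbh:
  assumes S: "S \<subseteq> A" "C \<in> S"
  shows "vdegree C u \<le> card (nbh (E S) {u})"
proof -
  have fin: "finite (nbh (E S) {u})" using nbh_subset[OF S(1)] by (rule finite_subset) simp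
  have "{e \<in> edges C. u \<in> e} \<subseteq> (\<lambda>y. {u, y}) ` nbh (E S) {u}"
  proof
    fix e assume e: "e \<in> {e \<in> edges C. u \<in> e}"
    then have "card e = 2" using copyD(5)[of C e] S by blast
    then obtain a b where ab: "e = {a, b}" "a \<noteq> b" "{b, a} = e" unfolding card_2_iff by blast
    have "\<exists>y. e = {u, y} \<and> y \<noteq> u"
    proof (cases "u = a")
      case True
      then show ?thesis using ab by (intro exI[of _ b]) simp
    next
      case False
      then have "u = b" using e ab by simp
      then show ?thesis using ab by (intro exI[of _ a]) simp
    qed
    then obtain y where y: "e = {u, y}" "y \<noteq> u" by blast
    have "{u, y} \<in> E S" using e y S by blast
    then have "y \<in> nbh (E S) {u}" using y by (simp add: nbh_def)
    then show "e \<in> (\<lambda>y. {u, y}) ` nbh (E S) {u}" using y by (intro image_eqI[of _ _ y])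
  qed
  then have "vdegree C u \<le> card ((\<lambda>y. {u, y}) ` nbh (E S) {u})"
    unfolding vdegree_def using fin by (intro card_mono) auto
  also have "\<dots> \<le> card (nbh (E S) {u})" by (rule card_image_le[OF fin])
  finally show ?thesis .
qed

text \<open>Together these are the possible reasons for a vertex \<open>u\<close> of degree below
  two. In the last one \<open>w\<close> is the only neighbour of \<open>u\<close>, and several
  copies overlap in both.\<close>

abbreviation "uncovered S \<equiv> \<exists>u\<in>V. copies_at S u = {}"
abbreviation "covered_once S \<equiv> \<exists>u\<in>V. \<exists>C. copies_at S u = {C}"
abbreviation "covered_twice_leaf S \<equiv> \<exists>u\<in>V. \<exists>w\<in>V. u \<noteq> w \<and>
  (\<exists>C\<in>S. \<exists>C'\<in>S. C \<noteq> C' \<and> u \<in> verts C \<and> u \<in> verts C') \<and> (\<forall>C\<in>S. u \<in> verts C \<longrightarrow> w \<in> verts C)"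

lemma prob_uncovered:
  assumes p: "0 \<le> p" "p \<le> 1" and M: "M = real (m1 H n) * p"
  shows "subset_prob A p {S. uncovered S} \<le> real n * exp (- M)"
proof -
  have "subset_prob A p {S. uncovered S}
     \<le> (\<Sum>u\<in>V. 1 * (1 - (1 - 0) * p) ^ card (copies_at A u))"
  proof (rule prob_random_subset_union_bound')
    fix S assume "S \<subseteq> A" "uncovered S"
    then obtain u where "u \<in> V" "S \<inter> copies_at A u = {}" by blast
    then show "\<exists>u\<in>V. 1 \<le> 1 * (0::real) ^ card (S \<inter> copies_at A u)"
      by (intro bexI[of _ u]) simp_all
  qed (use p in auto)
  also have "\<dots> = real n * (1 - p) ^ m1 H n" by (simp add: card_copies_at)
  also have "\<dots> \<le> real n * exp (- M)"
    using one_minus_power_le_exp[OF p(2), of "m1 H n"] M by (intro mult_left_mono) (simp_all add: mult.commute)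
  finally show ?thesis .
qed

lemma prob_covered_once:
  assumes p: "0 \<le> p" "p \<le> 1" and M: "M = real (m1 H n) * p"
  shows "subset_prob A p {S. covered_once S}
    \<le> exp 1 * (real n * M * exp (- M))"
proof -
  define I where "I = Sigma V (\<lambda>u. copies_at A u)"
  define B where "B = (\<lambda>i. {C \<in> A. fst i \<in> verts C} - {snd i})"
  have fI: "finite I" unfolding I_def by (intro finite_SigmaI) auto
  have cI: "card I = n * m1 H n"
    unfolding I_def by (subst card_SigmaI) (auto simp: card_copies_at)
  have cB: "card (B i) = m1 H n - 1" if "i \<in> I" for i
    using that by (auto simp: B_def I_def card_copies_at card_Diff_singleton)
  have "subset_prob A p {S. covered_once S}
     \<le> (\<Sum>i\<in>I. 1 * (p ^ card {snd i} * (1 - (1 - 0) * p) ^ card (B i)))"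
  proof (rule prob_random_subset_union_bound)
    fix S assume S: "S \<subseteq> A" "covered_once S"
    then obtain u C where u: "u \<in> V" "copies_at S u = {C}" by blast
    then have C: "C \<in> S" "u \<in> verts C" by blast+
    have "(u, C) \<in> I" using u C S by (auto simp: I_def)
    moreover have "S \<inter> B (u, C) = {}" using u S by (auto simp: B_def)
    ultimately show "\<exists>i\<in>I. {snd i} \<subseteq> S \<and> 1 \<le> 1 * (0::real) ^ card (S \<inter> B i)"
      using C by (intro bexI[of _ "(u, C)"]) simp_all
  next
    show "{snd i} \<subseteq> A \<and> B i \<subseteq> A \<and> {snd i} \<inter> B i = {} \<and> 0 \<le> (0::real) \<and> 0 \<le> (1::real)" if "i \<in> I" for i
      using that by (auto simp: I_def B_def)
  qed (use p fI in auto)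
  also have "\<dots> = real n * (real (m1 H n) * p) * (1 - p) ^ (m1 H n - 1)" by (simp add: cB cI)
  also have "\<dots> \<le> real n * (real (m1 H n) * p) * exp (1 - M)"
  proof (rule mult_left_mono)
    have "(1 - p) ^ (m1 H n - 1) \<le> exp (- p * real (m1 H n - 1))" by (rule one_minus_power_le_exp[OF p(2)])
    also have "real (m1 H n - 1) = real (m1 H n) - 1" using m1_pos by (simp add: of_nat_diff)
    also have "exp (- p * (real (m1 H n) - 1)) \<le> exp (1 - M)" using p M by (simp add: algebra_simps)
    finally show "(1 - p) ^ (m1 H n - 1) \<le> exp (1 - M)" .
  qed (use p in simp)
  also have "\<dots> = exp 1 * (real n * M * exp (- M))" by (simp add: M exp_diff exp_minus field_simps)
  finally show ?thesis .
qed

text \<open>The pairs \<open>(u, w)\<close> give a factor \<open>n ^ 2\<close>, but each of the two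
  copies containing both vertices costs \<open>p * m2\<close>, at most \<open>v * M / n\<close>. So
  no power of \<open>n\<close> survives, and the bound vanishes as soon as \<open>M\<close> tends to
  infinity.\<close>

lemma prob_covered_twice_leaf:
  assumes p: "0 \<le> p" "p \<le> 1" and M: "M = real (m1 H n) * p" "real v * M \<le> real n"
  shows "subset_prob A p {S. covered_twice_leaf S} \<le> exp 1 * ((real v * M)\<^sup>2 * exp (- M))"
    (is "measure_pmf.prob _ {S. ?Q S} \<le> _")
proof -
  define P where "P = (\<lambda>u w. {C \<in> A. u \<in> verts C \<and> w \<in> verts C})"
  define J where "J = {(u, w). u \<in> V \<and> w \<in> V \<and> u \<noteq> w}"
  define I where "I = Sigma J (\<lambda>(u, w). {(C, C'). C \<in> P u w \<and> C' \<in> P u w \<and> C \<noteq> C'})"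
  define F where "F = (\<lambda>i :: (nat \<times> nat) \<times> (nat graph \<times> nat graph). {fst (snd i), snd (snd i)})"
  define B where "B = (\<lambda>i :: (nat \<times> nat) \<times> (nat graph \<times> nat graph).
      {C \<in> A. fst (fst i) \<in> verts C} - P (fst (fst i)) (snd (fst i)))"
  have cP: "finite (P u w)" "u \<in> V \<Longrightarrow> w \<in> V \<Longrightarrow> u \<noteq> w \<Longrightarrow> card (P u w) = m2" for u w
    unfolding P_def using card_copies_pair by auto
  have Isub: "I \<subseteq> Sigma J (\<lambda>(u, w). P u w \<times> P u w)" by (auto simp: I_def)
  have Jsub: "J \<subseteq> V \<times> V" by (auto simp: J_def)
  have fJ: "finite J" using Jsub by (rule finite_subset) simp
  have fS: "finite (Sigma J (\<lambda>(u, w). P u w \<times> P u w))" using fJ cP by (intro finite_SigmaI) auto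
  have fI: "finite I" using Isub fS by (rule finite_subset)
  have cI: "card I \<le> n * n * (m2 * m2)"
  proof -
    have "card I \<le> card (Sigma J (\<lambda>(u, w). P u w \<times> P u w))" by (rule card_mono[OF fS Isub])
    also have "\<dots> = (\<Sum>j\<in>J. card (case j of (u, w) \<Rightarrow> P u w \<times> P u w))"
      by (rule card_SigmaI) (use fJ cP in auto)
    also have "\<dots> = (\<Sum>j\<in>J. m2 * m2)"
      by (rule sum.cong) (use cP in \<open>auto simp: J_def card_cartesian_product\<close>)
    also have "\<dots> = card J * (m2 * m2)" by simp
    also have "card J \<le> n * n" using card_mono[OF _ Jsub] by (simp add: card_cartesian_product)
    finally show ?thesis by simp
  qed
  have cB: "card (B i) = m1 H n - m2" if iI: "i \<in> I" for i
  proof -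
    obtain u w where i: "fst i = (u, w)" "u \<in> V" "w \<in> V" "u \<noteq> w"
      using iI by (auto simp: I_def J_def)
    have "P u w \<subseteq> copies_at A u" by (auto simp: P_def)
    then show ?thesis using cP[of u w] i by (simp add: B_def card_Diff_subset card_copies_at)
  qed
  have "subset_prob A p {S. ?Q S}
     \<le> (\<Sum>i\<in>I. 1 * (p ^ card (F i) * (1 - (1 - 0) * p) ^ card (B i)))"
  proof (rule prob_random_subset_union_bound)
    fix S assume S: "S \<subseteq> A" "?Q S"
    then obtain u w C C' where u: "u \<in> V" "w \<in> V" "u \<noteq> w" "C \<in> S" "C' \<in> S" "C \<noteq> C'" "u \<in> verts C" "u \<in> verts C'"
      and all: "\<forall>C\<in>S. u \<in> verts C \<longrightarrow> w \<in> verts C" by blast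
    have "w \<in> verts C" "w \<in> verts C'" using all u by blast+
    then have "((u, w), (C, C')) \<in> I" using u S(1) by (auto simp: I_def J_def P_def)
    moreover have "S \<inter> B ((u, w), (C, C')) = {}" using all by (auto simp: B_def P_def)
    moreover have "F ((u, w), (C, C')) \<subseteq> S" using u by (simp add: F_def)
    ultimately show "\<exists>i\<in>I. F i \<subseteq> S \<and> 1 \<le> 1 * (0::real) ^ card (S \<inter> B i)"
      by (intro bexI[of _ "((u, w), (C, C'))"]) simp_all
  next
    show "F i \<subseteq> A \<and> B i \<subseteq> A \<and> F i \<inter> B i = {} \<and> 0 \<le> (0::real) \<and> 0 \<le> (1::real)" if "i \<in> I" for i
      using that by (auto simp: I_def F_def B_def P_def)
  qed (use p fI in auto)
  also have "\<dots> = (\<Sum>i\<in>I. p ^ 2 * (1 - p) ^ (m1 H n - m2))"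
  proof (rule sum.cong)
    fix i assume i: "i \<in> I"
    then have "card (F i) = 2" by (auto simp: I_def F_def card_insert_if)
    then show "1 * (p ^ card (F i) * (1 - (1 - 0) * p) ^ card (B i)) = p ^ 2 * (1 - p) ^ (m1 H n - m2)"
      using cB[OF i] by simp
  qed simp
  also have "\<dots> = real (card I) * (p ^ 2 * (1 - p) ^ (m1 H n - m2))" by simp
  also have "\<dots> \<le> real (n * n * (m2 * m2)) * (p ^ 2 * (1 - p) ^ (m1 H n - m2))"
    using cI p by (intro mult_right_mono) (simp_all only: of_nat_le_iff, simp)
  also have "\<dots> = (real n * (p * real m2))\<^sup>2 * (1 - p) ^ (m1 H n - m2)" by (simp add: power2_eq_square mult_ac)
  also have "\<dots> \<le> (real v * M)\<^sup>2 * exp (1 - M)"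
  proof (rule mult_mono)
    have rate: "p * real m2 \<le> real v * M / real n" using pair_rate[OF p(1)] M(1) by simp
    then have "real n * (p * real m2) \<le> real v * M" using n by (simp add: le_divide_eq mult_ac)
    then show "(real n * (p * real m2))\<^sup>2 \<le> (real v * M)\<^sup>2" using p by (intro power_mono) auto
    have "real v * M / real n \<le> 1" using M(2) n by (simp add: divide_le_eq)
    then have m2p: "p * real m2 \<le> 1" using rate by simp
    have "(1 - p) ^ (m1 H n - m2) \<le> exp (- p * real (m1 H n - m2))" by (rule one_minus_power_le_exp[OF p(2)])
    also have "\<dots> \<le> exp (- p * (real (m1 H n) - real m2))"
      using p by (simp add: mult_left_mono)
    also have "\<dots> \<le> exp (1 - M)" using m2p M(1) by (simp add: algebra_simps)
    finally show "(1 - p) ^ (m1 H n - m2) \<le> exp (1 - M)" .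
  qed (use p in simp_all)
  also have "\<dots> = exp 1 * ((real v * M)\<^sup>2 * exp (- M))" by (simp add: exp_diff exp_minus field_simps)
  finally show ?thesis .
qed

text \<open>Every copy at \<open>u\<close> has an edge at \<open>u\<close>. If \<open>u\<close> has
  only one neighbour \<open>w\<close>, this edge leads to \<open>w\<close>, so all chosen copies at
  \<open>u\<close> contain \<open>w\<close>.\<close>

lemma not_degree_ge_2_cases:
  assumes S: "S \<subseteq> A" "\<not> degree_ge_2 S"
  shows "uncovered S \<or> covered_once S \<or> covered_twice_leaf S"
proof (rule ccontr)
  assume "\<not> ?thesis"
  then have no: "\<not> uncovered S" "\<not> covered_once S"
    "\<not> covered_twice_leaf S"
    by (simp_all only: de_Morgan_disj not_False_eq_True)
  obtain u where u: "u \<in> V" "card (nbh (E S) {u}) < 2"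
    using S(2) unfolding degree_ge_2_def not_le[symmetric] by blast
  have fin: "finite (nbh (E S) {u})" using nbh_subset[OF S(1)] by (rule finite_subset) simp
  have ex: "\<exists>y. y \<in> verts C \<and> y \<noteq> u \<and> y \<in> nbh (E S) {u}" if C: "C \<in> S" "u \<in> verts C" for C
  proof -
    obtain y where y: "y \<in> verts C" "y \<noteq> u" "{u, y} \<in> edges C"
      using copy_edge_at[of C u] C S(1) by blast
    then have "{u, y} \<in> E S" using C by blast
    then show ?thesis using y by (auto simp: nbh_def)
  qed
  have "copies_at S u \<noteq> {}" using no(1) bexI[OF _ u(1)] by (rule contrapos_nn)
  then obtain C where C: "C \<in> S" "u \<in> verts C" by blast
  have "copies_at S u \<noteq> {C}" using no(2) bexI[OF exI u(1)] by (rule contrapos_nn)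
  then obtain C' where C': "C' \<in> S" "u \<in> verts C'" "C \<noteq> C'" using C by blast
  obtain w where w: "w \<in> verts C" "w \<noteq> u" "w \<in> nbh (E S) {u}" using ex[OF C] by blast
  have only: "y = w" if "y \<in> nbh (E S) {u}" for y
  proof -
    have "card (nbh (E S) {u}) \<le> Suc 0" using u(2) by simp
    then show ?thesis using card_le_Suc0_iff_eq[OF fin] that w(3) by blast
  qed
  have all: "\<forall>C\<in>S. u \<in> verts C \<longrightarrow> w \<in> verts C"
  proof (intro ballI impI)
    fix C'' assume "C'' \<in> S" "u \<in> verts C''"
    then obtain y where "y \<in> verts C''" "y \<in> nbh (E S) {u}" using ex by blast
    then show "w \<in> verts C''" using only by simp
  qed
  have wV: "w \<in> V" using w(1) C(1) S(1) copyD(2) by blast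
  have two: "\<exists>C\<in>S. \<exists>C'\<in>S. C \<noteq> C' \<and> u \<in> verts C \<and> u \<in> verts C'"
    using C C' by (intro bexI[of _ C] bexI[of _ C'] conjI)
  show False
    by (rule notE[OF no(3)], rule bexI[OF _ u(1)], rule bexI[OF _ wV])
       (intro conjI w(2)[symmetric] two all)
qed

text \<open>With minimum degree at least two, a single copy at \<open>u\<close> already supplies two
  neighbours. Otherwise being covered once is the dominant obstruction; the factor 4 adds the
  uncovered vertices, by \<open>1 \<le> M\<close>, to the bound 3 for \<open>exp 1\<close>.\<close>

lemma prob_not_degree_ge_2:
  assumes p: "0 \<le> p" "p \<le> 1" and M: "M = real (m1 H n) * p" "1 \<le> M" "real v * M \<le> real n"
  shows "subset_prob A p {S. \<not> degree_ge_2 S}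
    \<le> (if 2 \<le> min_degree H then real n * exp (- M) else 4 * (real n * M * exp (- M)) + 3 * ((real v * M)\<^sup>2 * exp (- M)))"
proof (cases "2 \<le> min_degree H")
  case True
  have "subset_prob A p {S. \<not> degree_ge_2 S}
    \<le> subset_prob A p {S. uncovered S}"
  proof (rule prob_random_subset_mono_event)
    fix S assume S: "S \<subseteq> A" "\<not> degree_ge_2 S"
    obtain u where u: "u \<in> V" "card (nbh (E S) {u}) < 2"
      using S(2) unfolding degree_ge_2_def not_le[symmetric] by blast
    have False if C: "C \<in> S" "u \<in> verts C" for C
    proof -
      have "min_degree H \<le> vdegree C u" using copy_vdegree(1) C S(1) by blast
      then show False using vdegree_le_nbh[OF S(1) C(1), of u] u True by simp
    qed
    then show "uncovered S" using u(1) by blast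
  qed
  also have "\<dots> \<le> real n * exp (- M)" by (rule prob_uncovered[OF p M(1)])
  finally show ?thesis using True by simp
next
  case False
  have e3: "exp (1::real) \<le> 3" using exp_le by simp
  have "subset_prob A p {S. \<not> degree_ge_2 S}
    \<le> subset_prob A p {S. uncovered S} +
      subset_prob A p {S. covered_once S \<or> covered_twice_leaf S}"
    by (rule prob_random_subset_disj) (rule not_degree_ge_2_cases)
  also have "\<dots> \<le> real n * exp (- M) + (exp 1 * (real n * M * exp (- M)) + exp 1 * ((real v * M)\<^sup>2 * exp (- M)))"
  proof (rule add_mono[OF prob_uncovered[OF p M(1)]])
    show "subset_prob A p {S. covered_once S \<or> covered_twice_leaf S}
      \<le> exp 1 * (real n * M * exp (- M)) + exp 1 * ((real v * M)\<^sup>2 * exp (- M))"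
      using add_mono[OF prob_covered_once[OF p M(1)] prob_covered_twice_leaf[OF p M(1,3)]]
      by (rule order_trans[OF prob_random_subset_disj, rotated]) assumption
  qed
  also have "\<dots> \<le> real n * M * exp (- M) + (3 * (real n * M * exp (- M)) + 3 * ((real v * M)\<^sup>2 * exp (- M)))"
    using M(2) e3 mult_left_mono[OF M(2), of "real n"] by (intro add_mono mult_right_mono) auto
  finally show ?thesis using False by (simp add: mult_ac)
qed

lemma prob_not_expander:
  assumes p: "0 \<le> p" "p \<le> 1" and M: "M = real (m1 H n) * p" "1 \<le> M" "real v * M \<le> real n" "real n \<le> exp M"
    and small: "exp (real v + 1) / M \<le> 1 / 2" "343 * exp 2 * M ^ 9 * exp (- M / (2 * real v)) \<le> 1 / 2"
  shows "subset_prob A p {S. \<not> expander V (E S)}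
    \<le> failure_bound v M + (if 2 \<le> min_degree H then real n * exp (- M) else 4 * (real n * M * exp (- M)))"
proof -
  let ?P = "\<lambda>Q. subset_prob A p {S. Q S}"
  have "?P (\<lambda>S. \<not> expander V (E S)) \<le> ?P (\<lambda>S. \<not> sparse M S \<or> (\<not> spread M S \<or> (\<not> separated S \<or> \<not> degree_ge_2 S)))"
  proof (rule prob_random_subset_mono_event)
    fix S assume S: "S \<subseteq> A" "\<not> expander V (E S)"
    have "0 \<le> M" using M(2) by simp
    from expanderI[OF S(1) this] S(2)
    show "\<not> sparse M S \<or> (\<not> spread M S \<or> (\<not> separated S \<or> \<not> degree_ge_2 S))" by blast
  qed
  also have "\<dots> \<le> ?P (\<lambda>S. \<not> sparse M S) + ?P (\<lambda>S. \<not> spread M S \<or> (\<not> separated S \<or> \<not> degree_ge_2 S))"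
    by (rule prob_random_subset_disj)
  also have "?P (\<lambda>S. \<not> spread M S \<or> (\<not> separated S \<or> \<not> degree_ge_2 S))
    \<le> ?P (\<lambda>S. \<not> spread M S) + ?P (\<lambda>S. \<not> separated S \<or> \<not> degree_ge_2 S)"
    by (rule prob_random_subset_disj)
  also have "?P (\<lambda>S. \<not> separated S \<or> \<not> degree_ge_2 S) \<le> ?P (\<lambda>S. \<not> separated S) + ?P (\<lambda>S. \<not> degree_ge_2 S)"
    by (rule prob_random_subset_disj)
  finally have le: "?P (\<lambda>S. \<not> expander V (E S))
    \<le> ?P (\<lambda>S. \<not> sparse M S) + (?P (\<lambda>S. \<not> spread M S) + (?P (\<lambda>S. \<not> separated S) + ?P (\<lambda>S. \<not> degree_ge_2 S)))"
    by simp
  have nonneg: "0 \<le> 3 * ((real v * M)\<^sup>2 * exp (- M))" by simp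
  have "?P (\<lambda>S. \<not> degree_ge_2 S) \<le> 3 * ((real v * M)\<^sup>2 * exp (- M)) +
      (if 2 \<le> min_degree H then real n * exp (- M) else 4 * (real n * M * exp (- M)))"
  proof (cases "2 \<le> min_degree H")
    case True
    then have "?P (\<lambda>S. \<not> degree_ge_2 S) \<le> real n * exp (- M)" using prob_not_degree_ge_2[OF p M(1-3)] by simp
    from add_mono[OF nonneg this] True show ?thesis by simp
  qed (use prob_not_degree_ge_2[OF p M(1-3)] in simp)
  then show ?thesis
    using le prob_not_sparse[OF p M(1,2) small(1)] prob_not_spread[OF p M(1,2) small(2)]
      prob_not_separated[OF p M]
    unfolding failure_bound_def by linarith
qed

end

section \<open>Sprinkling\<close>

lemma hamiltonian_mono: "hamiltonian (V, E) \<Longrightarrow> E \<subseteq> E' \<Longrightarrow> hamiltonian (V, E')"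
  unfolding hamiltonian_def fst_conv snd_conv by blast

lemma path_order_mono:
  assumes "finite_graph V E" "finite_graph V E'" "E \<subseteq> E'"
  shows "path_order V E \<le> path_order V E'"
proof -
  obtain P where P: "gpath V E P" "length P = path_order V E"
    using finite_graph.longest_path[OF assms(1)] .
  have "successively (\<lambda>x y. {x, y} \<in> E) P" using P(1) by (simp add: gpath_def)
  then have "successively (\<lambda>x y. {x, y} \<in> E') P"
    by (rule successively_mono) (rule subsetD[OF assms(3)])
  then have "gpath V E' P" using P(1) unfolding gpath_def by blast
  then show ?thesis using finite_graph.gpath_length_le[OF assms(2)] P(2) by metis
qed

lemma expander_mono:
  assumes X: "expander V E" and sub: "E \<subseteq> E'" and fin: "\<And>X. finite (nbh E' X)"
  shows "expander V E'"
  unfolding expander_def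
proof (intro allI impI)
  fix X assume "X \<subseteq> V \<and> X \<noteq> {} \<and> 4 * card X \<le> card V"
  then have "2 * card X \<le> card (nbh E X)" using X unfolding expander_def by blast
  also have "\<dots> \<le> card (nbh E' X)" using sub by (intro card_mono[OF fin]) (auto simp: nbh_def)
  finally show "2 * card X \<le> card (nbh E' X)" .
qed

context copies_host
begin

lemma finite_graph_E: "S \<subseteq> A \<Longrightarrow> finite_graph V (E S)"
  using n E_subset by (intro finite_graph.intro) auto

text \<open>A family of added copies is grown as long as every copy lengthens the longest path; when it
  is maximal, no further copy of \<open>T\<close> contains a booster.\<close>
lemma ex_maximal_boosting:
  assumes S: "S \<subseteq> A" "T \<subseteq> A" and nonham: "\<not> hamiltonian (V, E (S \<union> T))"
  shows "\<exists>T'\<subseteq>T. card T' \<le> n \<and> (\<forall>C\<in>T. edges C \<inter> boosters V (E (S \<union> T')) = {})"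
proof -
  define good where "good = (\<lambda>T'. T' \<subseteq> T \<and> card T' \<le> path_order V (E (S \<union> T')))"
  have finT: "finite T" using S(2) by (rule finite_subset) simp
  have fg: "finite_graph V (E (S \<union> T'))" if "T' \<subseteq> T" for T'
    by (rule finite_graph_E) (use that S in blast)
  have bound: "card T' < Suc n" if "good T'" for T'
    using finite_graph.path_order_le[OF fg, of T'] that by (simp add: good_def)
  have "good {}" by (simp add: good_def)
  then obtain T' where T': "good T'" and max: "\<And>T''. good T'' \<Longrightarrow> card T'' \<le> card T'"
    using ex_has_greatest_nat[of good "{}" card "Suc n"] bound by (metis less_imp_le)
  have T'T: "T' \<subseteq> T" "card T' \<le> path_order V (E (S \<union> T'))" using T' by (simp_all add: good_def)
  have fin: "finite T'" using T'T(1) finT by (rule finite_subset)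
  have "edges C \<inter> boosters V (E (S \<union> T')) = {}" if C: "C \<in> T" for C
  proof (rule ccontr)
    assume "edges C \<inter> boosters V (E (S \<union> T')) \<noteq> {}"
    then obtain e where e: "e \<in> edges C" "e \<in> boosters V (E (S \<union> T'))" by blast
    define G where "G = E (S \<union> T')"
    have sub: "insert e G \<subseteq> E (S \<union> insert C T')" using e by (auto simp: G_def)
    have subT: "E (S \<union> insert C T') \<subseteq> E (S \<union> T)" using C T'T by blast
    have "\<not> hamiltonian (V, insert e G)"
      using nonham hamiltonian_mono[OF _ subset_trans[OF sub subT]] by blast
    then have longer: "path_order V G < path_order V (insert e G)" using e(2) by (simp add: boosters_def G_def)
    have C': "insert C T' \<subseteq> T" using C T'T by blast
    have "finite_graph V (insert e G)"
    proof (rule finite_graph.intro)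
      show "d \<subseteq> V" if "d \<in> insert e G" for d
        using that sub finite_graph.edgesV[OF fg[OF C']] by blast
    qed (use n in auto)
    then have "path_order V (insert e G) \<le> path_order V (E (S \<union> insert C T'))"
      using path_order_mono[OF _ fg[OF C'] sub] by blast
    moreover have "Suc (card T') \<le> path_order V (insert e G)"
      using longer T'T(2) unfolding G_def by linarith
    moreover have "card (insert C T') \<le> Suc (card T')" by (rule card_insert_le_m1) simp_all
    ultimately have "card (insert C T') \<le> path_order V (E (S \<union> insert C T'))" by linarith
    then have "good (insert C T')" using C' unfolding good_def by blast
    then have "card (insert C T') \<le> card T'" by (rule max)
    then have "C \<in> T'" using fin by (auto simp: card_insert_if split: if_splits)
    then have "insert e G = G" using e by (auto simp: G_def)
    then show False using longer by simp
  qed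
  moreover have "card T' \<le> n" using bound[OF T'] by simp
  ultimately show ?thesis using T'T(1) by blast
qed

text \<open>By \<open>ex_maximal_boosting\<close>, failure yields a family \<open>T'\<close> that is
  chosen entirely while no copy with a booster of \<open>S \<union> T'\<close> is. Expansion
  survives adding copies, so there are at least \<open>n ^ 2 / 32\<close> boosters, and with
  \<open>M = m1 H n * r\<close> the expected number of chosen copies containing one is at least
  \<open>n * M / (16 * v)\<close>.\<close>

lemma prob_sprinkle:
  assumes S: "S \<subseteq> A" "expander V (E S)" and r: "0 \<le> r" "r \<le> 1"
  shows "subset_prob A r {T. \<not> hamiltonian (V, E (S \<union> T))}
    \<le> (32 * exp (- (real (m1 H n) * r) / (32 * real v))) ^ n"
proof -
  define M where "M = real (m1 H n) * r"
  have M0: "0 \<le> M" using r by (simp add: M_def)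
  define I where "I = {T'. T' \<subseteq> A \<and> card T' \<le> n \<and> \<not> hamiltonian (V, E (S \<union> T'))}"
  define B where "B = (\<lambda>T'. {C \<in> A. edges C \<inter> boosters V (E (S \<union> T')) \<noteq> {}})"
  have fI: "finite I" by (rule finite_subset[of _ "Pow A"]) (auto simp: I_def)
  have "subset_prob A r {T. \<not> hamiltonian (V, E (S \<union> T))}
     \<le> (\<Sum>T'\<in>I. 1 * (r ^ card T' * (1 - (1 - 0) * r) ^ card (B T')))"
  proof (rule prob_random_subset_union_bound)
    show "T' \<subseteq> A \<and> B T' \<subseteq> A \<and> T' \<inter> B T' = {} \<and> 0 \<le> (0::real) \<and> 0 \<le> (1::real)" if T': "T' \<in> I" for T'
    proof -
      \<comment> \<open>A pair that is already an edge would be a booster only of a Hamiltonian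
        graph.\<close>
      have "edges C \<inter> boosters V (E (S \<union> T')) = {}" if C: "C \<in> T'" for C
      proof (rule ccontr)
        assume "edges C \<inter> boosters V (E (S \<union> T')) \<noteq> {}"
        then obtain e where e: "e \<in> edges C" "e \<in> boosters V (E (S \<union> T'))" by blast
        have "insert e (E (S \<union> T')) = E (S \<union> T')" using e(1) C by blast
        then show False using e(2) T' by (simp add: boosters_def I_def)
      qed
      then have "T' \<inter> B T' = {}" unfolding B_def by blast
      then show ?thesis using T' by (auto simp: I_def B_def)
    qed
    show "\<exists>T'\<in>I. T' \<subseteq> T \<and> 1 \<le> 1 * (0::real) ^ card (T \<inter> B T')" if T: "T \<subseteq> A" "\<not> hamiltonian (V, E (S \<union> T))" for T
    proof -
      obtain T' where T': "T' \<subseteq> T" "card T' \<le> n" "\<forall>C\<in>T. edges C \<inter> boosters V (E (S \<union> T')) = {}"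
        using ex_maximal_boosting[OF S(1) T] by blast
      have "E (S \<union> T') \<subseteq> E (S \<union> T)" using T'(1) by blast
      then have "\<not> hamiltonian (V, E (S \<union> T'))" using T(2) hamiltonian_mono by blast
      then have i: "T' \<in> I" using T' T(1) by (auto simp: I_def)
      have "T \<inter> B T' = {}" using T'(3) unfolding B_def by blast
      then show ?thesis using i T'(1) by (intro bexI[of _ T']) simp_all
    qed
  qed (use r fI in auto)
  also have "\<dots> \<le> (\<Sum>T'\<in>I. r ^ card T' * exp (- (real n * M / (16 * real v))))"
  proof (rule sum_mono)
    fix T' assume T': "T' \<in> I"
    define P where "P = boosters V (E (S \<union> T'))"
    have sub: "S \<union> T' \<subseteq> A" using S(1) T' by (auto simp: I_def)
    have "finite (nbh (E (S \<union> T')) X)" for X using nbh_subset[OF sub] by (rule finite_subset) simp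
    then have "expander V (E (S \<union> T'))" by (intro expander_mono[OF S(2)]) auto
    then have "(card V)\<^sup>2 \<le> 32 * card P"
      unfolding P_def by (rule finite_graph.card_boosters[OF finite_graph_E[OF sub]]) (use n in simp)
    then have "real (n\<^sup>2) \<le> real (32 * card P)" by (simp only: of_nat_le_iff card_atLeastAtMost) simp
    then have nP: "real n * real n / 32 \<le> real (card P)" by (simp add: power2_eq_square)
    have "real n * M / (16 * real v) = 2 * M * (real n * real n / 32) / (real v * real n)"
      using n v_ge_2 by (simp add: field_simps)
    also have "\<dots> \<le> 2 * M * real (card P) / (real v * real n)"
      using nP M0 by (intro divide_right_mono mult_left_mono) auto
    also have "\<dots> \<le> r * real (card (B T'))"
      unfolding B_def M_def P_def[symmetric]
      by (rule copies_meeting_rate[OF _ r(1)]) (auto simp: P_def boosters_def)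
    finally have rate: "real n * M / (16 * real v) \<le> r * real (card (B T'))" .
    have "(1 - r) ^ card (B T') \<le> exp (- r * real (card (B T')))" by (rule one_minus_power_le_exp[OF r(2)])
    also have "\<dots> \<le> exp (- (real n * M / (16 * real v)))" using rate by simp
    finally show "1 * (r ^ card T' * (1 - (1 - 0) * r) ^ card (B T')) \<le> r ^ card T' * exp (- (real n * M / (16 * real v)))"
      using r by (simp add: mult_left_mono)
  qed
  also have "\<dots> \<le> (\<Sum>T'\<in>{T'. T' \<subseteq> A \<and> card T' \<le> n}. r ^ card T' * exp (- (real n * M / (16 * real v))))"
    using r by (intro sum_mono2) (auto simp: I_def)
  also have "\<dots> = (\<Sum>T'\<in>{T'. T' \<subseteq> A \<and> card T' \<le> n}. r ^ card T') * exp (- (real n * M / (16 * real v)))"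
    by (simp add: sum_distrib_right)
  \<comment> \<open>The weighted count with \<open>t = 32\<close>: since
    \<open>r * N = n * M / v\<close>, the factor \<open>exp (r * N / 32)\<close> consumes just half
    of the exponent \<open>n * M / (16 * v)\<close>, at the price of \<open>32 ^ n\<close>.\<close>
  also have "\<dots> \<le> (32 ^ n * exp (r * real N / 32)) * exp (- (real n * M / (16 * real v)))"
    by (intro mult_right_mono sum_bounded_subsets_le) (use r in auto)
  also have "r * real N = real n * M / real v"
  proof -
    have "real n * real (m1 H n) = real v * real N" unfolding of_nat_mult[symmetric] m1_eq ..
    then have "real v * (r * real N) = real n * M" by (simp add: M_def mult_ac)
    then show ?thesis using v_ge_2 by (simp add: field_simps)
  qed
  also have "(32 ^ n * exp (real n * M / real v / 32)) * exp (- (real n * M / (16 * real v)))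
     = 32 ^ n * exp (real n * (- M / (32 * real v)))"
  proof -
    have "real n * M / real v / 32 + - (real n * M / (16 * real v)) = real n * (- M / (32 * real v))"
      using v_ge_2 by (simp add: field_simps)
    then show ?thesis by (simp only: mult.assoc exp_add[symmetric])
  qed
  also have "\<dots> = (32 * exp (- M / (32 * real v))) ^ n"
    by (simp only: exp_of_nat_mult power_mult_distrib)
  finally show ?thesis by (simp add: M_def)
qed

section \<open>From sets of copies back to the random graph\<close>

lemma prob_random_graph_hamiltonian:
  "hamiltonian_prob H n p = subset_prob A p {S. hamiltonian (V, E S)}"
  unfolding random_graph_def random_subset_def by (simp add: union_graph_def vimage_def)

lemma prob_hamiltonian_mono:
  assumes "0 \<le> p" "p \<le> p'" "p' \<le> 1"
  shows "hamiltonian_prob H n p \<le> measure_pmf.prob (random_graph H n p') {G. hamiltonian G}"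
  unfolding prob_random_graph_hamiltonian
proof (rule prob_random_subset_mono[OF finite_A assms])
  fix S T assume "hamiltonian (V, E S)" "S \<subseteq> T"
  then show "hamiltonian (V, E T)" by (elim hamiltonian_mono) blast
qed

text \<open>Both rounds together have parameter \<open>p + r - p * r\<close>, which is at most
  \<open>p'\<close>; monotonicity makes up the difference.\<close>

lemma prob_hamiltonian_ge:
  assumes p: "0 \<le> p" "0 \<le> r" "p + r \<le> p'" "p' \<le> 1"
  shows "1 - measure_pmf.prob (random_graph H n p') {G. hamiltonian G}
    \<le> subset_prob A p {S. \<not> expander V (E S)} + (32 * exp (- (real (m1 H n) * r) / (32 * real v))) ^ n"
proof -
  have pr: "0 \<le> p * r" "p \<le> 1" "r \<le> 1" using p by auto
  have "p * r \<le> p" using p(1) pr(3) by (rule mult_left_le[rotated])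
  then have s: "0 \<le> p + r - p * r" "p + r - p * r \<le> p'" using p pr by linarith+
  have "hamiltonian_prob H n (p + r - p * r) \<le> measure_pmf.prob (random_graph H n p') {G. hamiltonian G}"
    by (rule prob_hamiltonian_mono[OF s p(4)])
  moreover have "1 - hamiltonian_prob H n (p + r - p * r)
    = subset_prob A (p + r - p * r) {S. \<not> hamiltonian (V, E S)}"
    unfolding prob_random_graph_hamiltonian
    using measure_pmf.prob_compl[of "{S. hamiltonian (V, E S)}" "random_subset A (p + r - p * r)"]
    by (simp add: Compl_eq_Diff_UNIV[symmetric] Collect_neg_eq)
  moreover have "subset_prob A (p + r - p * r) {S. \<not> hamiltonian (V, E S)}
     \<le> subset_prob A p {S. \<not> expander V (E S)} + (32 * exp (- (real (m1 H n) * r) / (32 * real v))) ^ n"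
  proof (rule prob_random_subset_union_le)
    fix S assume "S \<subseteq> A" "expander V (E S)"
    from prob_sprinkle[OF this p(2) pr(3)]
    show "subset_prob A r {T. S \<union> T \<in> {S. \<not> hamiltonian (V, E S)}}
      \<le> (32 * exp (- (real (m1 H n) * r) / (32 * real v))) ^ n" by simp
  qed (use p pr in auto)
  ultimately show ?thesis by simp
qed

end

section \<open>Second moment\<close>

lemma hamiltonian_two_neighbours:
  assumes "hamiltonian (V, F)" "u \<in> V"
  shows "\<exists>y z. y \<noteq> z \<and> {u, y} \<in> F \<and> {u, z} \<in> F"
proof -
  obtain vs where vs: "length vs \<ge> 3" "distinct vs" "set vs = V"
    "\<forall>i<length vs. {vs ! i, vs ! ((i + 1) mod length vs)} \<in> F"
    using assms(1) unfolding hamiltonian_def fst_conv snd_conv by (elim exE conjE)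
  obtain i where i: "i < length vs" "u = vs ! i" using assms(2) vs(3) by (metis in_set_conv_nth)
  define l where "l = length vs"
  \<comment> \<open>The cyclic predecessor and successor of position \<open>i\<close>; they differ
    because a Hamilton cycle has at least three vertices.\<close>
  define j where "j = (if i = 0 then l - 1 else i - 1)"
  define k where "k = (if i = l - 1 then 0 else i + 1)"
  have j: "j < l" "(j + 1) mod l = i" and k: "(i + 1) mod l = k" "k < l" "j \<noteq> k"
    using vs(1) i(1) unfolding j_def k_def l_def[symmetric] by (auto split: if_splits)
  have "{vs ! i, vs ! k} \<in> F" using vs(4)[rule_format, OF i(1)] k(1) by (simp add: l_def)
  moreover have "{vs ! j, vs ! i} \<in> F" using vs(4) j by (metis l_def)
  then have "{vs ! i, vs ! j} \<in> F" by (subst insert_commute)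
  moreover have "vs ! k \<noteq> vs ! j" using vs(2) j k by (simp add: nth_eq_iff_index_eq l_def)
  ultimately show ?thesis unfolding i(2) by blast
qed

text \<open>Chebyshev's inequality in the form \<open>P(X = 0) \<le> E(X / E X - 1)\<^sup>2\<close>\<close>
lemma second_moment_random_subset:
  assumes A: "finite A" and U: "finite U"
    and a: "a = (\<Sum>u\<in>U. subset_prob A p {S. J u S})" "0 < a"
  shows "subset_prob A p {S. \<forall>u\<in>U. \<not> J u S}
    \<le> (\<Sum>u\<in>U. \<Sum>w\<in>U. subset_prob A p {S. J u S \<and> J w S}) / a\<^sup>2 - 1"
proof -
  let ?E = "measure_pmf.expectation (random_subset A p)"
  define X :: "_ \<Rightarrow> real" where "X = (\<lambda>S. \<Sum>u\<in>U. indicator {S. J u S} S)"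
  have EX: "?E X = a"
    unfolding X_def a(1) using A by (subst Bochner_Integration.integral_sum) auto
  have sq: "X S * X S = (\<Sum>u\<in>U. \<Sum>w\<in>U. indicator {S. J u S \<and> J w S} S)" for S
    unfolding X_def sum_product by (intro sum.cong refl) (auto simp: indicator_def)
  have EX2: "?E (\<lambda>S. X S * X S) = (\<Sum>u\<in>U. \<Sum>w\<in>U. subset_prob A p {S. J u S \<and> J w S})"
    unfolding sq using A by (subst Bochner_Integration.integral_sum, simp)+ simp
  have "subset_prob A p {S. \<forall>u\<in>U. \<not> J u S} = ?E (indicator {S. \<forall>u\<in>U. \<not> J u S})"
    by simp
  also have "\<dots> \<le> ?E (\<lambda>S. X S * X S / a\<^sup>2 - 2 * X S / a + 1)"
  proof (rule integral_mono)
    fix S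
    have eq: "X S * X S / a\<^sup>2 - 2 * X S / a + 1 = (X S / a - 1)\<^sup>2"
      using a(2) by (simp add: power2_eq_square field_simps)
    show "indicator {S. \<forall>u\<in>U. \<not> J u S} S \<le> X S * X S / a\<^sup>2 - 2 * X S / a + 1"
    proof (cases "\<forall>u\<in>U. \<not> J u S")
      case True
      then have "X S = 0" by (simp add: X_def)
      then show ?thesis using True by simp
    next
      case False
      then show ?thesis unfolding eq by simp
    qed
  qed (use A in auto)
  also have "\<dots> = ?E (\<lambda>S. X S * X S) / a\<^sup>2 - 2 * ?E X / a + 1"
    using A by simp
  also have "\<dots> = ?E (\<lambda>S. X S * X S) / a\<^sup>2 - 1" using a(2) by (simp add: EX)
  finally show ?thesis by (simp add: EX2)
qed

lemma sum_pairs_le: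
  fixes f :: "'b \<Rightarrow> 'b \<Rightarrow> real"
  assumes U: "finite U" and f: "\<And>u. u \<in> U \<Longrightarrow> f u u \<le> a" "\<And>u w. u \<in> U \<Longrightarrow> w \<in> U \<Longrightarrow> u \<noteq> w \<Longrightarrow> f u w \<le> b"
    and b: "0 \<le> b"
  shows "(\<Sum>u\<in>U. \<Sum>w\<in>U. f u w) \<le> real (card U) * a + (real (card U))\<^sup>2 * b"
proof -
  have "(\<Sum>u\<in>U. \<Sum>w\<in>U. f u w) \<le> (\<Sum>u\<in>U. a + real (card U) * b)"
  proof (rule sum_mono)
    fix u assume u: "u \<in> U"
    have "(\<Sum>w\<in>U. f u w) = f u u + (\<Sum>w\<in>U - {u}. f u w)" by (rule sum.remove[OF U u])
    also have "\<dots> \<le> a + (\<Sum>w\<in>U - {u}. b)" using f u by (intro add_mono sum_mono) auto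
    also have "(\<Sum>w\<in>U - {u}. b) \<le> (\<Sum>w\<in>U. b)" using U b by (intro sum_mono2) auto
    finally show "(\<Sum>w\<in>U. f u w) \<le> a + real (card U) * b" by simp
  qed
  then show ?thesis by (simp add: power2_eq_square algebra_simps)
qed

context copies_host
begin

text \<open>The vertices of degree at most one that are counted in the second moment argument.\<close>
definition exposed :: "nat \<Rightarrow> nat graph set \<Rightarrow> bool" where
  "exposed u S \<longleftrightarrow> (if 2 \<le> min_degree H then copies_at S u = {}
     else \<exists>C. copies_at S u = {C} \<and> vdegree C u = 1)"

text \<open>The two cycle edges at \<open>u\<close> come from chosen copies at \<open>u\<close>. If
  there is only one such copy, both lie in it, although \<open>u\<close> is a leaf there.\<close>

lemma exposed_not_hamiltonian:
  assumes S: "S \<subseteq> A" and u: "u \<in> V" "exposed u S"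
  shows "\<not> hamiltonian (V, E S)"
proof
  assume "hamiltonian (V, E S)"
  then obtain y z where yz: "y \<noteq> z" "{u, y} \<in> E S" "{u, z} \<in> E S"
    using hamiltonian_two_neighbours[OF _ u(1)] by blast
  then obtain C1 C2 where C12: "C1 \<in> S" "{u, y} \<in> edges C1" "C2 \<in> S" "{u, z} \<in> edges C2" by blast
  then have v: "u \<in> verts C1" "u \<in> verts C2"
    using copyD(5)[of C1 "{u, y}"] copyD(5)[of C2 "{u, z}"] S by auto
  have ne: "copies_at S u \<noteq> {}" using C12 v by blast
  then obtain C where C: "copies_at S u = {C}" "vdegree C u = 1"
    using u(2) unfolding exposed_def by (cases "2 \<le> min_degree H") auto
  then have "C1 = C" "C2 = C" "C \<in> S" using C12 v by blast+
  then have sub: "{{u, y}, {u, z}} \<subseteq> {e \<in> edges C. u \<in> e}" using C12 by simp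
  have "finite {e \<in> edges C. u \<in> e}" using copyD(4)[of C] S \<open>C \<in> S\<close> by auto
  then have "card {{u, y}, {u, z}} \<le> card {e \<in> edges C. u \<in> e}" using sub by (rule card_mono)
  moreover have "{u, y} \<noteq> {u, z}" using yz(1) by (auto simp: doubleton_eq_iff)
  ultimately show False using C(2) by (simp add: vdegree_def)
qed

lemma prob_hamiltonian_le:
  assumes "a = (\<Sum>u\<in>V. subset_prob A p {S. exposed u S})" "0 < a"
  shows "hamiltonian_prob H n p
    \<le> (\<Sum>u\<in>V. \<Sum>w\<in>V. subset_prob A p {S. exposed u S \<and> exposed w S}) / a\<^sup>2 - 1"
proof -
  have "hamiltonian_prob H n p
    \<le> subset_prob A p {S. \<forall>u\<in>V. \<not> exposed u S}"
    unfolding prob_random_graph_hamiltonian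
    by (rule prob_random_subset_mono_event) (use exposed_not_hamiltonian in blast)
  also have "\<dots> \<le> (\<Sum>u\<in>V. \<Sum>w\<in>V. subset_prob A p {S. exposed u S \<and> exposed w S}) / a\<^sup>2 - 1"
    by (rule second_moment_random_subset) (use assms in auto)
  finally show ?thesis .
qed

section \<open>Uncovered vertices\<close>

lemma prob_isolated:
  assumes p: "0 \<le> p" "p \<le> 1" and u: "u \<in> V"
  shows "subset_prob A p {S. copies_at S u = {}} = (1 - p) ^ m1 H n"
proof -
  have "subset_prob A p {S. copies_at S u = {}}
    = subset_prob A p {S. {} \<subseteq> S \<and> S \<inter> copies_at A u = {}}"
    by (intro order_antisym prob_random_subset_mono_event) blast+
  also have "\<dots> = p ^ card ({} :: nat graph set) * (1 - p) ^ card (copies_at A u)"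
    by (rule prob_random_subset) (use p in auto)
  finally show ?thesis by (simp add: card_copies_at[OF u])
qed

text \<open>By inclusion-exclusion \<open>2 * m1 H n - m2\<close> copies must be missed. The
  denominator stands for the \<open>m2\<close> common copies and is the whole correlation between
  the two events.\<close>

lemma prob_isolated_pair:
  assumes p: "0 \<le> p" "p < 1" and u: "u \<in> V" "w \<in> V" "u \<noteq> w"
  shows "subset_prob A p {S. copies_at S u = {} \<and> copies_at S w = {}}
    = ((1 - p) ^ m1 H n)\<^sup>2 / (1 - p) ^ m2"
proof -
  let ?B = "{C \<in> A. u \<in> verts C \<or> w \<in> verts C}"
  have "subset_prob A p {S. copies_at S u = {} \<and> copies_at S w = {}}
    = subset_prob A p {S. {} \<subseteq> S \<and> S \<inter> ?B = {}}"
    by (intro order_antisym prob_random_subset_mono_event) blast+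
  also have "\<dots> = p ^ card ({} :: nat graph set) * (1 - p) ^ card ?B"
    by (rule prob_random_subset) (use p in auto)
  also have "\<dots> = (1 - p) ^ (card ?B + m2) / (1 - p) ^ m2" using p by (simp add: power_add)
  also have "\<dots> = ((1 - p) ^ m1 H n)\<^sup>2 / (1 - p) ^ m2"
    unfolding card_copies_either[OF u] by (simp add: power_mult mult.commute)
  finally show ?thesis .
qed

lemma prob_hamiltonian_le_isolated:
  assumes p: "0 \<le> p" "p < 1" and deg: "2 \<le> min_degree H"
  shows "hamiltonian_prob H n p
    \<le> 1 / (real n * (1 - p) ^ m1 H n) + (1 / (1 - p) ^ m2 - 1)"
proof -
  define \<pi> where "\<pi> = (1 - p) ^ m1 H n"
  have \<pi>: "0 < \<pi>" using p by (simp add: \<pi>_def)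
  have P1: "subset_prob A p {S. exposed u S} = \<pi>" if "u \<in> V" for u
    using prob_isolated[OF p(1) _ that] p deg by (simp add: exposed_def \<pi>_def)
  have P2: "subset_prob A p {S. exposed u S \<and> exposed w S} = \<pi>\<^sup>2 / (1 - p) ^ m2"
    if "u \<in> V" "w \<in> V" "u \<noteq> w" for u w
    using prob_isolated_pair[OF p that] deg by (simp add: exposed_def \<pi>_def)
  have a: "(\<Sum>u\<in>V. subset_prob A p {S. exposed u S}) = real n * \<pi>" using P1 by simp
  have "hamiltonian_prob H n p
    \<le> (\<Sum>u\<in>V. \<Sum>w\<in>V. subset_prob A p {S. exposed u S \<and> exposed w S}) / (real n * \<pi>)\<^sup>2 - 1"
    by (rule prob_hamiltonian_le) (use a \<pi> n in auto)
  also have "(\<Sum>u\<in>V. \<Sum>w\<in>V. subset_prob A p {S. exposed u S \<and> exposed w S})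
    \<le> real (card V) * \<pi> + (real (card V))\<^sup>2 * (\<pi>\<^sup>2 / (1 - p) ^ m2)"
    by (rule sum_pairs_le) (use P1 P2 p \<pi> in auto)
  also have "(real (card V) * \<pi> + (real (card V))\<^sup>2 * (\<pi>\<^sup>2 / (1 - p) ^ m2)) / (real n * \<pi>)\<^sup>2 - 1
     = 1 / (real n * \<pi>) + (1 / (1 - p) ^ m2 - 1)"
    using \<pi> n p by (simp add: field_simps power2_eq_square)
  finally show ?thesis using \<pi> n by (simp add: \<pi>_def divide_right_mono)
qed

section \<open>Vertices that are a leaf of their only copy\<close>

text \<open>The event splits into disjoint ones, one for each copy \<open>C\<close> with a leaf at
  \<open>u\<close>: it is chosen and the other copies at \<open>u\<close> are not. Dividing by
  \<open>1 - p\<close> accounts for \<open>C\<close> itself among the \<open>m1 H n\<close>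
  factors.\<close>

lemma prob_leaf:
  assumes p: "0 \<le> p" "p < 1" and u: "u \<in> V"
  shows "subset_prob A p {S. \<exists>C. copies_at S u = {C} \<and> vdegree C u = 1}
    = real m1_leaf * p * (1 - p) ^ m1 H n / (1 - p)"
proof -
  define L where "L = {C \<in> A. u \<in> verts C \<and> vdegree C u = 1}"
  define B where "B = (\<lambda>C. copies_at A u - {C})"
  let ?E = "measure_pmf.expectation (random_subset A p)"
  have cB: "Suc (card (B C)) = m1 H n" if "C \<in> L" for C
  proof -
    have "C \<in> copies_at A u" using that by (simp add: L_def)
    then have "Suc (card (B C)) = card (copies_at A u)" unfolding B_def by (intro card_Suc_Diff1) simp_all
    then show ?thesis by (simp add: card_copies_at[OF u])
  qed
  have "subset_prob A p {S. \<exists>C. copies_at S u = {C} \<and> vdegree C u = 1}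
    = ?E (indicator {S. \<exists>C. copies_at S u = {C} \<and> vdegree C u = 1})" by simp
  also have "\<dots> = ?E (\<lambda>S. \<Sum>C\<in>L. indicator {S. {C} \<subseteq> S \<and> S \<inter> B C = {}} S)"
  proof (rule integral_cong_AE)
    show "AE S in measure_pmf (random_subset A p).
      indicator {S. \<exists>C. copies_at S u = {C} \<and> vdegree C u = 1} S
      = (\<Sum>C\<in>L. indicator {S. {C} \<subseteq> S \<and> S \<inter> B C = {}} S :: real)"
    proof (rule AE_pmfI)
      fix S assume "S \<in> set_pmf (random_subset A p)"
      then have S: "S \<subseteq> A" using set_pmf_random_subset by blast
      have iff: "{C} \<subseteq> S \<and> S \<inter> B C = {} \<longleftrightarrow> copies_at S u = {C}" if "C \<in> L" for C
        using S that unfolding B_def L_def by blast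
      show "indicator {S. \<exists>C. copies_at S u = {C} \<and> vdegree C u = 1} S
        = (\<Sum>C\<in>L. indicator {S. {C} \<subseteq> S \<and> S \<inter> B C = {}} S :: real)"
      proof (cases "\<exists>C. copies_at S u = {C} \<and> vdegree C u = 1")
        case True
        then obtain D where D: "copies_at S u = {D}" "vdegree D u = 1" by blast
        then have DS: "D \<in> S" "u \<in> verts D" by blast+
        then have DL: "D \<in> L" using S D(2) by (auto simp: L_def)
        have "(\<Sum>C\<in>L. indicator {S. {C} \<subseteq> S \<and> S \<inter> B C = {}} S :: real) = (\<Sum>C\<in>L. if C = D then 1 else 0)"
        proof (rule sum.cong[OF refl])
          fix C assume "C \<in> L"
          have "copies_at S u = {C} \<longleftrightarrow> C = D" unfolding D(1) by blast
          then show "indicator {S. {C} \<subseteq> S \<and> S \<inter> B C = {}} S = (if C = D then 1 else 0 :: real)"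
            using iff[OF \<open>C \<in> L\<close>] by (simp add: indicator_def)
        qed
        also have "\<dots> = 1" using DL by (simp add: L_def)
        finally show ?thesis using True by simp
      next
        case False
        have "(\<Sum>C\<in>L. indicator {S. {C} \<subseteq> S \<and> S \<inter> B C = {}} S :: real) = 0"
        proof (rule sum.neutral, rule ballI)
          fix C assume C: "C \<in> L"
          then have "vdegree C u = 1" by (simp add: L_def)
          then have "\<not> ({C} \<subseteq> S \<and> S \<inter> B C = {})" using False iff[OF C] by blast
          then show "indicator {S. {C} \<subseteq> S \<and> S \<inter> B C = {}} S = (0::real)" by (simp add: indicator_def)
        qed
        then show ?thesis using False by simp
      qed
    qed
  qed auto
  also have "\<dots> = (\<Sum>C\<in>L. subset_prob A p {S. {C} \<subseteq> S \<and> S \<inter> B C = {}})"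
    by (subst Bochner_Integration.integral_sum) auto
  also have "\<dots> = (\<Sum>C\<in>L. p * (1 - p) ^ m1 H n / (1 - p))"
  proof (rule sum.cong[OF refl])
    fix C assume C: "C \<in> L"
    have "subset_prob A p {S. {C} \<subseteq> S \<and> S \<inter> B C = {}} = p ^ card {C} * (1 - p) ^ card (B C)"
      by (rule prob_random_subset) (use C p in \<open>auto simp: L_def B_def\<close>)
    also have "\<dots> = p * (1 - p) ^ Suc (card (B C)) / (1 - p)" using p by simp
    finally show "subset_prob A p {S. {C} \<subseteq> S \<and> S \<inter> B C = {}} = p * (1 - p) ^ m1 H n / (1 - p)"
      unfolding cB[OF C] .
  qed
  also have "\<dots> = real m1_leaf * p * (1 - p) ^ m1 H n / (1 - p)"
    by (simp add: L_def card_copies_leaf[OF u, simplified])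
  finally show ?thesis .
qed

text \<open>The chosen copies at \<open>u\<close> or \<open>w\<close> are one common copy or two
  distinct ones, and the union bound runs over this family \<open>F\<close>. Common copies
  contribute \<open>m2 * p\<close>, which is of order \<open>M / n\<close>, so the two events are
  almost uncorrelated.\<close>

lemma prob_leaf_pair:
  assumes p: "0 < p" "p < 1" and u: "u \<in> V" "w \<in> V" "u \<noteq> w"
  shows "subset_prob A p {S. (\<exists>C. copies_at S u = {C} \<and> vdegree C u = 1)
      \<and> (\<exists>C. copies_at S w = {C} \<and> vdegree C w = 1)}
    \<le> (real m2 * p + (real m1_leaf * p)\<^sup>2) * ((1 - p) ^ m1 H n)\<^sup>2 / ((1 - p) ^ m2 * (1 - p)\<^sup>2)"
    (is "measure_pmf.prob _ {S. ?Q S} \<le> _")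
proof -
  define X where "X = {C \<in> A. u \<in> verts C \<or> w \<in> verts C}"
  define D where "D = {C \<in> A. u \<in> verts C \<and> w \<in> verts C}"
  define Lu where "Lu = {C \<in> A. u \<in> verts C \<and> vdegree C u = 1}"
  define Lw where "Lw = {C \<in> A. w \<in> verts C \<and> vdegree C w = 1}"
  \<comment> \<open>For a common copy the leaf conditions are dropped; \<open>m2\<close> is small
    enough to afford this.\<close>
  define I where "I = (\<lambda>C. {C}) ` D \<union> (\<lambda>(C, C'). {C, C'}) ` {(C, C'). C \<in> Lu \<and> C' \<in> Lw \<and> C \<noteq> C'}"
  define R where "R = ((1 - p) ^ m1 H n)\<^sup>2 / ((1 - p) ^ m2 * (1 - p)\<^sup>2)"
  have R0: "0 \<le> R" using p by (simp add: R_def)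
  have cX: "card X + m2 = 2 * m1 H n" unfolding X_def by (rule card_copies_either[OF u])
  have finL: "finite Lu" "finite Lw" "finite D" "finite X" by (simp_all add: Lu_def Lw_def D_def X_def)
  have finP: "finite {(C, C'). C \<in> Lu \<and> C' \<in> Lw \<and> C \<noteq> C'}"
    by (rule finite_subset[of _ "Lu \<times> Lw"]) (use finL in auto)
  have fI: "finite I" unfolding I_def using finL finP by blast
  have IX: "F \<subseteq> X" if "F \<in> I" for F using that by (auto simp: I_def D_def Lu_def Lw_def X_def)
  have c2: "card F = 2" if "F \<in> (\<lambda>(C, C'). {C, C'}) ` {(C, C'). C \<in> Lu \<and> C' \<in> Lw \<and> C \<noteq> C'}" for F
  proof -
    from that obtain z where "z \<in> {(C, C'). C \<in> Lu \<and> C' \<in> Lw \<and> C \<noteq> C'}" "F = (\<lambda>(C, C'). {C, C'}) z" by (rule imageE)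
    then have "F = {fst z, snd z}" "fst z \<noteq> snd z" by (simp_all add: case_prod_unfold)
    then show ?thesis by simp
  qed
  have cI: "card F = 1 \<or> card F = 2" if "F \<in> I" for F
    using that c2 unfolding I_def by (elim UnE) auto
  have term_le: "p ^ card F * (1 - (1 - 0) * p) ^ card (X - F) \<le> p ^ card F * R" if F: "F \<in> I" for F
  proof -
    have finF: "finite F" using IX[OF F] finL(4) by (rule finite_subset)
    have "card (X - F) + card F = card X"
      using card_mono[OF finL(4) IX[OF F]] card_Diff_subset[OF finF IX[OF F]] by simp
    then have sum: "card (X - F) + (m2 + card F) = 2 * m1 H n" using cX by simp
    have "(1 - p) ^ card (X - F) * (1 - p) ^ (m2 + card F) = ((1 - p) ^ m1 H n)\<^sup>2"
      unfolding power_add[symmetric] sum by (simp add: power_mult mult.commute)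
    then have "(1 - p) ^ card (X - F) = ((1 - p) ^ m1 H n)\<^sup>2 / (1 - p) ^ (m2 + card F)"
      using p by (simp add: eq_divide_eq)
    \<comment> \<open>\<open>F\<close> has one or two members; pretending that it has two covers
      both cases by the same \<open>R\<close>.\<close>
    also have "\<dots> \<le> ((1 - p) ^ m1 H n)\<^sup>2 / ((1 - p) ^ (m2 + 2))"
      using p cI[OF F] by (intro divide_left_mono power_decreasing mult_pos_pos) auto
    finally have "(1 - p) ^ card (X - F) \<le> R" unfolding R_def power_add .
    then show ?thesis using p by (simp add: mult_left_mono)
  qed
  have "subset_prob A p {S. ?Q S}
     \<le> (\<Sum>F\<in>I. 1 * (p ^ card F * (1 - (1 - 0) * p) ^ card (X - F)))"
  proof (rule prob_random_subset_union_bound)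
    show "F \<subseteq> A \<and> X - F \<subseteq> A \<and> F \<inter> (X - F) = {} \<and> 0 \<le> (0::real) \<and> 0 \<le> (1::real)" if "F \<in> I" for F
      using IX[OF that] by (auto simp: X_def)
    fix S assume S: "S \<subseteq> A" "?Q S"
    then obtain C C' where C: "copies_at S u = {C}" "vdegree C u = 1"
      and C': "copies_at S w = {C'}" "vdegree C' w = 1" by blast
    have CS: "C \<in> S" "u \<in> verts C" "C' \<in> S" "w \<in> verts C'" using C(1) C'(1) by blast+
    have SX: "S \<inter> (X - {C, C'}) = {}" using C(1) C'(1) unfolding X_def by blast
    have "{C, C'} \<in> I"
    proof (cases "C = C'")
      case True
      then have "C \<in> D" using CS S(1) by (auto simp: D_def)
      then show ?thesis using True by (simp add: I_def)
    next
      case False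
      have "(C, C') \<in> {(C, C'). C \<in> Lu \<and> C' \<in> Lw \<and> C \<noteq> C'}"
        using CS S(1) C(2) C'(2) False by (auto simp: Lu_def Lw_def)
      then show ?thesis unfolding I_def by (intro UnI2 image_eqI[of _ _ "(C, C')"]) simp_all
    qed
    then show "\<exists>F\<in>I. F \<subseteq> S \<and> 1 \<le> 1 * (0::real) ^ card (S \<inter> (X - F))"
      using SX CS by (intro bexI[of _ "{C, C'}"]) simp_all
  qed (use p fI in auto)
  also have "\<dots> \<le> (\<Sum>F\<in>I. p ^ card F * R)" using term_le by (intro sum_mono) simp
  also have "\<dots> \<le> (\<Sum>F\<in>(\<lambda>C. {C}) ` D. p ^ card F * R)
     + (\<Sum>F\<in>(\<lambda>(C, C'). {C, C'}) ` {(C, C'). C \<in> Lu \<and> C' \<in> Lw \<and> C \<noteq> C'}. p ^ card F * R)"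
  proof -
    have "0 \<le> p ^ card F * R" for F :: "nat graph set" using p R0 by simp
    then show ?thesis unfolding I_def
      using finL finP sum.union_inter[of "(\<lambda>C. {C}) ` D" "(\<lambda>(C, C'). {C, C'}) ` {(C, C'). C \<in> Lu \<and> C' \<in> Lw \<and> C \<noteq> C'}" "\<lambda>F. p ^ card F * R"]
      by (smt (verit) finite_imageI sum_nonneg)
  qed
  also have "\<dots> \<le> real m2 * p * R + (real m1_leaf * p)\<^sup>2 * R"
  proof (rule add_mono)
    have "(\<Sum>F\<in>(\<lambda>C. {C}) ` D. p ^ card F * R) = (\<Sum>C\<in>D. p * R)"
      by (subst sum.reindex) (auto simp: inj_on_def)
    also have "\<dots> = real m2 * p * R" using card_copies_pair[OF u] by (simp add: D_def)
    finally show "(\<Sum>F\<in>(\<lambda>C. {C}) ` D. p ^ card F * R) \<le> real m2 * p * R" by simp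
    let ?P = "{(C, C'). C \<in> Lu \<and> C' \<in> Lw \<and> C \<noteq> C'}"
    have "(\<Sum>F\<in>(\<lambda>(C, C'). {C, C'}) ` ?P. p ^ card F * R) = (\<Sum>F\<in>(\<lambda>(C, C'). {C, C'}) ` ?P. p\<^sup>2 * R)"
      by (rule sum.cong[OF refl]) (simp only: c2)
    also have "\<dots> = real (card ((\<lambda>(C, C'). {C, C'}) ` ?P)) * (p\<^sup>2 * R)" by simp
    also have "\<dots> \<le> real (m1_leaf * m1_leaf) * (p\<^sup>2 * R)"
    proof (rule mult_right_mono)
      have "card ((\<lambda>(C, C'). {C, C'}) ` ?P) \<le> card ?P" by (rule card_image_le[OF finP])
      also have "\<dots> \<le> card (Lu \<times> Lw)" by (rule card_mono) (use finL in auto)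
      also have "\<dots> = m1_leaf * m1_leaf"
        unfolding card_cartesian_product Lu_def Lw_def card_copies_leaf[OF u(1)] card_copies_leaf[OF u(2)] ..
      finally show "real (card ((\<lambda>(C, C'). {C, C'}) ` ?P)) \<le> real (m1_leaf * m1_leaf)" by (simp only: of_nat_le_iff)
    qed (use R0 in simp)
    also have "\<dots> = (real m1_leaf * p)\<^sup>2 * R" by (simp add: power2_eq_square mult_ac)
    finally show "(\<Sum>F\<in>(\<lambda>(C, C'). {C, C'}) ` ?P. p ^ card F * R) \<le> (real m1_leaf * p)\<^sup>2 * R" .
  qed
  also have "\<dots> = (real m2 * p + (real m1_leaf * p)\<^sup>2) * ((1 - p) ^ m1 H n)\<^sup>2 / ((1 - p) ^ m2 * (1 - p)\<^sup>2)"
    by (simp add: R_def distrib_right add_divide_distrib)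
  finally show ?thesis .
qed

lemma prob_hamiltonian_le_leaf:
  assumes p: "0 < p" "p < 1" and deg: "\<not> 2 \<le> min_degree H" and L: "0 < m1_leaf"
  shows "hamiltonian_prob H n p
    \<le> (1 - p) / (real n * (real m1_leaf * p * (1 - p) ^ m1 H n))
      + ((real m2 * p / (real m1_leaf * p)\<^sup>2 + 1) / (1 - p) ^ m2 - 1)"
proof -
  define \<pi> where "\<pi> = real m1_leaf * p * (1 - p) ^ m1 H n / (1 - p)"
  have \<pi>: "0 < \<pi>" using p L by (simp add: \<pi>_def)
  define \<beta> where "\<beta> = (real m2 * p / (real m1_leaf * p)\<^sup>2 + 1) / (1 - p) ^ m2 * \<pi>\<^sup>2"
  have \<beta>: "0 \<le> \<beta>" using p by (simp add: \<beta>_def)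
  have P1: "subset_prob A p {S. exposed u S} = \<pi>" if "u \<in> V" for u
    using prob_leaf[OF _ p(2) that] p(1) deg by (simp add: exposed_def \<pi>_def)
  have \<beta>_eq: "\<beta> = (real m2 * p + (real m1_leaf * p)\<^sup>2) * ((1 - p) ^ m1 H n)\<^sup>2 / ((1 - p) ^ m2 * (1 - p)\<^sup>2)"
    using p L by (simp add: \<beta>_def \<pi>_def field_simps)
  have P2: "subset_prob A p {S. exposed u S \<and> exposed w S} \<le> \<beta>"
    if "u \<in> V" "w \<in> V" "u \<noteq> w" for u w
    using prob_leaf_pair[OF p that] deg unfolding \<beta>_eq by (simp add: exposed_def)
  have a: "(\<Sum>u\<in>V. subset_prob A p {S. exposed u S}) = real n * \<pi>" using P1 by simp
  have "hamiltonian_prob H n p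
    \<le> (\<Sum>u\<in>V. \<Sum>w\<in>V. subset_prob A p {S. exposed u S \<and> exposed w S}) / (real n * \<pi>)\<^sup>2 - 1"
    by (rule prob_hamiltonian_le) (use a \<pi> n in auto)
  also have "\<dots> \<le> (real (card V) * \<pi> + (real (card V))\<^sup>2 * \<beta>) / (real n * \<pi>)\<^sup>2 - 1"
    by (intro diff_right_mono divide_right_mono sum_pairs_le) (use P1 P2 \<beta> in auto)
  also have "\<dots> = 1 / (real n * \<pi>) + (\<beta> / \<pi>\<^sup>2 - 1)"
    using \<pi> n by (simp add: field_simps power2_eq_square)
  also have "\<beta> / \<pi>\<^sup>2 = (real m2 * p / (real m1_leaf * p)\<^sup>2 + 1) / (1 - p) ^ m2"
    using \<pi> by (simp add: \<beta>_def)
  also have "1 / (real n * \<pi>) = (1 - p) / (real n * (real m1_leaf * p * (1 - p) ^ m1 H n))"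
    by (simp add: \<pi>_def)
  finally show ?thesis .
qed

end

section \<open>The threshold\<close>

lemma failure_bound_tendsto: "0 < k \<Longrightarrow> (failure_bound k \<longlongrightarrow> 0) at_top"
  unfolding failure_bound_def by real_asymp

lemma one_minus_power_ge_exp:
  fixes p :: real
  assumes "0 \<le> p" "p \<le> 1 / 2"
  shows "exp (- p * real m - 2 * p\<^sup>2 * real m) \<le> (1 - p) ^ m"
proof -
  have "- p - 2 * p\<^sup>2 \<le> ln (1 - p)" using assms by (rule ln_one_minus_pos_lower_bound)
  then have "exp (- p - 2 * p\<^sup>2) \<le> exp (ln (1 - p))" by simp
  then have "exp (- p - 2 * p\<^sup>2) ^ m \<le> (1 - p) ^ m" using assms by (intro power_mono) auto
  then show ?thesis by (simp add: exp_of_nat_mult[symmetric] algebra_simps)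
qed

context copies_host
begin

lemma delta_2: "real_of_int (delta 2 H) = (if 2 \<le> min_degree H then 0 else 1)"
proof -
  obtain u where "u \<in> verts H" "vdegree H u = min_degree H" using min_degree_attained by blast
  then have d: "1 \<le> min_degree H" using vdegree_H_pos by metis
  show ?thesis
  proof (cases "2 \<le> min_degree H")
    case True
    have "\<lceil>real 2 / real (min_degree H)\<rceil> = 1"
      using True by (intro ceiling_unique) (auto simp: divide_simps)
    then show ?thesis using True by (simp add: delta_def)
  next
    case False
    then have "min_degree H = 1" using d by simp
    then show ?thesis by (simp add: delta_def)
  qed
qed

text \<open>Since \<open>m1 H n \<ge> n / v\<close>, \<open>p\<close> is at most
  \<open>v * M / n\<close>. The bound on \<open>M ^ 2\<close> then keeps
  \<open>p ^ 2 * m1 H n = p * M\<close> at most one half, so \<open>(1 - p) ^ m1 H n\<close> stays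
  within a constant factor of \<open>exp (- M)\<close>.\<close>

lemma small_p_bounds:
  assumes p: "0 \<le> p" and M: "M = real (m1 H n) * p" "1 \<le> M" "2 * real v * M\<^sup>2 \<le> real n"
  shows "0 < p" "p \<le> 1 / 2" "exp (- M - 1) \<le> (1 - p) ^ m1 H n"
    "1 / (1 - p) ^ m2 \<le> exp (2 * real v * M / real n)"
proof -
  have m1: "0 < real (m1 H n)" using m1_pos by simp
  show p0: "0 < p" using M(1,2) p by (cases "p = 0") auto
  have "M \<le> M\<^sup>2" using M(2) by (simp add: power2_eq_square)
  then have vM: "2 * real v * M \<le> real n" using M(3) mult_left_mono[of M "M\<^sup>2" "2 * real v"] by simp
  have pn: "p * real n \<le> real v * M"
    using mult_left_mono[OF n_le p] by (simp add: M(1) mult_ac)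
  show p2: "p \<le> 1 / 2"
  proof -
    have "p * real n \<le> 1 / 2 * real n" using pn vM by simp
    then show ?thesis by (rule mult_right_le_imp_le) (use n in simp)
  qed
  have pM: "2 * (p * M) \<le> 1"
  proof -
    have "2 * (p * M) * real n \<le> 2 * (real v * M) * M"
      using mult_right_mono[OF pn, of "2 * M"] M(2) by (simp add: mult_ac)
    also have "\<dots> \<le> 1 * real n" using M(3) by (simp add: power2_eq_square mult_ac)
    finally show ?thesis by (rule mult_right_le_imp_le) (use n in simp)
  qed
  have "exp (- M - 1) \<le> exp (- p * real (m1 H n) - 2 * p\<^sup>2 * real (m1 H n))"
    using pM by (simp add: M(1) power2_eq_square mult_ac)
  also have "\<dots> \<le> (1 - p) ^ m1 H n" by (rule one_minus_power_ge_exp[OF p p2])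
  finally show "exp (- M - 1) \<le> (1 - p) ^ m1 H n" .
  have "p * real m2 + 2 * p\<^sup>2 * real m2 \<le> 2 * (p * real m2)"
    using mult_right_mono[OF p2, of "2 * (p * real m2)"] p by (simp add: power2_eq_square mult_ac)
  also have "\<dots> \<le> 2 * real v * M / real n" using pair_rate[OF p] by (simp add: M(1))
  finally have "- (2 * real v * M / real n) \<le> - p * real m2 - 2 * p\<^sup>2 * real m2" by simp
  then have "exp (- (2 * real v * M / real n)) \<le> exp (- p * real m2 - 2 * p\<^sup>2 * real m2)" by (simp only: exp_le_cancel_iff)
  also have "\<dots> \<le> (1 - p) ^ m2" by (rule one_minus_power_ge_exp[OF p p2])
  finally have "exp (- (2 * real v * M / real n)) \<le> (1 - p) ^ m2" .
  then have "1 / (1 - p) ^ m2 \<le> 1 / exp (- (2 * real v * M / real n))"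
    using p2 by (intro divide_left_mono mult_pos_pos) auto
  then show "1 / (1 - p) ^ m2 \<le> exp (2 * real v * M / real n)" by (simp add: exp_minus inverse_eq_divide)
qed

text \<open>The first summand bounds the reciprocal of the expected number of exposed vertices, the
  second the correlation of two of them. The term \<open>v ^ 3 / n\<close> comes from common leaf
  copies: \<open>(v * M / n) / (M / v) ^ 2 = v ^ 3 / (n * M)\<close>.\<close>

lemma prob_hamiltonian_small:
  assumes p: "0 \<le> p" and M: "M = real (m1 H n) * p" "1 \<le> M" "2 * real v * M\<^sup>2 \<le> real n"
  shows "hamiltonian_prob H n p
    \<le> (if 2 \<le> min_degree H then exp (M + 1) / real n else real v * exp (M + 1) / (real n * M))
      + (((real v) ^ 3 / real n + 1) * exp (2 * real v * M / real n) - 1)"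
proof -
  note b = small_p_bounds[OF assms]
  have p1: "p < 1" using b(2) by simp
  have Q: "0 < (1 - p) ^ m1 H n" using p1 by simp
  have e: "exp (M + 1) = 1 / exp (- M - 1)" by (simp add: exp_minus[symmetric] inverse_eq_divide[symmetric])
  show ?thesis
  proof (cases "2 \<le> min_degree H")
    case True
    have "hamiltonian_prob H n p
      \<le> 1 / (real n * (1 - p) ^ m1 H n) + (1 / (1 - p) ^ m2 - 1)"
      by (rule prob_hamiltonian_le_isolated[OF p p1 True])
    also have "\<dots> \<le> exp (M + 1) / real n + (exp (2 * real v * M / real n) - 1)"
    proof (intro add_mono diff_right_mono b(4))
      have "1 / (real n * (1 - p) ^ m1 H n) \<le> 1 / (real n * exp (- M - 1))"
        using n Q b(3) by (intro divide_left_mono mult_left_mono mult_pos_pos) auto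
      also have "\<dots> = exp (M + 1) / real n" by (simp add: e)
      finally show "1 / (real n * (1 - p) ^ m1 H n) \<le> exp (M + 1) / real n" .
    qed
    also have "exp (2 * real v * M / real n) \<le> ((real v) ^ 3 / real n + 1) * exp (2 * real v * M / real n)"
      by (simp add: distrib_right)
    finally show ?thesis using True by simp
  next
    case False
    obtain u where "u \<in> verts H" "vdegree H u = min_degree H" using min_degree_attained by blast
    then have "1 \<le> min_degree H" using vdegree_H_pos by metis
    then have "min_degree H = 1" using False by simp
    then have L: "real (m1 H n) \<le> real v * real m1_leaf" by (rule m1_leaf_ge)
    have L0: "0 < m1_leaf" using L m1_pos by (cases m1_leaf) auto
    have v0: "0 < real v" using v_ge_2 by simp
    have Lp: "M / real v \<le> real m1_leaf * p"
      using mult_right_mono[OF L p] v0 by (simp add: M(1) divide_le_eq mult_ac)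
    have Mv: "0 < M / real v" using M(2) v0 by simp
    have "hamiltonian_prob H n p
      \<le> (1 - p) / (real n * (real m1_leaf * p * (1 - p) ^ m1 H n))
      + ((real m2 * p / (real m1_leaf * p)\<^sup>2 + 1) / (1 - p) ^ m2 - 1)"
      by (rule prob_hamiltonian_le_leaf[OF b(1) p1 False L0])
    also have "\<dots> \<le> real v * exp (M + 1) / (real n * M) + (((real v) ^ 3 / real n + 1) * exp (2 * real v * M / real n) - 1)"
    proof (intro add_mono diff_right_mono)
      have "(1 - p) / (real n * (real m1_leaf * p * (1 - p) ^ m1 H n)) \<le> 1 / (real n * (M / real v * exp (- M - 1)))"
        using n Q b Lp Mv p by (intro frac_le mult_left_mono mult_mono mult_pos_pos) auto
      also have "\<dots> = real v * exp (M + 1) / (real n * M)" unfolding e by simp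
      finally show "(1 - p) / (real n * (real m1_leaf * p * (1 - p) ^ m1 H n)) \<le> real v * exp (M + 1) / (real n * M)" .
      have rate: "real m2 * p \<le> real v * M / real n"
        using pair_rate[OF p] unfolding M(1) by (simp add: mult.commute)
      have "real m2 * p / (real m1_leaf * p)\<^sup>2 \<le> (real v * M / real n) / (M / real v)\<^sup>2"
        using rate Lp Mv M(2) by (intro frac_le power_mono zero_less_power) auto
      also have "\<dots> = (real v) ^ 3 / (real n * M)"
        using n v0 M(2) by (simp add: power2_eq_square power3_eq_cube field_simps)
      also have "\<dots> \<le> (real v) ^ 3 / (real n * 1)"
        using n M(2) by (intro divide_left_mono mult_left_mono mult_pos_pos) auto
      finally have "real m2 * p / (real m1_leaf * p)\<^sup>2 + 1 \<le> (real v) ^ 3 / real n + 1" by simp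
      then have "(real m2 * p / (real m1_leaf * p)\<^sup>2 + 1) * (1 / (1 - p) ^ m2)
          \<le> ((real v) ^ 3 / real n + 1) * exp (2 * real v * M / real n)"
        using p1 by (intro mult_mono b(4)) auto
      then show "(real m2 * p / (real m1_leaf * p)\<^sup>2 + 1) / (1 - p) ^ m2
          \<le> ((real v) ^ 3 / real n + 1) * exp (2 * real v * M / real n)" by simp
    qed
    finally show ?thesis using False by simp
  qed
qed

end

section \<open>The limit below the threshold\<close>

text \<open>By monotonicity it suffices to treat \<open>p_minus\<close> itself. There
  \<open>exp M\<close> is \<open>n * exp (- x n)\<close>, or \<open>n * ln n * exp (- x n)\<close>
  for minimum degree one, so the reciprocal of the expected number of exposed vertices is of order
  \<open>exp (- x n)\<close>.\<close>

lemma hamiltonian_below_threshold: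
  fixes H :: "'a graph" and p x :: "nat \<Rightarrow> real"
  assumes H: "simple_graph H" "\<not> (\<exists>v. isolated H v)"
    and x: "filterlim x at_top sequentially" "x \<in> o(\<lambda>n. ln (ln (real n)))"
    and p: "\<And>n. 0 \<le> p n"
    and le: "\<forall>\<^sub>F n in sequentially. p n \<le> p_minus 2 H x n"
  shows "(\<lambda>n. hamiltonian_prob H n (p n)) \<longlonglongrightarrow> 0"
proof -
  define v where "v = card (verts H)"
  define g where "g = (\<lambda>n. 2 * real v * exp 1 * exp (- x n) + (((real v) ^ 3 / real n + 1) * exp (4 * real v * ln (real n) / real n) - 1))"
  have "(\<lambda>n. exp (- x n)) \<longlonglongrightarrow> 0"
    by (rule filterlim_compose[OF exp_at_bot]) (use x(1) in \<open>simp add: filterlim_uminus_at_bot\<close>)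
  moreover have "(\<lambda>n. ((real v) ^ 3 / real n + 1) * exp (4 * real v * ln (real n) / real n) - 1) \<longlonglongrightarrow> 0"
    by real_asymp
  ultimately have "g \<longlonglongrightarrow> 2 * real v * exp 1 * 0 + 0"
    unfolding g_def by (intro tendsto_add tendsto_mult tendsto_const)
  then have g0: "g \<longlonglongrightarrow> 0" by simp
  have "\<forall>\<^sub>F n in sequentially. norm (x n) \<le> 1/2 * norm (ln (ln (real n)))"
    by (rule landau_o.smallD[OF x(2)]) simp
  moreover have "\<forall>\<^sub>F n in sequentially. 0 \<le> x n" using x(1) by (simp add: filterlim_at_top)
  moreover have "\<forall>\<^sub>F n in sequentially. 0 \<le> ln (ln (real n)) \<and> ln (ln (real n)) \<le> ln (real n) \<and> 2 \<le> ln (real n)"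
    by (intro eventually_conj) real_asymp+
  moreover have "\<forall>\<^sub>F n in sequentially. 8 * real v * (ln (real n))\<^sup>2 \<le> real n" by real_asymp
  moreover have "\<forall>\<^sub>F n in sequentially. max 10 v \<le> n" by (rule eventually_ge_at_top)
  ultimately have "\<forall>\<^sub>F n in sequentially. hamiltonian_prob H n (p n) \<le> g n"
    using le
  proof eventually_elim
    case (elim n)
    interpret copies_host H n using H elim by unfold_locales (auto simp: v_def)
    define LL where "LL = ln (ln (real n))"
    define M where "M = ln (real n) + real_of_int (delta 2 H) * LL - x n"
    have m1: "0 < real (m1 H n)" using m1_pos by simp
    have pm: "p_minus 2 H x n = M / real (m1 H n)" by (simp add: p_minus_def M_def LL_def)
    have xb: "0 \<le> x n" "x n \<le> LL / 2" "0 \<le> LL" "LL \<le> ln (real n)" "2 \<le> ln (real n)"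
      using elim by (auto simp: LL_def)
    \<comment> \<open>Here \<open>x n \<le> LL / 2\<close> enters: it keeps \<open>M\<close> of the
      order of \<open>ln n\<close>, and \<open>ln n / M \<le> 2\<close> is the factor 2 in
      \<open>g\<close>.\<close>
    have Mb: "ln (real n) / 2 \<le> M" "M \<le> 2 * ln (real n)"
      using xb unfolding M_def delta_2 by (auto split: if_splits)
    have M1: "1 \<le> M" using Mb xb by linarith
    have Mp: "M = real (m1 H n) * (M / real (m1 H n))" using m1 by simp
    have "M\<^sup>2 \<le> (2 * ln (real n))\<^sup>2" using M1 Mb by (intro power_mono) auto
    then have "2 * real v * M\<^sup>2 \<le> 2 * real v * (2 * ln (real n))\<^sup>2" by (intro mult_left_mono) auto
    also have "\<dots> = 8 * real v * (ln (real n))\<^sup>2" by (simp add: power2_eq_square)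
    also have "\<dots> \<le> real n" by fact
    finally have M2: "2 * real (card (verts H)) * M\<^sup>2 \<le> real n" by (simp add: v_def)
    have p0: "0 \<le> M / real (m1 H n)" using M1 m1 by simp
    note b = small_p_bounds[OF p0 Mp M1 M2]
    have n0: "0 < real n" using n by simp
    have "hamiltonian_prob H n (p n)
      \<le> hamiltonian_prob H n (M / real (m1 H n))"
    proof (rule prob_hamiltonian_mono[OF p])
      show "p n \<le> M / real (m1 H n)" using elim pm by simp
      show "M / real (m1 H n) \<le> 1" using b(2) by linarith
    qed
    also have "\<dots> \<le> (if 2 \<le> min_degree H then exp (M + 1) / real n else real (card (verts H)) * exp (M + 1) / (real n * M))
      + (((real (card (verts H))) ^ 3 / real n + 1) * exp (2 * real (card (verts H)) * M / real n) - 1)"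
      by (rule prob_hamiltonian_small[OF p0 Mp M1 M2])
    also have "\<dots> \<le> g n"
      unfolding g_def v_def[symmetric]
    proof (intro add_mono diff_right_mono mult_left_mono)
      have "2 * real v * M \<le> 2 * real v * (2 * ln (real n))" using Mb by (intro mult_left_mono) auto
      then have "2 * real v * M / real n \<le> 4 * real v * ln (real n) / real n"
        using n0 by (intro divide_right_mono) auto
      then show "exp (2 * real v * M / real n) \<le> exp (4 * real v * ln (real n) / real n)" by simp
      have v2: "2 \<le> real v" using v_ge_2 by (simp add: v_def)
      show "(if 2 \<le> min_degree H then exp (M + 1) / real n else real v * exp (M + 1) / (real n * M))
        \<le> 2 * real v * exp 1 * exp (- x n)"
      proof (cases "2 \<le> min_degree H")
        case True
        have "exp (M + 1) / real n = exp 1 * exp (- x n)"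
          using n0 True by (simp add: M_def delta_2 exp_add exp_diff exp_minus field_simps)
        also have "\<dots> \<le> (2 * real v * exp 1) * exp (- x n)"
          using v2 by (intro mult_right_mono) auto
        finally show ?thesis using True by simp
      next
        case False
        have "exp M = real n * ln (real n) * exp (- x n)"
        proof -
          have "M = ln (real n) + LL + - x n" using False by (simp add: M_def delta_2)
          moreover have "exp LL = ln (real n)" using xb by (simp add: LL_def)
          ultimately show ?thesis using n0 by (simp only: exp_add exp_ln)
        qed
        then have "real v * exp (M + 1) / (real n * M) = real v * exp 1 * exp (- x n) * (ln (real n) / M)"
          using n0 M1 by (simp add: exp_add field_simps)
        also have "\<dots> \<le> real v * exp 1 * exp (- x n) * 2"
          using Mb(1) M1 by (intro mult_left_mono) (auto simp: divide_le_eq)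
        finally show ?thesis using False by simp
      qed
    qed simp
    finally show ?case .
  qed
  then show ?thesis
    by (intro tendsto_sandwich[OF _ _ tendsto_const g0]) auto
qed

section \<open>The limit above the threshold\<close>

lemma hamiltonian_above_threshold:
  fixes H :: "'a graph" and p x :: "nat \<Rightarrow> real"
  assumes H: "simple_graph H" "\<not> (\<exists>v. isolated H v)"
    and x: "filterlim x at_top sequentially" "x \<in> o(\<lambda>n. ln (ln (real n)))"
    and p: "\<And>n. p n \<le> 1"
    and ge: "\<forall>\<^sub>F n in sequentially. p_plus 2 H x n \<le> p n"
  shows "(\<lambda>n. hamiltonian_prob H n (p n)) \<longlonglongrightarrow> 1"
proof -
  define v where "v = card (verts H)"
  \<comment> \<open>The first round gets only half of \<open>x n\<close>; the other half becomes the
    parameter \<open>r\<close> of the second round, so that \<open>p_plus\<close> is exactly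
    \<open>p1 + r\<close>.\<close>
  define M where "M = (\<lambda>n. ln (real n) + real_of_int (delta 2 H) * ln (ln (real n)) + x n / 2)"
  \<comment> \<open>12 is the factor 4 of \<open>prob_not_expander\<close> times the bound 3 for
    \<open>M n / ln n\<close>; 64 is the 32 of \<open>prob_sprinkle\<close> times 2 for the halving
    of \<open>x n\<close>.\<close>
  define g where "g = (\<lambda>n. failure_bound v (M n) + 12 * exp (- (x n / 2)) + 32 * exp (- (x n / (64 * real v))))"
  have v0: "0 < v" using H by (auto simp: v_def simple_graph_def card_gt_0_iff)
  have decay: "(\<lambda>n. exp (- (x n / c))) \<longlonglongrightarrow> 0" if "0 < c" for c :: real
  proof (rule filterlim_compose[OF exp_at_bot])
    have "filterlim (\<lambda>n. (1 / c) * x n) at_top sequentially"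
      by (rule filterlim_tendsto_pos_mult_at_top[OF tendsto_const _ x(1)]) (use that in simp)
    then show "filterlim (\<lambda>n. - (x n / c)) at_bot sequentially" by (simp add: filterlim_uminus_at_bot)
  qed
  have "\<forall>\<^sub>F n in sequentially. norm (x n) \<le> 1/2 * norm (ln (ln (real n)))"
    by (rule landau_o.smallD[OF x(2)]) simp
  moreover have "\<forall>\<^sub>F n in sequentially. 0 \<le> x n" using x(1) by (simp add: filterlim_at_top)
  moreover have "\<forall>\<^sub>F n in sequentially. 0 \<le> ln (ln (real n)) \<and> ln (ln (real n)) \<le> ln (real n) \<and> 2 \<le> ln (real n)"
    by (intro eventually_conj) real_asymp+
  ultimately have bounds: "\<forall>\<^sub>F n in sequentially. 0 \<le> x n \<and> 2 \<le> ln (real n) \<and> 0 \<le> ln (ln (real n)) \<and>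
      x n \<le> ln (real n) \<and> ln (ln (real n)) \<le> ln (real n)"
    by eventually_elim auto
  have host: "\<forall>\<^sub>F n in sequentially. copies_host H n"
    using eventually_ge_at_top[of "max 10 v"]
    by eventually_elim (use H in \<open>auto simp: copies_host_def v_def\<close>)
  have Mb: "\<forall>\<^sub>F n in sequentially. ln (real n) \<le> M n \<and> M n \<le> 3 * ln (real n)"
    using bounds host
    by eventually_elim (auto simp: M_def copies_host.delta_2)
  have Mtop: "filterlim M at_top sequentially"
  proof (rule filterlim_at_top_mono)
    show "filterlim (\<lambda>n. ln (real n)) at_top sequentially" by real_asymp
    show "\<forall>\<^sub>F n in sequentially. ln (real n) \<le> M n" using Mb by eventually_elim simp
  qed
  have "g \<longlonglongrightarrow> 0 + 12 * 0 + 32 * 0"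
    unfolding g_def using v0
    by (intro tendsto_add tendsto_mult tendsto_const decay filterlim_compose[OF failure_bound_tendsto Mtop]) auto
  then have g0: "g \<longlonglongrightarrow> 0" by simp
  have "\<forall>\<^sub>F m in at_top. exp (real v + 1) / m \<le> 1 / 2" by real_asymp
  then have s1: "\<forall>\<^sub>F n in sequentially. exp (real v + 1) / M n \<le> 1 / 2"
    by (rule eventually_compose_filterlim[OF _ Mtop])
  have "((\<lambda>m. 343 * exp 2 * m ^ 9 * exp (- m / (2 * real v))) \<longlongrightarrow> 0) at_top" using v0 by real_asymp
  then have "\<forall>\<^sub>F m in at_top. 343 * exp 2 * m ^ 9 * exp (- m / (2 * real v)) < 1 / 2"
    by (rule order_tendstoD) simp
  then have s2: "\<forall>\<^sub>F n in sequentially. 343 * exp 2 * M n ^ 9 * exp (- M n / (2 * real v)) < 1 / 2"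
    by (rule eventually_compose_filterlim[OF _ Mtop])
  have s3: "\<forall>\<^sub>F n in sequentially. real v * (3 * ln (real n)) \<le> real n" by real_asymp
  have s4: "\<forall>\<^sub>F n in sequentially. 32 * exp (- (x n / (64 * real v))) < 1"
  proof (rule order_tendstoD)
    have "(\<lambda>n. 32 * exp (- (x n / (64 * real v)))) \<longlonglongrightarrow> 32 * 0"
      using v0 by (intro tendsto_mult tendsto_const decay) simp
    then show "(\<lambda>n. 32 * exp (- (x n / (64 * real v)))) \<longlonglongrightarrow> 0" by simp
  qed simp
  have "\<forall>\<^sub>F n in sequentially. 1 - g n \<le> hamiltonian_prob H n (p n)"
    using bounds host Mb s1 s2 s3 s4 ge
  proof eventually_elim
    case (elim n)
    interpret copies_host H n by fact
    have m1: "0 < real (m1 H n)" using m1_pos by simp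
    have n0: "0 < real n" using n by simp
    define p1 where "p1 = M n / real (m1 H n)"
    define r where "r = x n / 2 / real (m1 H n)"
    have M1: "1 \<le> M n" using elim by linarith
    have Mp: "M n = real (m1 H n) * p1" using m1 by (simp add: p1_def)
    have xr: "real (m1 H n) * r = x n / 2" using m1 by (simp add: r_def)
    have "p_plus 2 H x n = p1 + r"
      unfolding p_plus_def p1_def r_def add_divide_distrib[symmetric] by (simp add: M_def)
    then have pr: "p1 + r \<le> p n" using elim by simp
    have p1: "0 \<le> p1" using M1 m1 by (simp add: p1_def)
    have r0: "0 \<le> r" using elim m1 by (simp add: r_def)
    have p1': "p1 \<le> 1" using pr r0 p[of n] by linarith
    have vM: "real (card (verts H)) * M n \<le> real n"
    proof -
      have "real v * M n \<le> real v * (3 * ln (real n))" using elim by (intro mult_left_mono) auto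
      then show ?thesis using elim by (simp add: v_def)
    qed
    have "exp (ln (real n)) \<le> exp (M n)" using elim by (simp only: exp_le_cancel_iff)
    then have nM: "real n \<le> exp (M n)" using n0 by simp
    have "1 - hamiltonian_prob H n (p n)
      \<le> subset_prob A p1 {S. \<not> expander V (E S)}
        + (32 * exp (- (real (m1 H n) * r) / (32 * real (card (verts H))))) ^ n"
      by (rule prob_hamiltonian_ge[OF p1 r0 pr p])
    also have "subset_prob A p1 {S. \<not> expander V (E S)}
      \<le> failure_bound (card (verts H)) (M n) + (if 2 \<le> min_degree H then real n * exp (- M n) else 4 * (real n * M n * exp (- M n)))"
      by (rule prob_not_expander[OF p1 p1' Mp M1 vM nM]) (use elim in \<open>auto simp: v_def\<close>)
    also have "(if 2 \<le> min_degree H then real n * exp (- M n) else 4 * (real n * M n * exp (- M n))) \<le> 12 * exp (- (x n / 2))"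
    proof (cases "2 \<le> min_degree H")
      case True
      have "- M n = - ln (real n) + - (x n / 2)" using True by (simp add: M_def delta_2)
      then have "exp (- M n) = exp (- ln (real n)) * exp (- (x n / 2))" by (simp only: exp_add)
      then have "real n * exp (- M n) = exp (- (x n / 2))"
        using n0 by (simp add: exp_minus[of "ln (real n)"])
      then show ?thesis using True by simp
    next
      case False
      have l0: "0 < ln (real n)" using elim by linarith
      have "- M n = - ln (real n) + - ln (ln (real n)) + - (x n / 2)" using False by (simp add: M_def delta_2)
      then have "exp (- M n) = exp (- ln (real n)) * exp (- ln (ln (real n))) * exp (- (x n / 2))"
        by (simp only: exp_add)
      moreover have "exp (- ln (real n)) = 1 / real n" "exp (- ln (ln (real n))) = 1 / ln (real n)"
        using n0 l0 by (simp_all add: exp_minus inverse_eq_divide)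
      ultimately have "exp (- M n) = 1 / real n * (1 / ln (real n)) * exp (- (x n / 2))" by (simp only:)
      then have "real n * M n * exp (- M n) = M n / ln (real n) * exp (- (x n / 2))"
        using n0 by simp
      also have "\<dots> \<le> 3 * exp (- (x n / 2))"
        using elim l0 by (intro mult_right_mono) (auto simp: divide_le_eq)
      finally show ?thesis using False by (simp add: mult_ac)
    qed
    also have "(32 * exp (- (real (m1 H n) * r) / (32 * real (card (verts H))))) ^ n \<le> 32 * exp (- (x n / (64 * real v)))"
    proof -
      have "- (real (m1 H n) * r) / (32 * real (card (verts H))) = - (x n / (64 * real v))"
        unfolding xr by (simp add: v_def)
      \<comment> \<open>The base is below one, so the \<open>n\<close>-th power is at most the base
        itself, which tends to 0 with \<open>x n\<close> tending to infinity.\<close>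
      moreover have "(32 * exp (- (x n / (64 * real v)))) ^ n \<le> (32 * exp (- (x n / (64 * real v)))) ^ 1"
      proof (rule power_decreasing)
        show "32 * exp (- (x n / (64 * real v))) \<le> 1" using \<open>32 * exp (- (x n / (64 * real v))) < 1\<close> by (rule less_imp_le)
      qed (use n(2) in simp_all)
      ultimately show ?thesis by simp
    qed
    finally show ?case by (simp add: g_def v_def)
  qed
  then have lower: "\<forall>\<^sub>F n in sequentially. 1 - g n \<le> hamiltonian_prob H n (p n)" .
  have "(\<lambda>n. 1 - g n) \<longlonglongrightarrow> 1 - 0" by (intro tendsto_diff tendsto_const g0)
  then have lim: "(\<lambda>n. 1 - g n) \<longlonglongrightarrow> 1" by simp
  show ?thesis
    by (rule tendsto_sandwich[OF lower always_eventually lim tendsto_const]) simp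
qed

theorem theorem6:
  fixes H :: "'a graph" and p x :: "nat \<Rightarrow> real"
  assumes "simple_graph H"
    and "\<not> (\<exists>v. isolated H v)"
    and "filterlim x at_top sequentially"
    and "x \<in> o(\<lambda>n. ln (ln (real n)))"
    and "\<forall>n. 0 \<le> p n \<and> p n \<le> 1"
  shows "((\<forall>\<^sub>F n in sequentially. p n \<le> p_minus 2 H x n) \<longrightarrow>
            (\<lambda>n. measure_pmf.prob (random_graph H n (p n)) {G. hamiltonian G}) \<longlonglongrightarrow> 0) \<and>
         ((\<forall>\<^sub>F n in sequentially. p n \<ge> p_plus 2 H x n) \<longrightarrow>
            (\<lambda>n. measure_pmf.prob (random_graph H n (p n)) {G. hamiltonian G}) \<longlonglongrightarrow> 1)"
  using hamiltonian_below_threshold[OF assms(1-4)] hamiltonian_above_threshold[OF assms(1-4)] assms(5)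
  by simp

end
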